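(* Let $0<\alpha\le\frac14$ and $\delta\in[0,\alpha)$, and set $$s(\delta)=\begin{cases}\frac12-\alpha+2\delta, & 0\le\delta<\frac{\alpha}{2},\\ \frac{\delta}{\alpha}, & \delta\ge\frac{\alpha}{2}.\end{cases}$$ (i) Let $\gamma:\mathbb{R}\times[-1,1]\to\mathbb{R}$ be any continuous map with $\gamma(x,0)=x$ for all $x$ which is bilipschitz continuous in $x$ (uniformly in $t$) and $\alpha$-Hölder continuous in $t$ (uniformly in $x$). Then for every $s>s(\delta)$ and every $f\in H^s(\mathbb{R})$, $$\lim_{t\to0^+}\frac{U_\gamma f(x,t)-f(x)}{t^\delta}=0\quad\text{for a.e. }x\in\mathbb{R}.$$ (ii) Conversely, there exists a map $\gamma$ satisfying all the assumptions in (i) such that for every $s<s(\delta)$ the statement "for every $f\in H^s(\mathbb{R})$, $\lim_{t\to0^+}\frac{U_\gamma f(x,t)-f(x)}{t^\delta}=0$ for a.e. $x\in\mathbb{R}$" is false.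
   Context: For a map $\gamma:\mathbb{R}\times[-1,1]\to\mathbb{R}$, define $$U_\gamma f(x,t)=\frac{1}{2\pi}\int_{\mathbb{R}}e^{i(\gamma(x,t)\xi+t|\xi|^2)}\widehat f(\xi)\,d\xi,\qquad \widehat f(\xi)=\int_{\mathbb{R}}e^{-ix\xi}f(x)\,dx.$$ When $\widehat f$ is not integrable, the integral is understood as the limit, as $N\to\infty$ through powers of $2$, of the integrals over $\{|\xi|\le N\}$; $f(x)$ is understood as $U_\gamma f(x,0)$. Bilipschitz continuous in $x$: there are constants $C_1,C_2>0$ with $\frac{1}{C_1}|x-x'|\le|\gamma(x,t)-\gamma(x',t)|\le C_2|x-x'|$ for all $t\in[-1,1]$, $x,x'\in\mathbb{R}$. $\alpha$-Hölder continuous in $t$: there is a constant $C_3>0$ with $|\gamma(x,t)-\gamma(x,t')|\le C_3|t-t'|^\alpha$ for all $x\in\mathbb{R}$, $t,t'\in[-1,1]$. $H^s(\mathbb{R})$ is the $L^2$-based Sobolev space with norm $\|(1+|\xi|^2)^{s/2}\widehat f\|_{L^2}$. *)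

theory Defs
  imports "HOL-Analysis.Analysis"
begin

definition nderiv :: "nat \<Rightarrow> (real \<Rightarrow> complex) \<Rightarrow> real \<Rightarrow> complex" where
  "nderiv k = (\<lambda>\<phi> x. vector_derivative \<phi> (at x)) ^^ k"

definition schwartz :: "(real \<Rightarrow> complex) set" where
  "schwartz = {\<phi>. (\<forall>k x. nderiv k \<phi> differentiable (at x)) \<and>
                  (\<forall>j k. bounded (range (\<lambda>x. x ^ j *\<^sub>R nderiv k \<phi> x)))}"

definition schwartz_norm :: "nat \<Rightarrow> (real \<Rightarrow> complex) \<Rightarrow> real" where
  "schwartz_norm n \<phi> = (\<Sum>j\<le>n. \<Sum>k\<le>n. SUP x. norm (x ^ j *\<^sub>R nderiv k \<phi> x))"

text \<open>A distribution is a functional of which only the values on \<^const>\<open>schwartz\<close> matter.\<close>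

type_synonym distribution = "(real \<Rightarrow> complex) \<Rightarrow> complex"

definition tempered :: "distribution \<Rightarrow> bool" where
  "tempered f \<longleftrightarrow>
     (\<forall>\<phi>\<in>schwartz. \<forall>\<psi>\<in>schwartz. \<forall>a b. f (\<lambda>x. a * \<phi> x + b * \<psi> x) = a * f \<phi> + b * f \<psi>) \<and>
     (\<exists>C n. \<forall>\<phi>\<in>schwartz. cmod (f \<phi>) \<le> C * schwartz_norm n \<phi>)"

definition fourier :: "(real \<Rightarrow> complex) \<Rightarrow> real \<Rightarrow> complex" where
  "fourier \<phi> \<xi> = (LINT x|lborel. exp (- \<i> * of_real (x * \<xi>)) * \<phi> x)"

text \<open>The distributional Fourier transform of \<open>f\<close>, that is \<open>\<lambda>\<phi>. f (fourier \<phi>)\<close>, is given by the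
  function \<open>g\<close>.\<close>

definition fourier_is_fun :: "distribution \<Rightarrow> (real \<Rightarrow> complex) \<Rightarrow> bool" where
  "fourier_is_fun f g \<longleftrightarrow> g \<in> borel_measurable lborel \<and>
     (\<forall>\<phi>\<in>schwartz. integrable lborel (\<lambda>\<xi>. g \<xi> * \<phi> \<xi>) \<and>
                   f (fourier \<phi>) = (LINT \<xi>|lborel. g \<xi> * \<phi> \<xi>))"

text \<open>Such a function is unique up to a null set, so the choice of representative affects neither
  membership in the Sobolev spaces nor any of the integrals below.\<close>

definition fhat :: "distribution \<Rightarrow> real \<Rightarrow> complex" where
  "fhat f = (SOME g. fourier_is_fun f g)"

text \<open>The order \<open>s\<close> may be negative, in which case the elements need not be functions.\<close>

definition sobolev :: "real \<Rightarrow> distribution set" where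
  "sobolev s = {f. tempered f \<and> (\<exists>g. fourier_is_fun f g) \<and>
     integrable lborel (\<lambda>\<xi>. (norm ((1 + \<bar>\<xi>\<bar>\<^sup>2) powr (s / 2) *\<^sub>R fhat f \<xi>))\<^sup>2)}"

text \<open>Only the values of the curve on \<open>UNIV \<times> {-1..1}\<close> matter.\<close>

definition admissible_curve :: "real \<Rightarrow> (real \<times> real \<Rightarrow> real) \<Rightarrow> bool" where
  "admissible_curve \<alpha> \<gamma> \<longleftrightarrow>
     continuous_on (UNIV \<times> {-1..1}) \<gamma> \<and>
     (\<forall>x. \<gamma> (x, 0) = x) \<and>
     (\<exists>C1>0. \<exists>C2>0. \<forall>t\<in>{-1..1}. \<forall>x x'.
        1 / C1 * \<bar>x - x'\<bar> \<le> \<bar>\<gamma> (x, t) - \<gamma> (x', t)\<bar> \<and>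
        \<bar>\<gamma> (x, t) - \<gamma> (x', t)\<bar> \<le> C2 * \<bar>x - x'\<bar>) \<and>
     (\<exists>C3>0. \<forall>x. \<forall>t\<in>{-1..1}. \<forall>t'\<in>{-1..1}.
        \<bar>\<gamma> (x, t) - \<gamma> (x, t')\<bar> \<le> C3 * \<bar>t - t'\<bar> powr \<alpha>)"

definition U_integrand ::
  "(real \<times> real \<Rightarrow> real) \<Rightarrow> distribution \<Rightarrow> real \<Rightarrow> real \<Rightarrow> real \<Rightarrow> complex" where
  "U_integrand \<gamma> f x t \<xi> = exp (\<i> * of_real (\<gamma> (x, t) * \<xi> + t * \<bar>\<xi>\<bar>\<^sup>2)) * fhat f \<xi>"

definition U_partial ::
  "(real \<times> real \<Rightarrow> real) \<Rightarrow> distribution \<Rightarrow> real \<Rightarrow> real \<Rightarrow> nat \<Rightarrow> complex" where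
  "U_partial \<gamma> f x t k =
     1 / (2 * of_real pi) * (LINT \<xi>:{\<xi>. \<bar>\<xi>\<bar> \<le> 2 ^ k}|lborel. U_integrand \<gamma> f x t \<xi>)"

definition U ::
  "(real \<times> real \<Rightarrow> real) \<Rightarrow> distribution \<Rightarrow> real \<Rightarrow> real \<Rightarrow> complex" where
  "U \<gamma> f x t =
     (if integrable lborel (fhat f)
      then 1 / (2 * of_real pi) * (LINT \<xi>|lborel. U_integrand \<gamma> f x t \<xi>)
      else lim (U_partial \<gamma> f x t))"

text \<open>\<^const>\<open>lim\<close> is total, so whether \<^const>\<open>U\<close> has a meaning at a point is tracked separately.\<close>

definition U_defined ::
  "(real \<times> real \<Rightarrow> real) \<Rightarrow> distribution \<Rightarrow> real \<Rightarrow> real \<Rightarrow> bool" where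
  "U_defined \<gamma> f x t \<longleftrightarrow> integrable lborel (fhat f) \<or> convergent (U_partial \<gamma> f x t)"

text \<open>The assertion that \<open>(U \<gamma> f x t - f x) / t powr \<delta>\<close> tends to 0 as \<open>t\<close> decreases to 0. It includes
  that the terms are defined; \<open>f x\<close> stands for \<open>U \<gamma> f x 0\<close>.\<close>

definition converges_with_rate ::
  "(real \<times> real \<Rightarrow> real) \<Rightarrow> real \<Rightarrow> distribution \<Rightarrow> real \<Rightarrow> bool" where
  "converges_with_rate \<gamma> \<delta> f x \<longleftrightarrow>
     U_defined \<gamma> f x 0 \<and>
     (\<forall>\<^sub>F t in at_right 0. U_defined \<gamma> f x t) \<and>
     ((\<lambda>t. (U \<gamma> f x t - U \<gamma> f x 0) / of_real (t powr \<delta>)) \<longlongrightarrow> 0) (at_right 0)"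

definition s_crit :: "real \<Rightarrow> real \<Rightarrow> real" where
  "s_crit \<alpha> \<delta> = (if \<delta> < \<alpha> / 2 then 1 / 2 - \<alpha> + 2 * \<delta> else \<delta> / \<alpha>)"

end

theory Submission
  imports Defs "HOL-Probability.Probability"
begin

text \<open>
  Convergence: decompose the frequencies dyadically and estimate the maximal function of
  \<open>t powr (- \<delta>) * (U f x t - U f x 0)\<close> on each block \<open>N < \<bar>\<xi>\<bar> \<le> 2 * N\<close> by the TT* method. Since
  the phase is quadratic in \<open>\<xi>\<close>, the first and second derivative tests bound the kernel, with sharp
  cutoffs, by \<open>1 / \<bar>x - y\<bar>\<close> unless \<open>\<bar>x - y\<bar>\<close> is at most a constant times \<open>N * \<bar>s - t\<bar>\<close> or
  \<open>\<bar>s - t\<bar> powr \<alpha>\<close>, in which case it is at most \<open>N\<close> and \<open>\<bar>s - t\<bar> powr (- 1 / 2)\<close>. Losing an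
  arbitrarily small power of \<open>N\<close>, every kernel is dominated by the single integrable kernel
  \<open>\<bar>x - y\<bar> powr (- \<kappa>)\<close> with \<open>\<kappa> < 1\<close>. The block norms are then summable above the critical exponent.

  Sharpness: take \<open>\<gamma> (x, t) = x + \<bar>t\<bar> powr \<alpha>\<close> and let the Fourier transform of \<open>f\<close> be a lacunary
  sum of combs, that is of indicator functions of unit intervals starting at odd multiples of \<open>R\<close>. For
  every \<open>x\<close> there are two times of size \<open>R powr (- 1 / \<alpha>)\<close> at which \<open>\<gamma> (x, t) * R\<close> is an even and an
  odd multiple of \<open>pi\<close>. At these times all teeth of the comb are aligned with opposite signs, so the two
  values cannot both be close to \<open>f x\<close>.
\<close>

section \<open>Oscillatory integrals with quadratic phase\<close>

text \<open>The two branches of \<open>s_crit\<close> are the two ends of a range of time scales. At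
  frequency \<open>N\<close> and times of size \<open>T\<close> between
  \<open>N powr (- 1 / \<alpha>)\<close> and \<open>N powr (- 2)\<close>, the squared weight
  \<open>T powr (- 2 * \<delta>)\<close> meets a kernel constant close to
  \<open>N * T powr \<alpha>\<close>. The product is a power of \<open>T\<close>, hence largest at
  an end: \<open>N powr (- 2)\<close> costs \<open>1 / 2 - \<alpha> + 2 * \<delta>\<close>
  derivatives, \<open>N powr (- 1 / \<alpha>)\<close> costs \<open>\<delta> / \<alpha>\<close>, and
  these agree at \<open>\<delta> = \<alpha> / 2\<close>. Below the range the weight is unbounded,
  but the phase has moved only boundedly since time 0, so, as \<open>\<delta> < \<alpha>\<close>,
  the weighted difference of propagators is a smooth amplitude of size
  \<open>N powr (\<delta> / \<alpha>)\<close>. The combs realize the costly end: their aligned times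
  are comparable to \<open>N powr (- 2)\<close> in the first branch and to
  \<open>N powr (- 1 / \<alpha>)\<close> in the second. Data are distributions and
  \<open>fhat\<close> is an arbitrary representative, so turning a prescribed comb into
  \<open>fhat f\<close> takes both inversion and uniqueness of the Fourier transform.\<close>

lemma has_vector_derivative_cis_quadratic:
  "((\<lambda>\<xi>. cis (a * \<xi> + \<tau> * \<xi>\<^sup>2)) has_vector_derivative
     (\<i> * of_real (a + 2 * \<tau> * \<xi>) * cis (a * \<xi> + \<tau> * \<xi>\<^sup>2))) (at \<xi> within S)"
  unfolding cis_conv_exp
  by (auto intro!: derivative_eq_intros has_vector_derivative_real_field simp: field_simps)

text \<open>The phase derivative is affine and keeps away from 0, so its reciprocal is monotone on
  the interval. After one integration by parts the two boundary terms give \<open>2 / \<mu>\<close>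
  and the variation of the reciprocal gives at most another \<open>2 / \<mu>\<close>.\<close>

lemma osc_first:
  fixes a \<tau> p q \<mu> :: real
  assumes pq: "p \<le> q" and lam: "\<mu> > 0" and lower: "\<And>\<xi>. \<xi> \<in> {p..q} \<Longrightarrow> \<mu> \<le> \<bar>a + 2 * \<tau> * \<xi>\<bar>"
  shows "cmod (integral {p..q} (\<lambda>\<xi>. cis (a * \<xi> + \<tau> * \<xi>\<^sup>2))) \<le> 4 / \<mu>"
proof -
  define d where "d = (\<lambda>\<xi>. a + 2 * \<tau> * \<xi>)"
  define c where "c = (\<lambda>\<xi>. cis (a * \<xi> + \<tau> * \<xi>\<^sup>2))"
  have d0: "d \<xi> \<noteq> 0" if "\<xi> \<in> {p..q}" for \<xi>
    using lower[OF that] lam by (auto simp: d_def)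
  have sq: "1 / \<bar>d \<xi>\<bar> \<le> 1 / \<mu>" if "\<xi> \<in> {p..q}" for \<xi>
    using lower[OF that] lam by (auto simp: d_def intro!: divide_left_mono mult_pos_pos)
  have c_der: "(c has_vector_derivative (\<i> * of_real (d \<xi>) * c \<xi>)) (at \<xi> within {p..q})" for \<xi>
    unfolding c_def d_def by (rule has_vector_derivative_cis_quadratic)
  have rd_der: "((\<lambda>\<xi>. - 1 / d \<xi>) has_real_derivative (2 * \<tau> / (d \<xi>)\<^sup>2)) (at \<xi> within {p..q})"
    if "\<xi> \<in> {p..q}" for \<xi>
    using d0[OF that] unfolding d_def
    by (auto intro!: derivative_eq_intros simp: power2_eq_square)
  have I1: "((\<lambda>\<xi>. 2 * \<tau> / (d \<xi>)\<^sup>2) has_integral (- 1 / d q - - 1 / d p)) {p..q}"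
    by (rule fundamental_theorem_of_calculus[OF pq])
       (use rd_der in \<open>auto simp: has_real_derivative_iff_has_vector_derivative\<close>)
  have cont: "continuous_on {p..q} d" "continuous_on {p..q} c"
    unfolding d_def c_def by (auto intro!: continuous_intros)
  \<comment> \<open>The function \<open>c - r\<close> is the derivative of
    \<open>c / (\<i> * d)\<close>, so \<open>r\<close> is what remains of \<open>c\<close> after the
    boundary terms.\<close>
  define r where "r = (\<lambda>\<xi>. c \<xi> * of_real (2 * \<tau> / (d \<xi>)\<^sup>2) / \<i>)"
  have r_int: "r integrable_on {p..q}"
    unfolding r_def using d0 cont
    by (intro integrable_continuous_real continuous_intros) auto
  have F: "((\<lambda>\<xi>. c \<xi> - r \<xi>) has_integral (c q / (\<i> * d q) - c p / (\<i> * d p))) {p..q}"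
  proof (rule fundamental_theorem_of_calculus[OF pq])
    fix \<xi> assume \<xi>: "\<xi> \<in> {p..q}"
    have "((\<lambda>\<xi>. c \<xi> * (\<i> * of_real (- 1 / d \<xi>))) has_vector_derivative
        (c \<xi> * (\<i> * of_real (2 * \<tau> / (d \<xi>)\<^sup>2)) + \<i> * of_real (d \<xi>) * c \<xi> * (\<i> * of_real (- 1 / d \<xi>))))
        (at \<xi> within {p..q})"
      by (intro has_vector_derivative_mult c_der has_vector_derivative_mult_right
           has_vector_derivative_of_real)
         (use rd_der[OF \<xi>] in \<open>simp add: has_real_derivative_iff_has_vector_derivative\<close>)
    moreover have "(\<lambda>\<xi>. c \<xi> * (\<i> * of_real (- 1 / d \<xi>))) = (\<lambda>\<xi>. c \<xi> / (\<i> * d \<xi>))"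
    proof
      fix x show "c x * (\<i> * of_real (- 1 / d x)) = c x / (\<i> * d x)"
        by (cases "d x = 0") (auto simp: field_simps)
    qed
    moreover have "c \<xi> * (\<i> * of_real (2 * \<tau> / (d \<xi>)\<^sup>2)) + \<i> * of_real (d \<xi>) * c \<xi> * (\<i> * of_real (- 1 / d \<xi>))
        = c \<xi> - r \<xi>"
      using d0[OF \<xi>] by (simp add: r_def field_simps)
    ultimately show "((\<lambda>\<xi>. c \<xi> / (\<i> * d \<xi>)) has_vector_derivative c \<xi> - r \<xi>) (at \<xi> within {p..q})"
      by simp
  qed
  have cc: "c integrable_on {p..q}"
    using cont by (intro integrable_continuous_real)
  have "integral {p..q} c = integral {p..q} (\<lambda>\<xi>. c \<xi> - r \<xi>) + integral {p..q} r"
    using integral_diff[OF cc r_int] by simp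
  also have "\<dots> = (c q / (\<i> * d q) - c p / (\<i> * d p)) + integral {p..q} r"
    using F by (simp add: integral_unique)
  finally have eq: "integral {p..q} c = (c q / (\<i> * d q) - c p / (\<i> * d p)) + integral {p..q} r" .
  have ends: "cmod (c q / (\<i> * d q)) \<le> 1 / \<mu>" "cmod (c p / (\<i> * d p)) \<le> 1 / \<mu>"
    using sq[of q] sq[of p] pq by (auto simp: norm_divide norm_mult c_def)
  \<comment> \<open>The factor \<open>sgn \<tau>\<close> gives the integrand one sign, so that the
    bound for \<open>r\<close> integrates exactly by \<open>I1\<close>.\<close>
  have "cmod (integral {p..q} r) \<le> integral {p..q} (\<lambda>\<xi>. sgn \<tau> * (2 * \<tau> / (d \<xi>)\<^sup>2))"
  proof (rule integral_norm_bound_integral[OF r_int])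
    show "(\<lambda>\<xi>. sgn \<tau> * (2 * \<tau> / (d \<xi>)\<^sup>2)) integrable_on {p..q}"
      by (rule integrable_on_mult_right[OF has_integral_integrable[OF I1]])
    show "cmod (r \<xi>) \<le> sgn \<tau> * (2 * \<tau> / (d \<xi>)\<^sup>2)" for \<xi>
      by (auto simp: r_def norm_mult norm_divide c_def norm_power sgn_if abs_if)
  qed
  also have "\<dots> = sgn \<tau> * (1 / d p - 1 / d q)"
    using integral_unique[OF has_integral_mult_right[OF I1, of "sgn \<tau>"]] by simp
  also have "\<dots> \<le> 1 / \<bar>d p\<bar> + 1 / \<bar>d q\<bar>"
  proof -
    have "sgn \<tau> * (1 / d p - 1 / d q) \<le> \<bar>1 / d p - 1 / d q\<bar>" by (auto simp: sgn_if abs_if)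
    also have "\<dots> \<le> \<bar>1 / d p\<bar> + \<bar>1 / d q\<bar>" by (rule abs_triangle_ineq4)
    finally show ?thesis by simp
  qed
  also have "\<dots> \<le> 2 / \<mu>" using sq[of p] sq[of q] pq by simp
  finally have "cmod (integral {p..q} r) \<le> 2 / \<mu>" .
  then have "cmod (integral {p..q} c) \<le> (1 / \<mu> + 1 / \<mu>) + 2 / \<mu>"
    unfolding eq using ends by (intro norm_triangle_le add_mono norm_triangle_le_diff) auto
  then show ?thesis by (simp add: c_def field_simps)
qed

text \<open>At distance at least \<open>r = 1 / sqrt \<bar>\<tau>\<bar>\<close> from the stationary
  point \<open>z\<close>, the first derivative test with
  \<open>\<mu> = 2 * sqrt \<bar>\<tau>\<bar>\<close> costs \<open>2 * r\<close> on each side, and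
  the excluded interval has length at most \<open>2 * r\<close>.\<close>

lemma osc_second:
  fixes a \<tau> p q :: real
  assumes pq: "p \<le> q" and \<tau>: "\<tau> \<noteq> 0"
  shows "cmod (integral {p..q} (\<lambda>\<xi>. cis (a * \<xi> + \<tau> * \<xi>\<^sup>2))) \<le> 6 / sqrt \<bar>\<tau>\<bar>"
proof -
  define c where "c = (\<lambda>\<xi>. cis (a * \<xi> + \<tau> * \<xi>\<^sup>2))"
  define r where "r = 1 / sqrt \<bar>\<tau>\<bar>"
  define z where "z = - a / (2 * \<tau>)"
  \<comment> \<open>Clamping to \<open>{p..q}\<close> covers every position of the stationary point
    relative to the interval; empty pieces degenerate to points.\<close>
  define p' where "p' = max p (min q (z - r))"
  define q' where "q' = max p (min q (z + r))"
  have r: "r > 0" using \<tau> by (simp add: r_def)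
  have pts: "p \<le> p'" "p' \<le> q'" "q' \<le> q" using pq r by (auto simp: p'_def q'_def)
  have ci: "c integrable_on {u..v}" for u v
    unfolding c_def by (intro integrable_continuous_real continuous_intros)
  have d: "\<bar>a + 2 * \<tau> * \<xi>\<bar> = 2 * \<bar>\<tau>\<bar> * \<bar>\<xi> - z\<bar>" for \<xi>
  proof -
    have "a + 2 * \<tau> * \<xi> = 2 * \<tau> * (\<xi> - z)" using \<tau> by (simp add: z_def field_simps)
    then show ?thesis by (simp add: abs_mult)
  qed
  define \<mu> where "\<mu> = 2 * sqrt \<bar>\<tau>\<bar>"
  have lam: "\<mu> > 0" "4 / \<mu> = 2 / sqrt \<bar>\<tau>\<bar>" using \<tau> by (auto simp: \<mu>_def)
  have lr: "2 * \<bar>\<tau>\<bar> * r = \<mu>"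
    using \<tau> real_sqrt_mult_self[of "\<bar>\<tau>\<bar>"] by (simp add: r_def \<mu>_def field_simps)
  have far: "\<mu> \<le> \<bar>a + 2 * \<tau> * \<xi>\<bar>" if "\<bar>\<xi> - z\<bar> \<ge> r" for \<xi>
    unfolding d lr[symmetric] using that \<tau> by (intro mult_left_mono) auto
  have "cmod (integral {p..p'} c) \<le> 4 / \<mu>"
  proof (cases "p' = p")
    case False
    then have "p' \<le> z - r" by (auto simp: p'_def min_def max_def split: if_splits)
    then show ?thesis unfolding c_def
      using pts lam by (intro osc_first) (auto intro!: far)
  qed (use lam in auto)
  moreover have "cmod (integral {q'..q} c) \<le> 4 / \<mu>"
  proof (cases "q' = q")
    case False
    then have "q' \<ge> z + r" using pq by (auto simp: q'_def min_def max_def split: if_splits)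
    then show ?thesis unfolding c_def
      using pts lam by (intro osc_first) (auto intro!: far)
  qed (use lam in auto)
  moreover have "cmod (integral {p'..q'} c) \<le> 1 * (q' - p')"
  proof -
    have "cmod (integral {p'..q'} c) \<le> integral {p'..q'} (\<lambda>_. 1::real)"
      by (rule integral_norm_bound_integral[OF ci]) (auto simp: c_def)
    then show ?thesis using pts by simp
  qed
  moreover have "q' - p' \<le> 2 * r" using pq r by (auto simp: p'_def q'_def)
  moreover have "integral {p..q} c = integral {p..p'} c + integral {p'..q'} c + integral {q'..q} c"
    using pts ci by (simp add: Henstock_Kurzweil_Integration.integral_combine)
  moreover have "cmod (A + B + C) \<le> cmod A + cmod B + cmod C" for A B C :: complex
    using norm_triangle_ineq[of "A + B" C] norm_triangle_ineq[of A B] by linarith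
  ultimately have "cmod (integral {p..q} c) \<le> 4 / \<mu> + 2 * r + 4 / \<mu>"
    by (smt (verit))
  then show ?thesis unfolding lam c_def by (simp add: r_def)
qed

section \<open>Maximal functions by the TT* method\<close>

lemma borel_measurable_cnj[measurable]: "cnj \<in> borel_measurable borel"
  by (intro borel_measurable_continuous_onI continuous_intros)

lemma le_one_plus_square: "c \<le> 1 + c\<^sup>2" for c :: real
proof -
  have "0 \<le> (c - 1 / 2)\<^sup>2" by simp
  also have "\<dots> = c\<^sup>2 - c + 1 / 4" by (simp add: power2_eq_square algebra_simps)
  finally show ?thesis by linarith
qed

lemma norm_integral_le_integral:
  fixes f :: "'a \<Rightarrow> 'b::{banach,second_countable_topology}"
  assumes "integrable M h" and "\<And>x. x \<in> space M \<Longrightarrow> norm (f x) \<le> h x"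
  shows "norm (\<integral>x. f x \<partial>M) \<le> (\<integral>x. h x \<partial>M)"
proof -
  have "norm (\<integral>x. f x \<partial>M) \<le> (\<integral>x. norm (f x) \<partial>M)" by (rule integral_norm_bound)
  also have "\<dots> \<le> (\<integral>x. h x \<partial>M)"
    by (rule integral_mono_AE') (use assms in \<open>auto intro: order_trans[OF norm_ge_zero]\<close>)
  finally show ?thesis .
qed

text \<open>For the operator T with kernel \<open>e\<close>, the norm of T equals that of its
  adjoint, and T T* has an integral kernel dominated by \<open>k\<close>, to which Schur's test
  applies. Finite measures and bounded \<open>e\<close> make the integrals \<open>I\<close> and
  \<open>J\<close> finite beforehand, which is what permits the absorption of \<open>J\<close> into
  \<open>I\<close>.\<close>

lemma TT_star_bound:
  fixes M :: "'a measure" and N :: "'b measure" and e :: "'a \<Rightarrow> 'b \<Rightarrow> complex"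
    and g :: "'b \<Rightarrow> complex" and k :: "'a \<Rightarrow> 'a \<Rightarrow> real"
  assumes "finite_measure M" "finite_measure N"
    and e[measurable]: "case_prod e \<in> borel_measurable (M \<Otimes>\<^sub>M N)"
    and bd: "\<And>x \<xi>. x \<in> space M \<Longrightarrow> \<xi> \<in> space N \<Longrightarrow> cmod (e x \<xi>) \<le> K"
    and g[measurable]: "g \<in> borel_measurable N"
    and g2: "integrable N (\<lambda>\<xi>. (cmod (g \<xi>))\<^sup>2)"
    and k[measurable]: "case_prod k \<in> borel_measurable (M \<Otimes>\<^sub>M M)"
    and k_sym: "\<And>x y. k x y = k y x"
    and k_bd: "\<And>x y. x \<in> space M \<Longrightarrow> y \<in> space M \<Longrightarrow>
                 cmod (\<integral>\<xi>. e x \<xi> * cnj (e y \<xi>) \<partial>N) \<le> k x y"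
    and k_int: "\<And>x. x \<in> space M \<Longrightarrow> (\<integral>\<^sup>+y. ennreal (k x y) \<partial>M) \<le> ennreal Q"
    and Q: "Q > 0"
  shows "(\<integral>\<^sup>+x. ennreal ((cmod (\<integral>\<xi>. e x \<xi> * g \<xi> \<partial>N))\<^sup>2) \<partial>M)
           \<le> ennreal (Q * (\<integral>\<xi>. (cmod (g \<xi>))\<^sup>2 \<partial>N))"
proof -
  interpret M: finite_measure M by fact
  interpret N: finite_measure N by fact
  interpret MN: pair_sigma_finite M N ..
  interpret MM: pair_sigma_finite M M ..
  interpret MMf: finite_measure "M \<Otimes>\<^sub>M M"
    by (rule finite_measure_pair_measure) fact+
  interpret MMN: pair_sigma_finite "M \<Otimes>\<^sub>M M" N ..
  interpret MMNf: finite_measure "(M \<Otimes>\<^sub>M M) \<Otimes>\<^sub>M N"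
    by (rule finite_measure_pair_measure) unfold_locales
  have g1: "integrable N (\<lambda>\<xi>. cmod (g \<xi>))"
  proof (rule Bochner_Integration.integrable_bound)
    show "integrable N (\<lambda>\<xi>. 1 + (cmod (g \<xi>))\<^sup>2)" using g2 by auto
    have "cmod (g \<xi>) \<le> 1 + (cmod (g \<xi>))\<^sup>2" for \<xi> by (rule le_one_plus_square)
    then show "AE \<xi> in N. norm (cmod (g \<xi>)) \<le> norm (1 + (cmod (g \<xi>))\<^sup>2)" by (auto simp: add_nonneg_nonneg)
  qed simp
  define u where "u x = (\<integral>\<xi>. e x \<xi> * g \<xi> \<partial>N)" for x
  have u_meas[measurable]: "u \<in> borel_measurable M" unfolding u_def by measurable
  define B where "B = \<bar>K\<bar> * (\<integral>\<xi>. cmod (g \<xi>) \<partial>N)"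
  have u_bd: "cmod (u x) \<le> B" if "x \<in> space M" for x
  proof -
    have "cmod (u x) \<le> (\<integral>\<xi>. \<bar>K\<bar> * cmod (g \<xi>) \<partial>N)"
      unfolding u_def
    proof (rule norm_integral_le_integral)
      show "integrable N (\<lambda>\<xi>. \<bar>K\<bar> * cmod (g \<xi>))" using g1 by auto
      show "norm (e x \<xi> * g \<xi>) \<le> \<bar>K\<bar> * cmod (g \<xi>)" if "\<xi> \<in> space N" for \<xi>
        using bd[OF \<open>x \<in> space M\<close> that] by (auto simp: norm_mult intro!: mult_right_mono)
    qed
    then show ?thesis by (simp add: B_def)
  qed
  have B0: "0 \<le> B" by (auto simp: B_def)
  have u2: "integrable M (\<lambda>x. (cmod (u x))\<^sup>2)"
    by (rule M.integrable_const_bound[where B="B\<^sup>2"]) (auto intro!: power_mono u_bd)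
  define I where "I = (\<integral>x. (cmod (u x))\<^sup>2 \<partial>M)"
  \<comment> \<open>\<open>G\<close> is the conjugate of the adjoint applied to \<open>u\<close>.
    Pairing it with \<open>g\<close> gives \<open>I\<close>, while its squared norm \<open>J\<close>
    is a quadratic form in the kernel of T T*.\<close>
  define G where "G \<xi> = (\<integral>x. cnj (u x) * e x \<xi> \<partial>M)" for \<xi>
  have G_meas[measurable]: "G \<in> borel_measurable N" unfolding G_def by measurable
  have prodbd: "cmod (cnj (u x) * e x \<xi>) \<le> B * \<bar>K\<bar>" if "x \<in> space M" "\<xi> \<in> space N" for x \<xi>
    using u_bd[OF that(1)] bd[OF that] B0 by (auto simp: norm_mult intro!: mult_mono)
  have G_bd: "cmod (G \<xi>) \<le> B * \<bar>K\<bar> * measure M (space M)" if "\<xi> \<in> space N" for \<xi>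
  proof -
    have "cmod (G \<xi>) \<le> (\<integral>x. B * \<bar>K\<bar> \<partial>M)" unfolding G_def
      by (rule norm_integral_le_integral) (use that prodbd in auto)
    then show ?thesis by (simp add: mult_ac)
  qed
  have G2: "integrable N (\<lambda>\<xi>. (cmod (G \<xi>))\<^sup>2)"
    by (rule N.integrable_const_bound[where B="(B * \<bar>K\<bar> * measure M (space M))\<^sup>2"])
       (auto intro!: power_mono G_bd)
  define J where "J = (\<integral>\<xi>. (cmod (G \<xi>))\<^sup>2 \<partial>N)"
  have int1: "integrable (M \<Otimes>\<^sub>M N) (\<lambda>(x,\<xi>). cnj (u x) * e x \<xi> * g \<xi>)"
  proof (rule Bochner_Integration.integrable_bound)
    show "integrable (M \<Otimes>\<^sub>M N) (\<lambda>(x,\<xi>). (B * \<bar>K\<bar>) * cmod (g \<xi>))"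
      by (rule MN.Fubini_integrable) (use g1 in auto)
    show "AE x in M \<Otimes>\<^sub>M N. norm (case x of (x, \<xi>) \<Rightarrow> cnj (u x) * e x \<xi> * g \<xi>)
         \<le> norm (case x of (x, \<xi>) \<Rightarrow> B * \<bar>K\<bar> * cmod (g \<xi>))"
      using prodbd B0 by (intro AE_I2) (auto simp: space_pair_measure norm_mult[of _ "g _"] abs_mult intro!: mult_right_mono)
  qed measurable
  have "complex_of_real I = (\<integral>x. (\<integral>\<xi>. cnj (u x) * e x \<xi> * g \<xi> \<partial>N) \<partial>M)"
  proof -
    have "complex_of_real I = (\<integral>x. cnj (u x) * u x \<partial>M)"
      unfolding I_def integral_complex_of_real[symmetric]
      by (rule Bochner_Integration.integral_cong) (simp_all only: complex_norm_square mult.commute)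
    also have "\<dots> = (\<integral>x. (\<integral>\<xi>. cnj (u x) * e x \<xi> * g \<xi> \<partial>N) \<partial>M)"
      by (rule Bochner_Integration.integral_cong) (auto simp: mult.assoc u_def)
    finally show ?thesis .
  qed
  also have "\<dots> = (\<integral>\<xi>. (\<integral>x. cnj (u x) * e x \<xi> * g \<xi> \<partial>M) \<partial>N)"
    using MN.Fubini_integral[OF int1] by simp
  also have "\<dots> = (\<integral>\<xi>. G \<xi> * g \<xi> \<partial>N)" by (simp add: G_def)
  finally have I_eq: "complex_of_real I = (\<integral>\<xi>. G \<xi> * g \<xi> \<partial>N)" .
  \<comment> \<open>with the weight \<open>Q\<close> in the AM-GM inequality, the dual term \<open>J / Q\<close> is absorbed by \<open>I\<close>\<close>
  have amgm: "cmod (G \<xi> * g \<xi>) \<le> (Q * (cmod (g \<xi>))\<^sup>2 + (cmod (G \<xi>))\<^sup>2 / Q) / 2" for \<xi>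
  proof -
    have "0 \<le> (Q * cmod (g \<xi>) - cmod (G \<xi>))\<^sup>2 / Q" using Q by simp
    also have "\<dots> = Q * (cmod (g \<xi>))\<^sup>2 + (cmod (G \<xi>))\<^sup>2 / Q - 2 * (cmod (G \<xi>) * cmod (g \<xi>))"
      using Q by (simp add: power2_eq_square field_simps)
    finally show ?thesis by (simp add: norm_mult)
  qed
  have I0: "I \<ge> 0" by (simp add: I_def)
  have "I = cmod (complex_of_real I)" using I0 by simp
  also have "\<dots> \<le> (\<integral>\<xi>. (Q * (cmod (g \<xi>))\<^sup>2 + (cmod (G \<xi>))\<^sup>2 / Q) / 2 \<partial>N)"
    unfolding I_eq
  proof (rule norm_integral_le_integral)
    show "integrable N (\<lambda>\<xi>. (Q * (cmod (g \<xi>))\<^sup>2 + (cmod (G \<xi>))\<^sup>2 / Q) / 2)"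
      using g2 G2 by auto
  qed (use amgm in auto)
  also have "\<dots> = (Q * (\<integral>\<xi>. (cmod (g \<xi>))\<^sup>2 \<partial>N) + J / Q) / 2"
    using g2 G2 by (simp add: J_def)
  finally have I_le: "I \<le> (Q * (\<integral>\<xi>. (cmod (g \<xi>))\<^sup>2 \<partial>N) + J / Q) / 2" .
  define Kxy where "Kxy p = (\<integral>\<xi>. e (fst p) \<xi> * cnj (e (snd p) \<xi>) \<partial>N)" for p
  have Kxy_m[measurable]: "Kxy \<in> borel_measurable (M \<Otimes>\<^sub>M M)" unfolding Kxy_def by measurable
  have "complex_of_real J = (\<integral>\<xi>. G \<xi> * cnj (G \<xi>) \<partial>N)"
    unfolding J_def integral_complex_of_real[symmetric]
    by (rule Bochner_Integration.integral_cong) (simp_all only: complex_norm_square)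
  also have "\<dots> = (\<integral>\<xi>. (\<integral>p. (cnj (u (fst p)) * e (fst p) \<xi>) * (u (snd p) * cnj (e (snd p) \<xi>)) \<partial>(M \<Otimes>\<^sub>M M)) \<partial>N)"
  proof (rule Bochner_Integration.integral_cong[OF refl])
    fix \<xi> assume \<xi>: "\<xi> \<in> space N"
    have "(\<integral>p. (cnj (u (fst p)) * e (fst p) \<xi>) * (u (snd p) * cnj (e (snd p) \<xi>)) \<partial>(M \<Otimes>\<^sub>M M))
      = (\<integral>x. (\<integral>y. (cnj (u x) * e x \<xi>) * (u y * cnj (e y \<xi>)) \<partial>M) \<partial>M)"
    proof (subst MM.integral_fst'[symmetric])
      have bd': "cmod (cnj (u x) * e x \<xi> * (u y * cnj (e y \<xi>))) \<le> (B * \<bar>K\<bar>) * (B * \<bar>K\<bar>)"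
        if "x \<in> space M" "y \<in> space M" for x y
        using mult_mono[OF prodbd[OF that(1) \<xi>] prodbd[OF that(2) \<xi>]] B0
        by (auto simp: norm_mult)
      show "integrable (M \<Otimes>\<^sub>M M) (\<lambda>p. cnj (u (fst p)) * e (fst p) \<xi> * (u (snd p) * cnj (e (snd p) \<xi>)))"
        by (rule MMf.integrable_const_bound[where B="(B * \<bar>K\<bar>) * (B * \<bar>K\<bar>)"])
           (use \<xi> bd' in \<open>auto simp: space_pair_measure\<close>)
    qed simp
    also have "\<dots> = G \<xi> * (\<integral>y. u y * cnj (e y \<xi>) \<partial>M)"
      by (simp add: G_def)
    also have "(\<integral>y. u y * cnj (e y \<xi>) \<partial>M) = cnj (G \<xi>)"
      unfolding G_def Bochner_Integration.integral_cnj[symmetric] by simp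
    finally show "G \<xi> * cnj (G \<xi>) = (\<integral>p. (cnj (u (fst p)) * e (fst p) \<xi>) * (u (snd p) * cnj (e (snd p) \<xi>)) \<partial>(M \<Otimes>\<^sub>M M))" ..
  qed
  also have "\<dots> = (\<integral>p. (\<integral>\<xi>. (cnj (u (fst p)) * e (fst p) \<xi>) * (u (snd p) * cnj (e (snd p) \<xi>)) \<partial>N) \<partial>(M \<Otimes>\<^sub>M M))"
  proof (rule MMN.Fubini_integral)
    show "integrable ((M \<Otimes>\<^sub>M M) \<Otimes>\<^sub>M N)
       (\<lambda>(p, \<xi>). (cnj (u (fst p)) * e (fst p) \<xi>) * (u (snd p) * cnj (e (snd p) \<xi>)))"
    proof (rule MMNf.integrable_const_bound[where B="(B * \<bar>K\<bar>) * (B * \<bar>K\<bar>)"])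
      show "AE x in (M \<Otimes>\<^sub>M M) \<Otimes>\<^sub>M N. norm (case x of (p, \<xi>) \<Rightarrow> (cnj (u (fst p)) * e (fst p) \<xi>) * (u (snd p) * cnj (e (snd p) \<xi>)))
        \<le> (B * \<bar>K\<bar>) * (B * \<bar>K\<bar>)"
      proof (rule AE_I2)
        fix z assume z: "z \<in> space ((M \<Otimes>\<^sub>M M) \<Otimes>\<^sub>M N)"
        obtain x y \<xi> where zz: "z = ((x,y),\<xi>)" by (metis prod.exhaust)
        then have sp: "x \<in> space M" "y \<in> space M" "\<xi> \<in> space N" using z by (auto simp: space_pair_measure)
        have "norm ((cnj (u x) * e x \<xi>) * cnj (cnj (u y) * e y \<xi>)) \<le> (B * \<bar>K\<bar>) * (B * \<bar>K\<bar>)"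
          unfolding norm_mult[of "cnj (u x) * e x \<xi>"] complex_mod_cnj
          by (intro mult_mono prodbd sp) (use B0 in auto)
        then show "norm (case z of (p, \<xi>) \<Rightarrow> (cnj (u (fst p)) * e (fst p) \<xi>) * (u (snd p) * cnj (e (snd p) \<xi>)))
        \<le> (B * \<bar>K\<bar>) * (B * \<bar>K\<bar>)"
          by (simp add: zz mult_ac)
      qed
    qed measurable
  qed
  also have "\<dots> = (\<integral>p. (cnj (u (fst p)) * u (snd p)) * Kxy p \<partial>(M \<Otimes>\<^sub>M M))"
    unfolding Kxy_def
    by (subst Bochner_Integration.integral_mult_right_zero[symmetric]) (simp add: mult_ac)
  finally have J_eq: "complex_of_real J = (\<integral>p. (cnj (u (fst p)) * u (snd p)) * Kxy p \<partial>(M \<Otimes>\<^sub>M M))" .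
  have J0: "J \<ge> 0" by (simp add: J_def)
  have nnI: "(\<integral>\<^sup>+x. ennreal ((cmod (u x))\<^sup>2) \<partial>M) = ennreal I"
    unfolding I_def by (rule nn_integral_eq_integral[OF u2]) auto
  \<comment> \<open>Schur's test with the weight split evenly: the product of the moduli of
    \<open>u\<close> at two points is at most half the sum of their squares, and each square is
    integrated against \<open>k\<close> in the other variable first. Symmetry of \<open>k\<close>
    reduces the second half to the first.\<close>
  have half: "(\<integral>\<^sup>+p. ennreal ((cmod (u (fst p)))\<^sup>2 / 2) * ennreal (k (fst p) (snd p)) \<partial>(M \<Otimes>\<^sub>M M)) \<le> ennreal (Q * I / 2)"
  proof -
    have "(\<integral>\<^sup>+p. ennreal ((cmod (u (fst p)))\<^sup>2 / 2) * ennreal (k (fst p) (snd p)) \<partial>(M \<Otimes>\<^sub>M M))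
       = (\<integral>\<^sup>+x. (\<integral>\<^sup>+y. ennreal ((cmod (u x))\<^sup>2 / 2) * ennreal (k x y) \<partial>M) \<partial>M)"
      by (subst M.nn_integral_fst[symmetric]) auto
    also have "\<dots> = (\<integral>\<^sup>+x. ennreal ((cmod (u x))\<^sup>2 / 2) * (\<integral>\<^sup>+y. ennreal (k x y) \<partial>M) \<partial>M)"
      by (intro nn_integral_cong nn_integral_cmult) auto
    also have "\<dots> \<le> (\<integral>\<^sup>+x. ennreal ((cmod (u x))\<^sup>2) * ennreal (Q / 2) \<partial>M)"
    proof (rule nn_integral_mono)
      fix x assume x: "x \<in> space M"
      have "ennreal ((cmod (u x))\<^sup>2 / 2) * (\<integral>\<^sup>+y. ennreal (k x y) \<partial>M) \<le> ennreal ((cmod (u x))\<^sup>2 / 2) * ennreal Q"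
        by (intro mult_left_mono k_int x) auto
      also have "\<dots> = ennreal ((cmod (u x))\<^sup>2) * ennreal (Q / 2)"
        using Q by (simp add: ennreal_mult[symmetric] mult.commute)
      finally show "ennreal ((cmod (u x))\<^sup>2 / 2) * (\<integral>\<^sup>+y. ennreal (k x y) \<partial>M) \<le> ennreal ((cmod (u x))\<^sup>2) * ennreal (Q / 2)" .
    qed
    also have "\<dots> = ennreal (Q * I / 2)"
    proof (subst nn_integral_multc)
      show "(\<integral>\<^sup>+x. ennreal ((cmod (u x))\<^sup>2) \<partial>M) * ennreal (Q / 2) = ennreal (Q * I / 2)"
        unfolding nnI using Q I0 by (simp add: ennreal_mult[symmetric] mult.commute)
    qed simp
    finally show ?thesis .
  qed
  have half': "(\<integral>\<^sup>+p. ennreal ((cmod (u (snd p)))\<^sup>2 / 2) * ennreal (k (fst p) (snd p)) \<partial>(M \<Otimes>\<^sub>M M)) \<le> ennreal (Q * I / 2)"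
  proof -
    have "(\<integral>\<^sup>+p. ennreal ((cmod (u (snd p)))\<^sup>2 / 2) * ennreal (k (fst p) (snd p)) \<partial>(M \<Otimes>\<^sub>M M))
      = (\<integral>\<^sup>+p. ennreal ((cmod (u (fst p)))\<^sup>2 / 2) * ennreal (k (fst p) (snd p)) \<partial>(M \<Otimes>\<^sub>M M))"
      by (subst MM.distr_pair_swap, subst nn_integral_distr) (auto simp: case_prod_beta' k_sym)
    then show ?thesis using half by simp
  qed
  have "ennreal J = ennreal (cmod (complex_of_real J))" using J0 by simp
  also have "\<dots> \<le> (\<integral>\<^sup>+p. ennreal (cmod ((cnj (u (fst p)) * u (snd p)) * Kxy p)) \<partial>(M \<Otimes>\<^sub>M M))"
    unfolding J_eq
    \<comment> \<open>Without integrability the Bochner integral is 0 by default, and the bound is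
      then trivial.\<close>
    by (cases "integrable (M \<Otimes>\<^sub>M M) (\<lambda>p. (cnj (u (fst p)) * u (snd p)) * Kxy p)")
       (use integral_norm_bound_ennreal in \<open>auto simp: not_integrable_integral_eq\<close>)
  also have "\<dots> \<le> (\<integral>\<^sup>+p. ennreal ((cmod (u (fst p)))\<^sup>2 / 2) * ennreal (k (fst p) (snd p)) +
       ennreal ((cmod (u (snd p)))\<^sup>2 / 2) * ennreal (k (fst p) (snd p)) \<partial>(M \<Otimes>\<^sub>M M))"
  proof (rule nn_integral_mono)
    fix p assume "p \<in> space (M \<Otimes>\<^sub>M M)"
    then have kp: "cmod (Kxy p) \<le> k (fst p) (snd p)"
      unfolding Kxy_def by (intro k_bd) (auto simp: space_pair_measure)
    have k0: "0 \<le> k (fst p) (snd p)" using kp norm_ge_zero order_trans by blast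
    have "cmod (u (fst p)) * cmod (u (snd p)) \<le> (cmod (u (fst p)))\<^sup>2 / 2 + (cmod (u (snd p)))\<^sup>2 / 2"
      using sum_squares_bound[of "cmod (u (fst p))" "cmod (u (snd p))"] by simp
    then have "cmod ((cnj (u (fst p)) * u (snd p)) * Kxy p)
        \<le> ((cmod (u (fst p)))\<^sup>2 / 2 + (cmod (u (snd p)))\<^sup>2 / 2) * k (fst p) (snd p)"
      unfolding norm_mult complex_mod_cnj by (intro mult_mono kp) auto
    also have "\<dots> = (cmod (u (fst p)))\<^sup>2 / 2 * k (fst p) (snd p) + (cmod (u (snd p)))\<^sup>2 / 2 * k (fst p) (snd p)"
      by (rule distrib_right)
    finally show "ennreal (cmod ((cnj (u (fst p)) * u (snd p)) * Kxy p)) \<le> ennreal ((cmod (u (fst p)))\<^sup>2 / 2) * ennreal (k (fst p) (snd p)) +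
       ennreal ((cmod (u (snd p)))\<^sup>2 / 2) * ennreal (k (fst p) (snd p))"
      using k0 by (simp add: ennreal_mult[symmetric] ennreal_plus[symmetric] del: ennreal_plus)
  qed
  also have "\<dots> \<le> ennreal (Q * I / 2) + ennreal (Q * I / 2)"
    by (subst nn_integral_add) (auto intro!: add_mono half half')
  also have "\<dots> = ennreal (Q * I)" using Q I0 by (simp add: ennreal_plus[symmetric] del: ennreal_plus)
  finally have "J \<le> Q * I" using Q I0 by simp
  then have "J / Q \<le> I" using Q by (simp add: field_simps)
  then have "I \<le> (Q * (\<integral>\<xi>. (cmod (g \<xi>))\<^sup>2 \<partial>N) + I) / 2" 
    by (intro order_trans[OF I_le] divide_right_mono add_left_mono) auto
  then have "I \<le> Q * (\<integral>\<xi>. (cmod (g \<xi>))\<^sup>2 \<partial>N)" by simp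
  then show ?thesis using nnI by (simp add: u_def ennreal_leI)
qed

text \<open>The kernel bound is assumed for all pairs of indices, so it survives any measurable
  choice of an index depending on the point. Such a choice realizes a finite maximum; monotone
  convergence passes to the supremum.\<close>

lemma maximal_TT_star_nat:
  fixes M :: "'a measure" and N :: "'b measure" and e :: "nat \<Rightarrow> 'a \<Rightarrow> 'b \<Rightarrow> complex"
    and g :: "'b \<Rightarrow> complex" and k :: "'a \<Rightarrow> 'a \<Rightarrow> real"
  assumes M: "finite_measure M" and N: "finite_measure N"
    and e[measurable]: "\<And>i. case_prod (e i) \<in> borel_measurable (M \<Otimes>\<^sub>M N)"
    and bd: "\<And>i x \<xi>. x \<in> space M \<Longrightarrow> \<xi> \<in> space N \<Longrightarrow> cmod (e i x \<xi>) \<le> K"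
    and g[measurable]: "g \<in> borel_measurable N"
    and g2: "integrable N (\<lambda>\<xi>. (cmod (g \<xi>))\<^sup>2)"
    and k: "case_prod k \<in> borel_measurable (M \<Otimes>\<^sub>M M)"
    and k_sym: "\<And>x y. k x y = k y x"
    and k_bd: "\<And>i j x y. x \<in> space M \<Longrightarrow> y \<in> space M \<Longrightarrow>
                 cmod (\<integral>\<xi>. e i x \<xi> * cnj (e j y \<xi>) \<partial>N) \<le> k x y"
    and k_int: "\<And>x. x \<in> space M \<Longrightarrow> (\<integral>\<^sup>+y. ennreal (k x y) \<partial>M) \<le> ennreal Q"
    and Q: "Q > 0"
  shows "(\<integral>\<^sup>+x. (SUP i. ennreal ((cmod (\<integral>\<xi>. e i x \<xi> * g \<xi> \<partial>N))\<^sup>2)) \<partial>M)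
           \<le> ennreal (Q * (\<integral>\<xi>. (cmod (g \<xi>))\<^sup>2 \<partial>N))"
proof -
  interpret M: finite_measure M by fact
  interpret N: finite_measure N by fact
  define u where "u i x = (\<integral>\<xi>. e i x \<xi> * g \<xi> \<partial>N)" for i x
  have u_meas[measurable]: "u i \<in> borel_measurable M" for i unfolding u_def by measurable
  define f where "f n x = (SUP i\<in>{..n}. ennreal ((cmod (u i x))\<^sup>2))" for n x
  have f_meas[measurable]: "f n \<in> borel_measurable M" for n
    unfolding f_def by measurable
  have inc: "incseq f"
    unfolding f_def by (intro monoI le_funI SUP_subset_mono) auto
  have "(SUP i. ennreal ((cmod (u i x))\<^sup>2)) = (SUP n. f n x)" for x
  proof (rule antisym)
    show "(SUP i. ennreal ((cmod (u i x))\<^sup>2)) \<le> (SUP n. f n x)"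
    proof (rule SUP_least)
      fix i
      have "ennreal ((cmod (u i x))\<^sup>2) \<le> f i x" unfolding f_def by (rule SUP_upper) simp
      also have "\<dots> \<le> (SUP n. f n x)" by (rule SUP_upper) simp
      finally show "ennreal ((cmod (u i x))\<^sup>2) \<le> (SUP n. f n x)" .
    qed
    show "(SUP n. f n x) \<le> (SUP i. ennreal ((cmod (u i x))\<^sup>2))"
      unfolding f_def by (intro SUP_least SUP_upper) auto
  qed
  then have "(\<integral>\<^sup>+x. (SUP i. ennreal ((cmod (u i x))\<^sup>2)) \<partial>M) = (\<integral>\<^sup>+x. (SUP n. f n x) \<partial>M)" by simp
  also have "\<dots> = (SUP n. (\<integral>\<^sup>+x. f n x \<partial>M))"
    by (rule nn_integral_monotone_convergence_SUP[OF inc]) simp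
  also have "\<dots> \<le> ennreal (Q * (\<integral>\<xi>. (cmod (g \<xi>))\<^sup>2 \<partial>N))"
  proof (rule SUP_least)
    fix n
    \<comment> \<open>linearization: \<open>j x\<close> is an index at which the maximum at \<open>x\<close> is attained\<close>
    define j where "j x = (LEAST i. i \<le> n \<and> (\<forall>i'\<in>{..n}. cmod (u i' x) \<le> cmod (u i x)))" for x
    have j: "j x \<le> n \<and> (\<forall>i'\<in>{..n}. cmod (u i' x) \<le> cmod (u (j x) x))" for x
    proof -
      have "Max ((\<lambda>i. cmod (u i x)) ` {..n}) \<in> (\<lambda>i. cmod (u i x)) ` {..n}" by (rule Max_in) auto
      then obtain i where "i \<in> {..n}" "Max ((\<lambda>i. cmod (u i x)) ` {..n}) = cmod (u i x)" by blast
      moreover from this(2)[symmetric] have "\<forall>i'\<in>{..n}. cmod (u i' x) \<le> cmod (u i x)"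
        by (auto intro!: Max_ge)
      ultimately show ?thesis
        unfolding j_def by (intro LeastI[of "\<lambda>i. i \<le> n \<and> (\<forall>i'\<in>{..n}. cmod (u i' x) \<le> cmod (u i x))" i]) auto
    qed
    have j_meas[measurable]: "j \<in> measurable M (count_space UNIV)"
      unfolding j_def by measurable
    have e'[measurable]: "(\<lambda>(x, \<xi>). e (j x) x \<xi>) \<in> borel_measurable (M \<Otimes>\<^sub>M N)"
    proof -
      have "(\<lambda>p. (\<lambda>i p. e i (fst p) (snd p)) (j (fst p)) p) \<in> borel_measurable (M \<Otimes>\<^sub>M N)"
        by (rule measurable_compose_countable) measurable
      then show ?thesis by (simp add: case_prod_beta')
    qed
    have "(\<integral>\<^sup>+x. f n x \<partial>M) \<le> (\<integral>\<^sup>+x. ennreal ((cmod (\<integral>\<xi>. e (j x) x \<xi> * g \<xi> \<partial>N))\<^sup>2) \<partial>M)"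
      unfolding f_def u_def[symmetric] using j
      by (intro nn_integral_mono SUP_least ennreal_leI power_mono) auto
    also have "\<dots> \<le> ennreal (Q * (\<integral>\<xi>. (cmod (g \<xi>))\<^sup>2 \<partial>N))"
      by (rule TT_star_bound[OF M N e' bd g g2 k k_sym k_bd k_int Q])
    finally show "(\<integral>\<^sup>+x. f n x \<partial>M) \<le> ennreal (Q * (\<integral>\<xi>. (cmod (g \<xi>))\<^sup>2 \<partial>N))" .
  qed
  finally show ?thesis by (simp add: u_def)
qed

text \<open>Continuity in \<open>t\<close> lets the supremum run over a countable dense subset of
  \<open>P\<close>, where it is measurable.\<close>

lemma maximal_TT_star:
  fixes M :: "'a measure" and N :: "'b measure" and e :: "real \<Rightarrow> 'a \<Rightarrow> 'b \<Rightarrow> complex"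
    and g :: "'b \<Rightarrow> complex" and k :: "'a \<Rightarrow> 'a \<Rightarrow> real"
  assumes M: "finite_measure M" and N: "finite_measure N"
    and e: "\<And>t. t \<in> P \<Longrightarrow> case_prod (e t) \<in> borel_measurable (M \<Otimes>\<^sub>M N)"
    and bd: "\<And>t x \<xi>. t \<in> P \<Longrightarrow> x \<in> space M \<Longrightarrow> \<xi> \<in> space N \<Longrightarrow> cmod (e t x \<xi>) \<le> K"
    and g: "g \<in> borel_measurable N"
    and g2: "integrable N (\<lambda>\<xi>. (cmod (g \<xi>))\<^sup>2)"
    and k: "case_prod k \<in> borel_measurable (M \<Otimes>\<^sub>M M)"
    and k_sym: "\<And>x y. k x y = k y x"
    and k_bd: "\<And>s t x y. s \<in> P \<Longrightarrow> t \<in> P \<Longrightarrow> x \<in> space M \<Longrightarrow> y \<in> space M \<Longrightarrow>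
                 cmod (\<integral>\<xi>. e s x \<xi> * cnj (e t y \<xi>) \<partial>N) \<le> k x y"
    and k_int: "\<And>x. x \<in> space M \<Longrightarrow> (\<integral>\<^sup>+y. ennreal (k x y) \<partial>M) \<le> ennreal Q"
    and Q: "Q > 0"
    and cont: "\<And>x. x \<in> space M \<Longrightarrow> continuous_on P (\<lambda>t. \<integral>\<xi>. e t x \<xi> * g \<xi> \<partial>N)"
  obtains S where "S \<in> borel_measurable M"
    and "\<And>x t. x \<in> space M \<Longrightarrow> t \<in> P \<Longrightarrow> ennreal ((cmod (\<integral>\<xi>. e t x \<xi> * g \<xi> \<partial>N))\<^sup>2) \<le> S x"
    and "(\<integral>\<^sup>+x. S x \<partial>M) \<le> ennreal (Q * (\<integral>\<xi>. (cmod (g \<xi>))\<^sup>2 \<partial>N))"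
proof (cases "P = {}")
  case True
  then show ?thesis by (intro that[of "\<lambda>_. 0"]) auto
next
  case False
  interpret N: finite_measure N by fact
  obtain T where T: "countable T" "T \<subseteq> P" "P \<subseteq> closure T" using separable[of P] by metis
  have "T \<noteq> {}" using T False by auto
  define \<tau> where "\<tau> = from_nat_into T"
  have \<tau>: "range \<tau> = T" unfolding \<tau>_def using \<open>T \<noteq> {}\<close> T(1) by (rule range_from_nat_into)
  then have \<tau>P: "\<tau> i \<in> P" for i using T by auto
  define u where "u t x = (\<integral>\<xi>. e t x \<xi> * g \<xi> \<partial>N)" for t x
  define S where "S x = (SUP i. ennreal ((cmod (u (\<tau> i) x))\<^sup>2))" for x
  show ?thesis
  proof (rule that[of S])
    have [measurable]: "case_prod (e (\<tau> i)) \<in> borel_measurable (M \<Otimes>\<^sub>M N)" for i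
      by (rule e[OF \<tau>P])
    note g[measurable]
    show "S \<in> borel_measurable M" unfolding S_def u_def by measurable
    show "(\<integral>\<^sup>+x. S x \<partial>M) \<le> ennreal (Q * (\<integral>\<xi>. (cmod (g \<xi>))\<^sup>2 \<partial>N))"
      unfolding S_def u_def
      by (rule maximal_TT_star_nat[OF M N e[OF \<tau>P] bd[OF \<tau>P] g g2 k k_sym k_bd[OF \<tau>P \<tau>P] k_int Q])
    fix x t assume x: "x \<in> space M" and t: "t \<in> P"
    have le: "ennreal ((cmod (u s x))\<^sup>2) \<le> S x" if "s \<in> T" for s
      using that \<tau> unfolding S_def by (auto intro!: SUP_upper)
    have "t \<in> closure T" using t T by auto
    then obtain s where s: "\<And>n. s n \<in> T" "s \<longlonglongrightarrow> t" by (auto simp: closure_sequential)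
    have "(\<lambda>n. u (s n) x) \<longlonglongrightarrow> u t x"
      unfolding u_def
      by (rule continuous_on_tendsto_compose[OF cont[OF x] s(2) t]) (use s(1) T(2) in \<open>auto intro!: always_eventually\<close>)
    then have "(\<lambda>n. ennreal ((cmod (u (s n) x))\<^sup>2)) \<longlonglongrightarrow> ennreal ((cmod (u t x))\<^sup>2)"
      by (intro tendsto_intros)
    then show "ennreal ((cmod (\<integral>\<xi>. e t x \<xi> * g \<xi> \<partial>N))\<^sup>2) \<le> S x"
      unfolding u_def[symmetric] by (rule LIMSEQ_le_const2) (use le s in auto)
  qed
qed

section \<open>Maximal functions on frequency annuli\<close>

text \<open>The half-open form makes the annuli of radii \<open>2 ^ k\<close> together with the set
  \<open>\<bar>\<xi>\<bar> \<le> 1\<close> a partition of the line.\<close>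

definition annulus :: "real \<Rightarrow> real set" where
  "annulus N = {\<xi>. N < \<bar>\<xi>\<bar> \<and> \<bar>\<xi>\<bar> \<le> 2 * N}"

abbreviation energy :: "real \<Rightarrow> (real \<Rightarrow> complex) \<Rightarrow> real" where
  "energy N g \<equiv> (LINT \<xi>:annulus N|lborel. (cmod (g \<xi>))\<^sup>2)"

abbreviation finite_energy :: "real \<Rightarrow> (real \<Rightarrow> complex) \<Rightarrow> bool" where
  "finite_energy N g \<equiv> set_integrable lborel (annulus N) (\<lambda>\<xi>. (cmod (g \<xi>))\<^sup>2)"

lemma annulus_eq: "N \<ge> 0 \<Longrightarrow> annulus N = {N<..2 * N} \<union> {- 2 * N..< - N}"
  by (auto simp: annulus_def)

lemma annulus_borel[measurable]: "annulus N \<in> sets borel"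
  unfolding annulus_def by measurable

lemma emeasure_annulus: "N \<ge> 0 \<Longrightarrow> emeasure lborel (annulus N) = ennreal (2 * N)"
  unfolding annulus_eq by (subst plus_emeasure[symmetric]) (auto simp: ennreal_plus[symmetric] simp del: ennreal_plus)

lemma measure_annulus: "N \<ge> 0 \<Longrightarrow> measure lborel (annulus N) = 2 * N"
  by (simp add: measure_def emeasure_annulus)

text \<open>Transfers the derivative tests, which concern gauge integrals over compact intervals, to
  the two halves of an annulus.\<close>

lemma norm_set_integral_annulus_le:
  fixes f :: "real \<Rightarrow> complex"
  assumes f: "continuous_on UNIV f" and N: "N \<ge> 0"
    and B: "cmod (integral {N..2 * N} f) \<le> B" "cmod (integral {- 2 * N..- N} f) \<le> B"
  shows "cmod (LINT \<xi>:annulus N|lborel. f \<xi>) \<le> 2 * B"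
proof -
  have [measurable]: "f \<in> borel_measurable borel" using f by (rule borel_measurable_continuous_onI)
  have si: "set_integrable lborel {a..b} f" for a b
    using f continuous_on_subset by (intro borel_integrable_atLeastAtMost') blast
  have si': "set_integrable lborel {N<..2 * N} f" "set_integrable lborel {- 2 * N..< - N} f"
    by (rule set_integrable_subset[OF si[of N "2 * N"]]; auto)
       (rule set_integrable_subset[OF si[of "- 2 * N" "- N"]]; auto)
  have "(LINT \<xi>:annulus N|lborel. f \<xi>) = (LINT \<xi>:{N<..2 * N}|lborel. f \<xi>) + (LINT \<xi>:{- 2 * N..< - N}|lborel. f \<xi>)"
    unfolding annulus_eq[OF N] using N by (intro set_integral_Un si') auto
  also have "(LINT \<xi>:{N<..2 * N}|lborel. f \<xi>) = (LINT \<xi>:{N..2 * N}|lborel. f \<xi>)"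
    by (rule set_integral_cong_set) (auto simp: set_borel_measurable_def intro!: AE_I[where N="{N}"])
  also have "(LINT \<xi>:{- 2 * N..< - N}|lborel. f \<xi>) = (LINT \<xi>:{- 2 * N..- N}|lborel. f \<xi>)"
    by (rule set_integral_cong_set) (auto simp: set_borel_measurable_def intro!: AE_I[where N="{- N}"])
  finally show ?thesis
    using B norm_triangle_ineq[of "integral {N..2 * N} f" "integral {- 2 * N..- N} f"]
    by (simp add: set_borel_integral_eq_integral(2)[OF si])
qed

section \<open>Maximal bounds on bounded intervals under a Riesz kernel\<close>

lemma finite_measure_restrict_lborel:
  "A \<in> sets borel \<Longrightarrow> emeasure lborel A < \<infinity> \<Longrightarrow> finite_measure (restrict_space lborel A)"
  by (auto intro!: finite_measureI simp: emeasure_restrict_space space_restrict_space)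

text \<open>Provides the Schur constant: for \<open>x\<close> and \<open>y\<close> in
  \<open>{- m..m}\<close> the difference stays in \<open>{- 2 * m..2 * m}\<close>, where the
  singularity is integrable since \<open>\<kappa> < 1\<close>.\<close>

lemma nn_integral_riesz_kernel_le:
  fixes m \<kappa> x :: real
  assumes m: "m > 0" and \<kappa>: "\<kappa> < 1" and x: "x \<in> {- m..m}"
  shows "(\<integral>\<^sup>+y. ennreal (\<bar>x - y\<bar> powr (- \<kappa>)) \<partial>restrict_space lborel {- m..m})
           \<le> ennreal (2 * (2 * m) powr (1 - \<kappa>) / (1 - \<kappa>))"
proof -
  let ?f = "\<lambda>y::real. ennreal (\<bar>y\<bar> powr (- \<kappa>))"
  have half: "(\<integral>\<^sup>+y. ?f y * indicator {0..2 * m} y \<partial>lborel) = ennreal ((2 * m) powr (1 - \<kappa>) / (1 - \<kappa>))"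
  proof -
    have "((\<lambda>y. y powr (- \<kappa>)) has_integral ((2 * m) powr (- \<kappa> + 1) / (- \<kappa> + 1))) {0..2 * m}"
      by (rule has_integral_powr_from_0) (use m \<kappa> in auto)
    then have "(\<integral>\<^sup>+y. ennreal (y powr (- \<kappa>)) * indicator {0..2 * m} y \<partial>lborel) = ennreal ((2 * m) powr (- \<kappa> + 1) / (- \<kappa> + 1))"
      by (intro nn_integral_has_integral_lebesgue' ) auto
    also have "(\<integral>\<^sup>+y. ennreal (y powr (- \<kappa>)) * indicator {0..2 * m} y \<partial>lborel) = (\<integral>\<^sup>+y. ?f y * indicator {0..2 * m} y \<partial>lborel)"
      by (intro nn_integral_cong) (auto simp: indicator_def)
    finally show ?thesis by (simp add: add.commute)
  qed
  have half': "(\<integral>\<^sup>+y. ?f y * indicator {- (2 * m)..0} y \<partial>lborel) = (\<integral>\<^sup>+y. ?f y * indicator {0..2 * m} y \<partial>lborel)"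
    by (subst nn_integral_real_affine[where c="-1" and t=0])
       (auto intro!: nn_integral_cong simp: indicator_def)
  have "(\<integral>\<^sup>+y. ennreal (\<bar>x - y\<bar> powr (- \<kappa>)) \<partial>restrict_space lborel {- m..m})
      = (\<integral>\<^sup>+y. ennreal (\<bar>x - y\<bar> powr (- \<kappa>)) * indicator {- m..m} y \<partial>lborel)"
    by (simp add: nn_integral_restrict_space)
  also have "\<dots> = (\<integral>\<^sup>+y. ?f y * indicator {- m..m} (x - y) \<partial>lborel)"
    by (subst nn_integral_real_affine[where c="-1" and t=x]) auto
  also have "\<dots> \<le> (\<integral>\<^sup>+y. ?f y * indicator {- (2 * m)..0} y + ?f y * indicator {0..2 * m} y \<partial>lborel)"
    using x by (intro nn_integral_mono) (auto simp: indicator_def)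
  also have "\<dots> = ennreal ((2 * m) powr (1 - \<kappa>) / (1 - \<kappa>)) + ennreal ((2 * m) powr (1 - \<kappa>) / (1 - \<kappa>))"
    by (subst nn_integral_add) (auto simp: half half')
  also have "\<dots> = ennreal (2 * (2 * m) powr (1 - \<kappa>) / (1 - \<kappa>))"
    using \<kappa> m by (simp add: ennreal_plus[symmetric] del: ennreal_plus)
  finally show ?thesis .
qed

text \<open>The supremum of an uncountable family need not be measurable; a measurable majorant takes its place.\<close>

definition maximal_L2_le :: "real \<Rightarrow> real set \<Rightarrow> (real \<Rightarrow> real \<Rightarrow> complex) \<Rightarrow> real \<Rightarrow> bool" where
  "maximal_L2_le m P u Q \<longleftrightarrow>
     (\<exists>S \<in> borel_measurable (restrict_space lborel {- m..m}).
        (\<forall>x \<in> {- m..m}. \<forall>t \<in> P. ennreal ((cmod (u t x))\<^sup>2) \<le> S x) \<and>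
        (\<integral>\<^sup>+x. S x \<partial>restrict_space lborel {- m..m}) \<le> ennreal Q)"

lemma maximal_L2_le_mono:
  assumes "maximal_L2_le m P u Q" "P' \<subseteq> P" "Q \<le> Q'"
    and "\<And>t x. t \<in> P' \<Longrightarrow> x \<in> {- m..m} \<Longrightarrow> cmod (v t x) \<le> cmod (u t x)"
  shows "maximal_L2_le m P' v Q'"
proof -
  obtain S where S: "S \<in> borel_measurable (restrict_space lborel {- m..m})"
    "\<And>x t. x \<in> {- m..m} \<Longrightarrow> t \<in> P \<Longrightarrow> ennreal ((cmod (u t x))\<^sup>2) \<le> S x"
    "(\<integral>\<^sup>+x. S x \<partial>restrict_space lborel {- m..m}) \<le> ennreal Q"
    using assms(1) unfolding maximal_L2_le_def by auto
  have "ennreal ((cmod (v t x))\<^sup>2) \<le> S x" if "x \<in> {- m..m}" "t \<in> P'" for t x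
    using assms(2,4) that by (intro order_trans[OF ennreal_leI S(2)] power_mono) auto
  moreover have "(\<integral>\<^sup>+x. S x \<partial>restrict_space lborel {- m..m}) \<le> ennreal Q'"
    using S(3) assms(3) by (meson ennreal_leI order_trans)
  ultimately show ?thesis using S(1) unfolding maximal_L2_le_def by blast
qed

lemma maximal_L2_le_add:
  assumes "maximal_L2_le m P u Q" "maximal_L2_le m P v R" "0 \<le> Q" "0 \<le> R" "0 \<le> c"
    and le: "\<And>t x. t \<in> P \<Longrightarrow> x \<in> {- m..m} \<Longrightarrow> cmod (w t x) \<le> cmod (u t x) + c * cmod (v t x)"
  shows "maximal_L2_le m P w (2 * Q + 2 * c\<^sup>2 * R)"
proof -
  obtain S where S: "S \<in> borel_measurable (restrict_space lborel {- m..m})"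
    "\<And>x t. x \<in> {- m..m} \<Longrightarrow> t \<in> P \<Longrightarrow> ennreal ((cmod (u t x))\<^sup>2) \<le> S x"
    "(\<integral>\<^sup>+x. S x \<partial>restrict_space lborel {- m..m}) \<le> ennreal Q"
    using assms(1) unfolding maximal_L2_le_def by auto
  obtain S' where S': "S' \<in> borel_measurable (restrict_space lborel {- m..m})"
    "\<And>x t. x \<in> {- m..m} \<Longrightarrow> t \<in> P \<Longrightarrow> ennreal ((cmod (v t x))\<^sup>2) \<le> S' x"
    "(\<integral>\<^sup>+x. S' x \<partial>restrict_space lborel {- m..m}) \<le> ennreal R"
    using assms(2) unfolding maximal_L2_le_def by auto
  note [measurable] = S(1) S'(1)
  have "ennreal ((cmod (w t x))\<^sup>2) \<le> ennreal 2 * S x + ennreal (2 * c\<^sup>2) * S' x"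
    if x: "x \<in> {- m..m}" and t: "t \<in> P" for x t
  proof -
    have "(cmod (w t x))\<^sup>2 \<le> (cmod (u t x) + c * cmod (v t x))\<^sup>2"
      using le[OF t x] by (intro power_mono) auto
    also have "\<dots> \<le> 2 * (cmod (u t x))\<^sup>2 + 2 * c\<^sup>2 * (cmod (v t x))\<^sup>2"
      using sum_squares_bound[of "cmod (u t x)" "c * cmod (v t x)"]
      by (simp add: power2_sum power_mult_distrib)
    finally have "ennreal ((cmod (w t x))\<^sup>2) \<le> ennreal (2 * (cmod (u t x))\<^sup>2 + 2 * c\<^sup>2 * (cmod (v t x))\<^sup>2)"
      by (rule ennreal_leI)
    also have "\<dots> = ennreal 2 * ennreal ((cmod (u t x))\<^sup>2) + ennreal (2 * c\<^sup>2) * ennreal ((cmod (v t x))\<^sup>2)"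
      by (subst ennreal_plus) (simp_all add: ennreal_mult')
    also have "\<dots> \<le> ennreal 2 * S x + ennreal (2 * c\<^sup>2) * S' x"
      by (intro add_mono mult_left_mono S(2) S'(2) x t) auto
    finally show ?thesis .
  qed
  moreover have "(\<integral>\<^sup>+x. ennreal 2 * S x + ennreal (2 * c\<^sup>2) * S' x \<partial>restrict_space lborel {- m..m})
      \<le> ennreal 2 * ennreal Q + ennreal (2 * c\<^sup>2) * ennreal R"
  proof -
    have "(\<integral>\<^sup>+x. ennreal 2 * S x + ennreal (2 * c\<^sup>2) * S' x \<partial>restrict_space lborel {- m..m})
      = ennreal 2 * (\<integral>\<^sup>+x. S x \<partial>restrict_space lborel {- m..m})
        + ennreal (2 * c\<^sup>2) * (\<integral>\<^sup>+x. S' x \<partial>restrict_space lborel {- m..m})"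
      by (subst nn_integral_add) (auto simp: nn_integral_cmult)
    also have "\<dots> \<le> ennreal 2 * ennreal Q + ennreal (2 * c\<^sup>2) * ennreal R"
      by (intro add_mono mult_left_mono S(3) S'(3)) auto
    finally show ?thesis .
  qed
  moreover have "ennreal 2 * ennreal Q + ennreal (2 * c\<^sup>2) * ennreal R = ennreal (2 * Q + 2 * c\<^sup>2 * R)"
    using assms by (subst ennreal_plus) (simp_all add: ennreal_mult')
  moreover have "(\<lambda>x. ennreal 2 * S x + ennreal (2 * c\<^sup>2) * S' x) \<in> borel_measurable (restrict_space lborel {- m..m})"
    by measurable
  ultimately show ?thesis unfolding maximal_L2_le_def by (intro bexI) auto
qed

lemma maximal_L2_le_UN:
  assumes "finite I" and "\<And>i. i \<in> I \<Longrightarrow> maximal_L2_le m (P i) u (Q i)" and "\<And>i. i \<in> I \<Longrightarrow> 0 \<le> Q i"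
  shows "maximal_L2_le m (\<Union>i\<in>I. P i) u (\<Sum>i\<in>I. Q i)"
proof -
  have "\<exists>S. \<forall>i\<in>I. S i \<in> borel_measurable (restrict_space lborel {- m..m}) \<and>
    (\<forall>x \<in> {- m..m}. \<forall>t \<in> P i. ennreal ((cmod (u t x))\<^sup>2) \<le> S i x) \<and>
    (\<integral>\<^sup>+x. S i x \<partial>restrict_space lborel {- m..m}) \<le> ennreal (Q i)"
    using assms(2) unfolding maximal_L2_le_def by (intro bchoice) blast
  then obtain S where S: "\<And>i. i \<in> I \<Longrightarrow> S i \<in> borel_measurable (restrict_space lborel {- m..m})"
    "\<And>i x t. i \<in> I \<Longrightarrow> x \<in> {- m..m} \<Longrightarrow> t \<in> P i \<Longrightarrow> ennreal ((cmod (u t x))\<^sup>2) \<le> S i x"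
    "\<And>i. i \<in> I \<Longrightarrow> (\<integral>\<^sup>+x. S i x \<partial>restrict_space lborel {- m..m}) \<le> ennreal (Q i)"
    by blast
  have "(\<lambda>x. \<Sum>i\<in>I. S i x) \<in> borel_measurable (restrict_space lborel {- m..m})"
    using S(1) by (intro borel_measurable_sum) auto
  moreover have "ennreal ((cmod (u t x))\<^sup>2) \<le> (\<Sum>i\<in>I. S i x)"
    if "i \<in> I" "x \<in> {- m..m}" "t \<in> P i" for i x t
    using S(2)[OF that] member_le_sum[of i I "\<lambda>i. S i x"] that(1) assms(1) by (auto intro: order_trans)
  moreover have "(\<integral>\<^sup>+x. (\<Sum>i\<in>I. S i x) \<partial>restrict_space lborel {- m..m}) \<le> ennreal (\<Sum>i\<in>I. Q i)"
  proof -
    have "(\<integral>\<^sup>+x. (\<Sum>i\<in>I. S i x) \<partial>restrict_space lborel {- m..m})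
        = (\<Sum>i\<in>I. \<integral>\<^sup>+x. S i x \<partial>restrict_space lborel {- m..m})"
      by (rule nn_integral_sum) (rule S(1))
    also have "\<dots> \<le> (\<Sum>i\<in>I. ennreal (Q i))" by (rule sum_mono) (rule S(3))
    also have "\<dots> = ennreal (\<Sum>i\<in>I. Q i)" by (rule sum_ennreal) (rule assms(3))
    finally show ?thesis .
  qed
  ultimately show ?thesis unfolding maximal_L2_le_def by (intro bexI) auto
qed

lemma maximal_L2_le_Un:
  assumes "maximal_L2_le m P u Q" "maximal_L2_le m P' u Q'" "0 \<le> Q" "0 \<le> Q'"
  shows "maximal_L2_le m (P \<union> P') u (Q + Q')"
proof -
  have "maximal_L2_le m (\<Union>b\<in>UNIV. if b then P else P') u (\<Sum>b\<in>UNIV. if b then Q else Q')"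
    by (rule maximal_L2_le_UN) (use assms in auto)
  then show ?thesis by (simp add: UNIV_bool Un_commute add.commute)
qed

definition riesz_const :: "real \<Rightarrow> real \<Rightarrow> real" where
  "riesz_const m \<kappa> = 2 * (2 * m) powr (1 - \<kappa>) / (1 - \<kappa>)"

lemma riesz_const_pos: "m > 0 \<Longrightarrow> \<kappa> < 1 \<Longrightarrow> riesz_const m \<kappa> > 0"
  by (simp add: riesz_const_def)

lemma maximal_annulus:
  fixes m \<kappa> N Q K :: real and P :: "real set" and e :: "real \<Rightarrow> real \<Rightarrow> real \<Rightarrow> complex"
    and g :: "real \<Rightarrow> complex"
  assumes m: "m > 0" and \<kappa>: "\<kappa> < 1" and N: "N \<ge> 0" and Q: "Q > 0"
    and e: "\<And>t. t \<in> P \<Longrightarrow> (\<lambda>(x, \<xi>). e t x \<xi>) \<in> borel_measurable (borel \<Otimes>\<^sub>M borel)"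
    and bd: "\<And>t x \<xi>. t \<in> P \<Longrightarrow> \<xi> \<in> annulus N \<Longrightarrow> cmod (e t x \<xi>) \<le> K"
    and g: "g \<in> borel_measurable borel" "finite_energy N g"
    and ker: "\<And>s t x y. s \<in> P \<Longrightarrow> t \<in> P \<Longrightarrow> x \<noteq> y \<Longrightarrow> x \<in> {- m..m} \<Longrightarrow> y \<in> {- m..m} \<Longrightarrow>
        cmod (LINT \<xi>:annulus N|lborel. e s x \<xi> * cnj (e t y \<xi>)) \<le> Q * \<bar>x - y\<bar> powr (- \<kappa>)"
    and cont: "\<And>x. continuous_on P (\<lambda>t. LINT \<xi>:annulus N|lborel. e t x \<xi> * g \<xi>)"
  shows "maximal_L2_le m P (\<lambda>t x. LINT \<xi>:annulus N|lborel. e t x \<xi> * g \<xi>)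
    (riesz_const m \<kappa> * Q * energy N g)"
proof -
  define C where "C = riesz_const m \<kappa>"
  have C: "C > 0" unfolding C_def by (rule riesz_const_pos[OF m \<kappa>])
  let ?M = "restrict_space lborel {- m..m}" and ?N = "restrict_space lborel (annulus N)"
  have spaces: "space ?M = {- m..m}" "space ?N = annulus N" by (auto simp: space_restrict_space)
  have int_N: "(\<integral>\<xi>. f \<xi> \<partial>?N) = (LINT \<xi>:annulus N|lborel. f \<xi>)" for f :: "real \<Rightarrow> 'z::{banach,second_countable_topology}"
    by (subst integral_restrict_space) (auto simp: set_lebesgue_integral_def)
  interpret M: finite_measure ?M by (rule finite_measure_restrict_lborel) (auto simp: emeasure_lborel_Icc_eq)
  interpret NN: finite_measure ?N by (rule finite_measure_restrict_lborel) (use N in \<open>auto simp: emeasure_annulus\<close>)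
  have id: "(\<lambda>x. x) \<in> measurable ?M borel" "(\<lambda>x. x) \<in> measurable ?N borel"
    by (rule measurable_restrict_space1; simp)+
  have pm: "(\<lambda>p. f (fst p) (snd p)) \<in> borel_measurable (A \<Otimes>\<^sub>M B)"
    if f: "(\<lambda>(x, y). f x y) \<in> borel_measurable (borel \<Otimes>\<^sub>M borel)"
      and A: "(\<lambda>x::real. x) \<in> measurable A borel" and B: "(\<lambda>x::real. x) \<in> measurable B borel"
    for f :: "real \<Rightarrow> real \<Rightarrow> 'z::topological_space" and A B
    using measurable_compose[OF measurable_Pair[OF measurable_compose[OF measurable_fst A]
      measurable_compose[OF measurable_snd B]] f] by simp
  \<comment> \<open>On the diagonal \<open>0 powr (- \<kappa>)\<close> is 0 and bounds nothing, so
    \<open>k\<close> takes there the trivial bound \<open>Z\<close>, the squared sup bound times the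
    measure of the annulus. In each row the diagonal is a null set.\<close>
  define Z where "Z = (K\<^sup>2 * (2 * N))"
  define k where "k x y = (if x = y then Z else Q * \<bar>x - y\<bar> powr (- \<kappa>))" for x y :: real
  have bd2: "cmod (LINT \<xi>:annulus N|lborel. e s x \<xi> * cnj (e t x \<xi>)) \<le> Z" if "s \<in> P" "t \<in> P" for s t x
  proof -
    have "cmod (\<integral>\<xi>. e s x \<xi> * cnj (e t x \<xi>) \<partial>?N) \<le> (\<integral>\<xi>. K\<^sup>2 \<partial>?N)"
    proof (rule norm_integral_le_integral)
      fix \<xi> assume "\<xi> \<in> space ?N"
      then have "cmod (e s x \<xi>) \<le> K" "cmod (e t x \<xi>) \<le> K" using bd that spaces by auto
      moreover then have "0 \<le> K" using norm_ge_zero order_trans by blast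
      ultimately show "cmod (e s x \<xi> * cnj (e t x \<xi>)) \<le> K\<^sup>2"
        unfolding norm_mult complex_mod_cnj power2_eq_square by (intro mult_mono) auto
    qed simp
    also have "\<dots> = Z" using N
      by (simp add: Z_def measure_restrict_space spaces measure_annulus)
    finally show ?thesis by (simp add: int_N)
  qed
  obtain S where S: "S \<in> borel_measurable ?M"
    "\<And>x t. x \<in> space ?M \<Longrightarrow> t \<in> P \<Longrightarrow> ennreal ((cmod (\<integral>\<xi>. e t x \<xi> * g \<xi> \<partial>?N))\<^sup>2) \<le> S x"
    "(\<integral>\<^sup>+x. S x \<partial>?M) \<le> ennreal ((Q * C) * (\<integral>\<xi>. (cmod (g \<xi>))\<^sup>2 \<partial>?N))"
  proof (rule maximal_TT_star[of ?M ?N P e K g k "Q * C"])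
    show "finite_measure ?M" "finite_measure ?N" by unfold_locales
    show "case_prod (e t) \<in> borel_measurable (?M \<Otimes>\<^sub>M ?N)" if "t \<in> P" for t
      using pm[OF e[OF that] id] by (simp add: case_prod_beta')
    show "g \<in> borel_measurable ?N" using g(1) by (simp add: measurable_restrict_space1)
    show "integrable ?N (\<lambda>\<xi>. (cmod (g \<xi>))\<^sup>2)"
      using g(2) by (subst integrable_restrict_space) (auto simp: set_integrable_def)
    have "(\<lambda>(x, y). k x y) \<in> borel_measurable (borel \<Otimes>\<^sub>M borel)"
      unfolding k_def case_prod_beta' by measurable
    from pm[OF this id(1) id(1)] show "case_prod k \<in> borel_measurable (?M \<Otimes>\<^sub>M ?M)"
      by (simp add: case_prod_beta')
    show "k x y = k y x" for x y by (simp add: k_def abs_minus_commute)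
    show "cmod (\<integral>\<xi>. e s x \<xi> * cnj (e t y \<xi>) \<partial>?N) \<le> k x y"
      if "s \<in> P" "t \<in> P" "x \<in> space ?M" "y \<in> space ?M" for s t x y
      using ker[of s t x y] bd2[of s t x] that unfolding int_N spaces k_def by auto
    show "(\<integral>\<^sup>+y. ennreal (k x y) \<partial>?M) \<le> ennreal (Q * C)" if x: "x \<in> space ?M" for x
    proof -
      have "AE y in lborel. y \<noteq> x" by (rule AE_lborel_singleton)
      then have AE: "AE y in ?M. y \<noteq> x" by (subst AE_restrict_space_iff) auto
      have "(\<integral>\<^sup>+y. ennreal (k x y) \<partial>?M) = (\<integral>\<^sup>+y. ennreal Q * ennreal (\<bar>x - y\<bar> powr (- \<kappa>)) \<partial>?M)"
        by (rule nn_integral_cong_AE, use AE in eventually_elim) (use Q in \<open>auto simp: k_def ennreal_mult\<close>)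
      also have "\<dots> = ennreal Q * (\<integral>\<^sup>+y. ennreal (\<bar>x - y\<bar> powr (- \<kappa>)) \<partial>?M)"
        by (rule nn_integral_cmult) (intro measurable_restrict_space1, measurable)
      also have "\<dots> \<le> ennreal Q * ennreal C"
        unfolding C_def riesz_const_def using nn_integral_riesz_kernel_le[OF m \<kappa>] x spaces by (intro mult_left_mono) auto
      finally show ?thesis using Q C by (simp add: ennreal_mult)
    qed
    show "0 < Q * C" using Q C by simp
    show "continuous_on P (\<lambda>t. \<integral>\<xi>. e t x \<xi> * g \<xi> \<partial>?N)" for x
      unfolding int_N by (rule cont)
  qed (use bd spaces in auto)
  show ?thesis
    using S unfolding maximal_L2_le_def int_N spaces C_def by (intro bexI[of _ S]) (auto simp: mult.commute)
qed

section \<open>Kernel estimates along a Hoelder curve\<close>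

lemma norm_cis_minus_one_le: "cmod (cis \<theta> - 1) \<le> \<bar>\<theta>\<bar>"
proof -
  have "cmod (cis \<theta> - 1) = 2 * \<bar>sin (\<theta> / 2)\<bar>"
    using dist_exp_i_1[of \<theta>] by (simp add: cis_conv_exp)
  also have "\<dots> \<le> 2 * \<bar>\<theta> / 2\<bar>" using abs_sin_x_le_abs_x[of "\<theta> / 2"] by linarith
  finally show ?thesis by simp
qed

text \<open>Interpolating the trivial bound \<open>N\<close> with
  \<open>1 / \<bar>x - y\<bar>\<close> trades a small power of \<open>N\<close> for the integrable
  singularity \<open>\<bar>x - y\<bar> powr (- \<kappa>)\<close>.\<close>

lemma le_interpolation:
  fixes k A B \<theta> :: real
  assumes "0 \<le> k" "k \<le> A" "k \<le> B" "0 \<le> \<theta>" "\<theta> \<le> 1"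
  shows "k \<le> A powr (1 - \<theta>) * B powr \<theta>"
proof (cases "k = 0")
  case False
  then have "k = k powr (1 - \<theta>) * k powr \<theta>" using assms by (simp add: powr_add[symmetric])
  also have "\<dots> \<le> A powr (1 - \<theta>) * B powr \<theta>"
    using assms by (intro mult_mono powr_mono2) auto
  finally show ?thesis .
qed (use assms in auto)

text \<open>One integration by parts against a linear phase. It serves times so short that the rest
  of the phase can be put into the amplitude \<open>h\<close>.\<close>

lemma norm_integral_cis_linear_le:
  fixes z p q H H' :: real and h h' :: "real \<Rightarrow> complex"
  assumes pq: "p \<le> q" and z: "z \<noteq> 0"
    and der: "\<And>\<xi>. \<xi> \<in> {p..q} \<Longrightarrow> (h has_vector_derivative h' \<xi>) (at \<xi> within {p..q})"
    and h': "continuous_on {p..q} h'"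
    and H: "\<And>\<xi>. \<xi> \<in> {p..q} \<Longrightarrow> cmod (h \<xi>) \<le> H"
    and H': "\<And>\<xi>. \<xi> \<in> {p..q} \<Longrightarrow> cmod (h' \<xi>) \<le> H'"
  shows "cmod (integral {p..q} (\<lambda>\<xi>. cis (z * \<xi>) * h \<xi>)) \<le> (2 * H + (q - p) * H') / \<bar>z\<bar>"
proof -
  let ?w = "1 / (\<i> * of_real z)"
  have h_cont: "continuous_on {p..q} h"
    using der by (rule continuous_on_vector_derivative)
  have cd: "((\<lambda>\<xi>. cis (z * \<xi>)) has_vector_derivative (\<i> * of_real z * cis (z * \<xi>))) (at \<xi> within {p..q})" for \<xi>
    using has_vector_derivative_cis_quadratic[of z 0 \<xi>] by simp
  have "((\<lambda>\<xi>. ?w * (\<i> * of_real z * cis (z * \<xi>) * h \<xi>) + ?w * (cis (z * \<xi>) * h' \<xi>)) has_integral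
      ?w * (cis (z * q) * h q) - ?w * (cis (z * p) * h p)) {p..q}"
  proof (rule fundamental_theorem_of_calculus[OF pq])
    fix \<xi> assume "\<xi> \<in> {p..q}"
    then have "((\<lambda>\<xi>. ?w * (cis (z * \<xi>) * h \<xi>)) has_vector_derivative
      ?w * (cis (z * \<xi>) * h' \<xi> + \<i> * of_real z * cis (z * \<xi>) * h \<xi>)) (at \<xi> within {p..q})"
      by (intro has_vector_derivative_mult_right has_vector_derivative_mult cd der)
    then show "((\<lambda>\<xi>. ?w * (cis (z * \<xi>) * h \<xi>)) has_vector_derivative
      ?w * (\<i> * of_real z * cis (z * \<xi>) * h \<xi>) + ?w * (cis (z * \<xi>) * h' \<xi>)) (at \<xi> within {p..q})"
      by (simp add: distrib_left add.commute)
  qed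
  moreover have "?w * (\<i> * of_real z * cis (z * \<xi>) * h \<xi>) = cis (z * \<xi>) * h \<xi>" for \<xi>
    using z by simp
  moreover have i2: "(\<lambda>\<xi>. ?w * (cis (z * \<xi>) * h' \<xi>)) integrable_on {p..q}"
    by (intro integrable_continuous_real continuous_intros h')
  ultimately have "((\<lambda>\<xi>. cis (z * \<xi>) * h \<xi> + ?w * (cis (z * \<xi>) * h' \<xi>) - ?w * (cis (z * \<xi>) * h' \<xi>)) has_integral
      ?w * (cis (z * q) * h q) - ?w * (cis (z * p) * h p) - integral {p..q} (\<lambda>\<xi>. ?w * (cis (z * \<xi>) * h' \<xi>))) {p..q}"
    by (intro has_integral_diff integrable_integral[OF i2]) (simp only:)
  then have eq: "integral {p..q} (\<lambda>\<xi>. cis (z * \<xi>) * h \<xi>) =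
      ?w * (cis (z * q) * h q) - ?w * (cis (z * p) * h p) - integral {p..q} (\<lambda>\<xi>. ?w * (cis (z * \<xi>) * h' \<xi>))"
    by (simp add: integral_unique)
  have "cmod (integral {p..q} (\<lambda>\<xi>. ?w * (cis (z * \<xi>) * h' \<xi>))) \<le> integral {p..q} (\<lambda>_. H' / \<bar>z\<bar>)"
    by (rule integral_norm_bound_integral[OF i2])
       (use H' in \<open>auto simp: norm_mult norm_divide intro!: divide_right_mono\<close>)
  also have "\<dots> = (q - p) * H' / \<bar>z\<bar>" using pq by simp
  finally have "cmod (integral {p..q} (\<lambda>\<xi>. ?w * (cis (z * \<xi>) * h' \<xi>))) \<le> (q - p) * H' / \<bar>z\<bar>" .
  moreover have "cmod (?w * (cis (z * q) * h q)) \<le> H / \<bar>z\<bar>" "cmod (?w * (cis (z * p) * h p)) \<le> H / \<bar>z\<bar>"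
    using H pq by (auto simp: norm_mult norm_divide intro!: divide_right_mono)
  moreover have "cmod (A - B - C) \<le> cmod A + cmod B + cmod C" for A B C :: complex
    using norm_triangle_ineq4[of "A - B" C] norm_triangle_ineq4[of A B] by linarith
  ultimately have "cmod (integral {p..q} (\<lambda>\<xi>. cis (z * \<xi>) * h \<xi>)) \<le> H / \<bar>z\<bar> + H / \<bar>z\<bar> + (q - p) * H' / \<bar>z\<bar>"
    unfolding eq by (smt (verit))
  also have "\<dots> = (2 * H + (q - p) * H') / \<bar>z\<bar>" by (simp add: add_divide_distrib)
  finally show ?thesis .
qed

locale holder_curve =
  fixes \<alpha> :: real and \<gamma> :: "real \<times> real \<Rightarrow> real" and C1 C3 :: real
  assumes alpha: "0 < \<alpha>" "\<alpha> \<le> 1 / 4"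
    and cont: "continuous_on (UNIV \<times> {-1..1}) \<gamma>"
    and at_zero: "\<gamma> (x, 0) = x"
    and C1: "C1 > 0" and C3: "C3 > 0"
    and expand: "t \<in> {-1..1} \<Longrightarrow> \<bar>x - x'\<bar> \<le> C1 * \<bar>\<gamma> (x, t) - \<gamma> (x', t)\<bar>"
    and holder: "t \<in> {-1..1} \<Longrightarrow> t' \<in> {-1..1} \<Longrightarrow> \<bar>\<gamma> (x, t) - \<gamma> (x, t')\<bar> \<le> C3 * \<bar>t - t'\<bar> powr \<alpha>"
begin

definition E :: "real \<Rightarrow> real \<Rightarrow> real \<Rightarrow> complex" where
  "E t x \<xi> = cis (\<gamma> (x, t) * \<xi> + t * \<xi>\<^sup>2)"

abbreviation kernel :: "real \<Rightarrow> real \<Rightarrow> real \<Rightarrow> real \<Rightarrow> real \<Rightarrow> complex" where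
  "kernel N s x t y \<equiv> (LINT \<xi>:annulus N|lborel. E s x \<xi> * cnj (E t y \<xi>))"

lemma norm_E[simp]: "cmod (E t x \<xi>) = 1" by (simp add: E_def)

lemma E_mult_cnj: "E s x \<xi> * cnj (E t y \<xi>) = cis ((\<gamma> (x, s) - \<gamma> (y, t)) * \<xi> + (s - t) * \<xi>\<^sup>2)"
  by (simp add: E_def cis_cnj cis_mult algebra_simps)

lemma continuous_E: "continuous_on S (E t x)"
  unfolding E_def by (intro continuous_intros)

lemma kernel_le_measure:
  assumes "N \<ge> 0"
  shows "cmod (kernel N s x t y) \<le> 2 * N"
proof -
  have "cmod (integral {p..q} (\<lambda>\<xi>. E s x \<xi> * cnj (E t y \<xi>))) \<le> N" if "q - p = N" for p q
  proof -
    have "cmod (integral {p..q} (\<lambda>\<xi>. E s x \<xi> * cnj (E t y \<xi>))) \<le> integral {p..q} (\<lambda>_. 1)"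
      by (rule integral_norm_bound_integral)
         (auto simp: norm_mult intro!: integrable_continuous_real continuous_intros continuous_E)
    then show ?thesis using assms that by simp
  qed
  then show ?thesis using assms
    by (intro norm_set_integral_annulus_le) (auto intro!: continuous_intros continuous_E)
qed

lemma kernel_le_second:
  assumes "N \<ge> 0" "s \<noteq> t"
  shows "cmod (kernel N s x t y) \<le> 12 / sqrt \<bar>s - t\<bar>"
proof -
  have "cmod (kernel N s x t y) \<le> 2 * (6 / sqrt \<bar>s - t\<bar>)"
    using assms unfolding E_mult_cnj
    by (intro norm_set_integral_annulus_le osc_second) (auto intro!: continuous_intros)
  then show ?thesis by simp
qed

text \<open>The phase derivative is
  \<open>\<gamma> (x, s) - \<gamma> (y, t) + 2 * (s - t) * \<xi>\<close>. The lower Lipschitz bound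
  makes its main part at least \<open>\<bar>x - y\<bar> / C1\<close>; if neither the Hoelder shift
  in time nor the dispersive term can compete, a quarter of this survives, and the first derivative
  test on the two halves of the annulus gives \<open>32 * C1\<close>.\<close>

lemma kernel_trichotomy:
  assumes N: "N \<ge> 0" and st: "s \<in> {-1..1}" "t \<in> {-1..1}" and xy: "x \<noteq> y"
  shows "cmod (kernel N s x t y) \<le> 32 * C1 / \<bar>x - y\<bar>
    \<or> \<bar>x - y\<bar> \<le> 16 * C1 * N * \<bar>s - t\<bar> \<or> \<bar>x - y\<bar> \<le> 2 * C1 * C3 * \<bar>s - t\<bar> powr \<alpha>"
proof (rule disjCI, clarsimp simp: not_le)
  assume far: "16 * C1 * N * \<bar>s - t\<bar> < \<bar>x - y\<bar>" "2 * C1 * C3 * \<bar>s - t\<bar> powr \<alpha> < \<bar>x - y\<bar>"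
  define a where "a = \<gamma> (x, s) - \<gamma> (y, t)"
  define z where "z = \<bar>x - y\<bar>"
  have z: "z > 0" using xy by (simp add: z_def)
  have "z / C1 \<le> \<bar>\<gamma> (x, s) - \<gamma> (y, s)\<bar>"
    using expand[OF st(1), of x y] C1 by (simp add: z_def field_simps)
  moreover have "\<bar>\<gamma> (y, s) - \<gamma> (y, t)\<bar> \<le> z / (2 * C1)"
  proof -
    have "\<bar>\<gamma> (y, s) - \<gamma> (y, t)\<bar> \<le> C3 * \<bar>s - t\<bar> powr \<alpha>" by (rule holder[OF st])
    also have "\<dots> \<le> z / (2 * C1)" using far(2) C1 by (simp add: z_def field_simps)
    finally show ?thesis .
  qed
  moreover have "z / C1 - z / (2 * C1) = z / (2 * C1)" using C1 by (simp add: field_simps)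
  ultimately have a: "z / (2 * C1) \<le> \<bar>a\<bar>" by (simp add: a_def)
  have b: "8 * N * \<bar>s - t\<bar> \<le> z / (2 * C1)" using far(1) C1 by (simp add: z_def field_simps)
  have lower: "z / (4 * C1) \<le> \<bar>a + 2 * (s - t) * \<xi>\<bar>" if "\<bar>\<xi>\<bar> \<le> 2 * N" for \<xi>
  proof -
    have "\<bar>2 * (s - t) * \<xi>\<bar> = 2 * \<bar>s - t\<bar> * \<bar>\<xi>\<bar>" by (simp only: abs_mult abs_numeral)
    also have "\<dots> \<le> 2 * \<bar>s - t\<bar> * (2 * N)" using that by (intro mult_left_mono) auto
    also have "\<dots> = 8 * N * \<bar>s - t\<bar> / 2" by simp
    also have "\<dots> \<le> z / (2 * C1) / 2" by (rule divide_right_mono[OF b]) simp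
    finally have "\<bar>2 * (s - t) * \<xi>\<bar> \<le> z / (4 * C1)" by simp
    moreover have "z / (2 * C1) - z / (4 * C1) = z / (4 * C1)" by simp
    ultimately show ?thesis using a by linarith
  qed
  have "cmod (kernel N s x t y) \<le> 2 * (4 / (z / (4 * C1)))"
    unfolding E_mult_cnj a_def[symmetric] using N z C1
    by (intro norm_set_integral_annulus_le osc_first lower) (auto intro!: continuous_intros)
  then show "cmod (kernel N s x t y) \<le> 32 * C1 / \<bar>x - y\<bar>"
    by (simp add: z_def)
qed

text \<open>Near pairs are treated by the second derivative test. When
  \<open>\<bar>x - y\<bar>\<close> is at most a multiple of
  \<open>\<bar>s - t\<bar> powr \<alpha>\<close>, it gives
  \<open>\<bar>x - y\<bar> powr (- 1 / (2 * \<alpha>))\<close>, whose interpolation with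
  \<open>N\<close> produces the exponent \<open>1 - 2 * \<alpha> * \<kappa>\<close>. This case is
  the worst: the other near case loses only \<open>N powr (1 / 2)\<close>, and
  \<open>2 * \<alpha> * \<kappa> \<le> 1 / 2\<close>.\<close>

lemma kernel_long_time:
  fixes \<kappa> Z :: real
  assumes \<kappa>: "1 / 2 \<le> \<kappa>" "\<kappa> < 1" and Z: "Z \<ge> 1"
  obtains C where "C > 0" and "\<And>N s t x y. \<lbrakk>N \<ge> 1; s \<in> {-1..1}; t \<in> {-1..1}; x \<noteq> y; \<bar>x - y\<bar> \<le> Z\<rbrakk> \<Longrightarrow>
    cmod (kernel N s x t y) \<le> C * N powr (1 - 2 * \<alpha> * \<kappa>) * \<bar>x - y\<bar> powr (- \<kappa>)"
proof -
  define B1 where "B1 = 2 powr (1 - \<kappa>) * (32 * C1) powr \<kappa>"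
  define B2 where "B2 = 12 * sqrt (16 * C1) * Z powr (\<kappa> - 1 / 2)"
  define D where "D = (2 * C1 * C3) powr (1 / (2 * \<alpha>))"
  have D: "D > 0" using C1 C3 by (simp add: D_def)
  define B3 where "B3 = 2 powr (1 - 2 * \<alpha> * \<kappa>) * (12 * D) powr (2 * \<alpha> * \<kappa>)"
  have B: "B1 \<ge> 0" "B2 \<ge> 0" "B3 > 0" using C1 D by (auto simp: B1_def B2_def B3_def)
  have ak: "0 \<le> 2 * \<alpha> * \<kappa>" "2 * \<alpha> * \<kappa> \<le> 1 / 2"
    using alpha \<kappa> mult_mono[of "2 * \<alpha>" "1/2" \<kappa> 1] by auto
  have ak': "2 * \<alpha> * \<kappa> \<le> \<kappa>"
    using alpha \<kappa> mult_right_mono[of "2 * \<alpha>" 1 \<kappa>] by simp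
  show ?thesis
  proof (rule that[of "B1 + B2 + B3"])
    show "B1 + B2 + B3 > 0" using B by simp
    fix N s t x y :: real
    assume N: "N \<ge> 1" and st: "s \<in> {-1..1}" "t \<in> {-1..1}" and xy: "x \<noteq> y" "\<bar>x - y\<bar> \<le> Z"
    define k where "k = cmod (kernel N s x t y)"
    define z where "z = \<bar>x - y\<bar>"
    have z: "0 < z" "z \<le> Z" using xy by (auto simp: z_def)
    have k: "0 \<le> k" "k \<le> 2 * N" unfolding k_def using kernel_le_measure N by auto
    have k2: "k \<le> 12 / sqrt \<bar>s - t\<bar>" if "s \<noteq> t" unfolding k_def using kernel_le_second N that by auto
    consider "k \<le> 32 * C1 / z" | "z \<le> 16 * C1 * N * \<bar>s - t\<bar>" | "z \<le> 2 * C1 * C3 * \<bar>s - t\<bar> powr \<alpha>"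
      using kernel_trichotomy[of N s t x y] N st xy unfolding k_def z_def by auto
    then have "k \<le> B1 * (N powr (1 - 2 * \<alpha> * \<kappa>) * z powr (- \<kappa>)) \<or> k \<le> B2 * (N powr (1 - 2 * \<alpha> * \<kappa>) * z powr (- \<kappa>))
        \<or> k \<le> B3 * (N powr (1 - 2 * \<alpha> * \<kappa>) * z powr (- \<kappa>))"
    proof cases
      case 1
      have "k \<le> (2 * N) powr (1 - \<kappa>) * (32 * C1 / z) powr \<kappa>"
        using le_interpolation[OF k(1,2) 1, of \<kappa>] \<kappa> by simp
      also have "\<dots> = B1 * (N powr (1 - \<kappa>) * z powr (- \<kappa>))"
        using z C1 N by (simp add: B1_def powr_mult powr_divide powr_minus_divide)
      also have "\<dots> \<le> B1 * (N powr (1 - 2 * \<alpha> * \<kappa>) * z powr (- \<kappa>))"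
        using B N ak' \<kappa> by (intro mult_left_mono mult_right_mono powr_mono) auto
      finally show ?thesis by blast
    next
      case 2
      then have st': "s \<noteq> t" using z by auto
      have sq: "sqrt z \<le> sqrt (16 * C1) * sqrt N * sqrt \<bar>s - t\<bar>"
        using 2 by (simp add: real_sqrt_mult[symmetric])
      have "k \<le> 12 / sqrt \<bar>s - t\<bar>" by (rule k2[OF st'])
      also have "\<dots> \<le> 12 * sqrt (16 * C1) * (sqrt N / sqrt z)"
        using sq st' z by (simp add: field_simps)
      \<comment> \<open>The surplus \<open>z powr (\<kappa> - 1 / 2)\<close> is bounded because
        \<open>\<kappa> \<ge> 1 / 2\<close> and \<open>z \<le> Z\<close>.\<close>
      also have "sqrt N / sqrt z = N powr (1 / 2) * z powr (\<kappa> - 1 / 2) * z powr (- \<kappa>)"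
      proof -
        have "z powr (\<kappa> - 1 / 2) * z powr (- \<kappa>) = z powr (- (1 / 2))"
          by (simp add: powr_add[symmetric])
        also have "\<dots> = 1 / sqrt z" using z by (simp only: powr_minus_divide) (simp add: powr_half_sqrt)
        finally show ?thesis using N by (simp add: powr_half_sqrt mult.assoc)
      qed
      also have "12 * sqrt (16 * C1) * (N powr (1 / 2) * z powr (\<kappa> - 1 / 2) * z powr (- \<kappa>))
          \<le> 12 * sqrt (16 * C1) * (N powr (1 - 2 * \<alpha> * \<kappa>) * Z powr (\<kappa> - 1 / 2) * z powr (- \<kappa>))"
        using N z C1 ak \<kappa> by (intro mult_left_mono mult_right_mono mult_mono powr_mono powr_mono2) auto
      also have "\<dots> = B2 * (N powr (1 - 2 * \<alpha> * \<kappa>) * z powr (- \<kappa>))" by (simp add: B2_def)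
      finally show ?thesis by blast
    next
      case 3
      then have st': "s \<noteq> t" using z by auto
      have "z powr (1 / (2 * \<alpha>)) \<le> (2 * C1 * C3 * \<bar>s - t\<bar> powr \<alpha>) powr (1 / (2 * \<alpha>))"
        using 3 z alpha by (intro powr_mono2) auto
      also have "\<dots> = D * sqrt \<bar>s - t\<bar>"
        using C1 C3 alpha by (simp add: D_def powr_mult powr_powr powr_half_sqrt)
      finally have zz: "z powr (1 / (2 * \<alpha>)) \<le> D * sqrt \<bar>s - t\<bar>" .
      have "k \<le> 12 / sqrt \<bar>s - t\<bar>" by (rule k2[OF st'])
      also have "\<dots> \<le> 12 * D / z powr (1 / (2 * \<alpha>))"
        using zz st' z by (simp add: field_simps)
      finally have "k \<le> 12 * D / z powr (1 / (2 * \<alpha>))" .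
      \<comment> \<open>The interpolation parameter \<open>2 * \<alpha> * \<kappa>\<close> is the
        one that turns \<open>z powr (- 1 / (2 * \<alpha>))\<close> into
        \<open>z powr (- \<kappa>)\<close>.\<close>
      then have "k \<le> (2 * N) powr (1 - 2 * \<alpha> * \<kappa>) * (12 * D / z powr (1 / (2 * \<alpha>))) powr (2 * \<alpha> * \<kappa>)"
        using le_interpolation[OF k(1,2), of _ "2 * \<alpha> * \<kappa>"] ak by simp
      also have "\<dots> = B3 * (N powr (1 - 2 * \<alpha> * \<kappa>) * z powr (- \<kappa>))"
        using z D N alpha by (simp add: B3_def powr_mult powr_divide powr_powr powr_minus_divide)
      finally show ?thesis by blast
    qed
    then show "k \<le> (B1 + B2 + B3) * N powr (1 - 2 * \<alpha> * \<kappa>) * z powr (- \<kappa>)"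
    proof -
      let ?w = "N powr (1 - 2 * \<alpha> * \<kappa>) * z powr (- \<kappa>)"
      have "0 \<le> B1 * ?w" "0 \<le> B2 * ?w" "0 \<le> B3 * ?w" using B by auto
      then have "k \<le> B1 * ?w + B2 * ?w + B3 * ?w"
        using \<open>k \<le> B1 * ?w \<or> k \<le> B2 * ?w \<or> k \<le> B3 * ?w\<close> by linarith
      then show ?thesis by (simp add: algebra_simps)
    qed
  qed
qed

text \<open>In a time window of length \<open>T\<close> with \<open>T * N\<^sup>2 \<le> 1\<close>
  the dispersive shift \<open>N * T\<close> is at most \<open>T powr \<alpha>\<close>, so both near
  cases confine \<open>\<bar>x - y\<bar>\<close> to a multiple of \<open>T powr \<alpha>\<close>.
  There the trivial bound \<open>N\<close> may be multiplied by the power \<open>\<kappa>\<close> of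
  a ratio that is at least 1.\<close>

lemma kernel_short_time:
  fixes \<kappa> :: real
  assumes \<kappa>: "0 < \<kappa>" "\<kappa> < 1"
  obtains C where "C > 0" and "\<And>N T s t x y. \<lbrakk>N \<ge> 1; T * N\<^sup>2 \<le> 1; 0 < T; s \<in> {-1..1}; t \<in> {-1..1}; \<bar>s - t\<bar> \<le> T; x \<noteq> y\<rbrakk> \<Longrightarrow>
    cmod (kernel N s x t y)
      \<le> C * (N powr (1 - \<kappa>) + N * T powr (\<alpha> * \<kappa>)) * \<bar>x - y\<bar> powr (- \<kappa>)"
proof -
  define D where "D = 16 * C1 + 2 * C1 * C3"
  have D: "D > 0" using C1 C3 by (auto simp: D_def intro!: add_pos_pos mult_pos_pos)
  define B1 where "B1 = 2 powr (1 - \<kappa>) * (32 * C1) powr \<kappa>"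
  define B2 where "B2 = 2 * D powr \<kappa>"
  have B: "B1 > 0" "B2 > 0" using C1 D by (auto simp: B1_def B2_def)
  show ?thesis
  proof (rule that[of "B1 + B2"])
    show "B1 + B2 > 0" using B by simp
    fix N T s t x y :: real
    assume N: "N \<ge> 1" and T: "T * N\<^sup>2 \<le> 1" "0 < T" and st: "s \<in> {-1..1}" "t \<in> {-1..1}" "\<bar>s - t\<bar> \<le> T" and xy: "x \<noteq> y"
    define k where "k = cmod (kernel N s x t y)"
    define z where "z = \<bar>x - y\<bar>"
    have z: "0 < z" using xy by (auto simp: z_def)
    have k: "0 \<le> k" "k \<le> 2 * N" unfolding k_def using kernel_le_measure N by auto
    have T1: "T \<le> 1"
    proof -
      have "T * 1 \<le> T * N\<^sup>2" using N T by (intro mult_left_mono one_le_power) auto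
      then show ?thesis using T by linarith
    qed
    \<comment> \<open>Squaring gives \<open>(N * T)\<^sup>2 = (T * N\<^sup>2) * T \<le> T\<close>,
      and \<open>sqrt T \<le> T powr \<alpha>\<close> because \<open>T \<le> 1\<close> and
      \<open>\<alpha> \<le> 1 / 2\<close>.\<close>
    have NT: "N * T \<le> T powr \<alpha>"
    proof -
      have "(N * T)\<^sup>2 = T * N\<^sup>2 * T" by (simp add: power2_eq_square)
      also have "\<dots> \<le> 1 * T" using T by (intro mult_right_mono) auto
      finally have "N * T \<le> sqrt T" using real_le_rsqrt by simp
      also have "\<dots> = T powr (1 / 2)" using T by (simp add: powr_half_sqrt)
      also have "\<dots> \<le> T powr \<alpha>" using T T1 alpha by (intro powr_mono') auto
      finally show ?thesis .
    qed
    have near: "k \<le> B2 * (N * T powr (\<alpha> * \<kappa>) * z powr (- \<kappa>))" if "z \<le> D * T powr \<alpha>"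
    proof -
      have "1 \<le> (D * T powr \<alpha> / z) powr \<kappa>"
        using that z \<kappa> by (intro ge_one_powr_ge_zero) auto
      then have "2 * N * 1 \<le> 2 * N * (D * T powr \<alpha> / z) powr \<kappa>"
        using N by (intro mult_left_mono) auto
      also have "\<dots> = B2 * (N * T powr (\<alpha> * \<kappa>) * z powr (- \<kappa>))"
        using z D by (simp add: B2_def powr_mult powr_divide powr_powr powr_minus_divide)
      finally show ?thesis using k by linarith
    qed
    consider "k \<le> 32 * C1 / z" | "z \<le> 16 * C1 * N * \<bar>s - t\<bar>" | "z \<le> 2 * C1 * C3 * \<bar>s - t\<bar> powr \<alpha>"
      using kernel_trichotomy[of N s t x y] N st xy unfolding k_def z_def by auto
    then have "k \<le> B1 * (N powr (1 - \<kappa>) * z powr (- \<kappa>)) \<or> k \<le> B2 * (N * T powr (\<alpha> * \<kappa>) * z powr (- \<kappa>))"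
    proof cases
      case 1
      have "k \<le> (2 * N) powr (1 - \<kappa>) * (32 * C1 / z) powr \<kappa>"
        using le_interpolation[OF k(1,2) 1, of \<kappa>] \<kappa> by simp
      also have "\<dots> = B1 * (N powr (1 - \<kappa>) * z powr (- \<kappa>))"
        using z C1 N by (simp add: B1_def powr_mult powr_divide powr_minus_divide)
      finally show ?thesis by blast
    next
      case 2
      have "16 * C1 * N * \<bar>s - t\<bar> \<le> 16 * C1 * N * T" using st C1 N by (intro mult_left_mono) auto
      also have "\<dots> = 16 * C1 * (N * T)" by simp
      also have "\<dots> \<le> 16 * C1 * T powr \<alpha>" using NT C1 by (intro mult_left_mono) auto
      also have "\<dots> \<le> D * T powr \<alpha>" using C1 C3 by (intro mult_right_mono) (auto simp: D_def)
      finally show ?thesis using near 2 by auto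
    next
      case 3
      have "2 * C1 * C3 * \<bar>s - t\<bar> powr \<alpha> \<le> D * T powr \<alpha>"
        using st C1 C3 alpha by (intro mult_mono powr_mono2) (auto simp: D_def)
      then show ?thesis using near 3 by auto
    qed
    then show "k \<le> (B1 + B2) * (N powr (1 - \<kappa>) + N * T powr (\<alpha> * \<kappa>)) * z powr (- \<kappa>)"
    proof
      assume "k \<le> B1 * (N powr (1 - \<kappa>) * z powr (- \<kappa>))"
      also have "\<dots> = B1 * N powr (1 - \<kappa>) * z powr (- \<kappa>)" by simp
      also have "\<dots> \<le> (B1 + B2) * (N powr (1 - \<kappa>) + N * T powr (\<alpha> * \<kappa>)) * z powr (- \<kappa>)"
        using B N by (intro mult_right_mono mult_mono) auto
      finally show ?thesis .
    next
      assume "k \<le> B2 * (N * T powr (\<alpha> * \<kappa>) * z powr (- \<kappa>))"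
      also have "\<dots> = B2 * (N * T powr (\<alpha> * \<kappa>)) * z powr (- \<kappa>)" by simp
      also have "\<dots> \<le> (B1 + B2) * (N powr (1 - \<kappa>) + N * T powr (\<alpha> * \<kappa>)) * z powr (- \<kappa>)"
        using B N by (intro mult_right_mono mult_mono) auto
      finally show ?thesis .
    qed
  qed
qed

text \<open>Up to time \<open>N powr (- 1 / \<alpha>)\<close> the curve moves by at most a multiple
  of \<open>1 / N\<close>, and \<open>t * N\<^sup>2\<close> is bounded as well. So
  \<open>E t x \<xi> - E 0 x \<xi>\<close> is \<open>cis (x * \<xi>)\<close> times a slowly varying
  amplitude, and the kernel behaves like one with linear phase \<open>(x - y) * \<xi>\<close> and
  amplitudes of size \<open>N powr (\<delta> / \<alpha>)\<close>.\<close>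

lemma kernel_difference:
  fixes \<kappa> \<delta> :: real
  assumes \<kappa>: "0 \<le> \<kappa>" "\<kappa> < 1" and \<delta>: "0 \<le> \<delta>" "\<delta> < \<alpha>"
  obtains C where "C > 0" and
    "\<And>N s t x y. \<lbrakk>N \<ge> 1; 0 < s; s \<le> N powr (- 1 / \<alpha>); 0 < t; t \<le> N powr (- 1 / \<alpha>); x \<noteq> y\<rbrakk> \<Longrightarrow>
      cmod (LINT \<xi>:annulus N|lborel. of_real (s powr (- \<delta>)) * (E s x \<xi> - E 0 x \<xi>) *
          cnj (of_real (t powr (- \<delta>)) * (E t y \<xi> - E 0 y \<xi>)))
        \<le> C * N powr (2 * \<delta> / \<alpha> + (1 - \<kappa>)) * \<bar>x - y\<bar> powr (- \<kappa>)"
    "\<And>N t x \<xi>. \<lbrakk>N \<ge> 1; 0 < t; t \<le> N powr (- 1 / \<alpha>); \<bar>\<xi>\<bar> \<le> 2 * N\<rbrakk> \<Longrightarrow>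
      cmod (of_real (t powr (- \<delta>)) * (E t x \<xi> - E 0 x \<xi>)) \<le> C * N powr (\<delta> / \<alpha>)"
proof -
  define B where "B = 4 * C3 + 4"
  have B: "B > 0" using C3 by (simp add: B_def)
  define b where "b t x = \<gamma> (x, t) - x" for t x
  define D where "D t x \<xi> = of_real (t powr (- \<delta>)) * (cis (b t x * \<xi> + t * \<xi>\<^sup>2) - 1)" for t x \<xi>
  define D' where "D' t x \<xi> = of_real (t powr (- \<delta>)) *
      (\<i> * of_real (b t x + 2 * t * \<xi>) * cis (b t x * \<xi> + t * \<xi>\<^sup>2))" for t x \<xi>
  have D_eq: "of_real (t powr (- \<delta>)) * (E t x \<xi> - E 0 x \<xi>) = cis (x * \<xi>) * D t x \<xi>" for t x \<xi>
    by (simp add: E_def D_def b_def at_zero algebra_simps cis_mult)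
  have D_der: "(D t x has_vector_derivative D' t x \<xi>) (at \<xi> within S)" for t x \<xi> S
  proof -
    have "((\<lambda>\<xi>. cis (b t x * \<xi> + t * \<xi>\<^sup>2) - 1) has_vector_derivative
        (\<i> * of_real (b t x + 2 * t * \<xi>) * cis (b t x * \<xi> + t * \<xi>\<^sup>2) - 0)) (at \<xi> within S)"
      by (intro has_vector_derivative_diff has_vector_derivative_cis_quadratic) simp
    then show ?thesis unfolding D_def D'_def
      by (intro has_vector_derivative_mult_right) simp
  qed
  have D'_cont: "continuous_on S (D' t x)" for t x S unfolding D'_def by (intro continuous_intros)
  have D_cont: "continuous_on S (D t x)" for t x S unfolding D_def by (intro continuous_intros)
  \<comment> \<open>Since \<open>\<delta> < \<alpha>\<close>, the bound
    \<open>t powr (\<alpha> - \<delta>)\<close> for the weighted displacement increases with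
    \<open>t\<close> and is controlled at the last time
    \<open>N powr (- 1 / \<alpha>)\<close>.\<close>
  have phase: "t powr (- \<delta>) * (\<bar>b t x\<bar> + t * N) \<le> (C3 + 1) * N powr (\<delta> / \<alpha>) / N"
    if N: "N \<ge> 1" and t: "0 < t" "t \<le> N powr (- 1 / \<alpha>)" for N t x
  proof -
    have "N powr (- 1 / \<alpha>) \<le> N powr 0" using N alpha by (intro powr_mono) auto
    then have t1: "t \<le> 1" using t N by simp
    have "\<bar>b t x\<bar> \<le> C3 * \<bar>t - 0\<bar> powr \<alpha>"
      using holder[of t 0 x] t t1 by (simp add: b_def at_zero)
    then have "t powr (- \<delta>) * \<bar>b t x\<bar> \<le> t powr (- \<delta>) * (C3 * t powr \<alpha>)"
      using t by (intro mult_left_mono) auto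
    also have "\<dots> = C3 * t powr (\<alpha> - \<delta>)" by (simp add: powr_diff powr_minus_divide)
    also have "\<dots> \<le> C3 * (N powr (- 1 / \<alpha>)) powr (\<alpha> - \<delta>)"
      using t \<delta> C3 by (intro mult_left_mono powr_mono2) auto
    also have "(N powr (- 1 / \<alpha>)) powr (\<alpha> - \<delta>) = N powr (\<delta> / \<alpha> - 1)"
    proof -
      have "- 1 / \<alpha> * (\<alpha> - \<delta>) = \<delta> / \<alpha> - 1" using alpha by (simp add: field_simps)
      then show ?thesis by (simp only: powr_powr)
    qed
    also have "\<dots> = N powr (\<delta> / \<alpha>) / N" using N by (simp add: powr_diff)
    finally have 1: "t powr (- \<delta>) * \<bar>b t x\<bar> \<le> C3 * (N powr (\<delta> / \<alpha>) / N)" .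
    have "t powr (- \<delta>) * (t * N) = t powr (1 - \<delta>) * N"
      using t by (simp add: powr_diff powr_minus_divide)
    also have "\<dots> \<le> (N powr (- 1 / \<alpha>)) powr (1 - \<delta>) * N"
      using t \<delta> alpha N by (intro mult_right_mono powr_mono2) auto
    also have "\<dots> = N powr (- (1 - \<delta>) / \<alpha> + 1)"
    proof -
      have "(N powr (- 1 / \<alpha>)) powr (1 - \<delta>) * N = N powr (- 1 / \<alpha> * (1 - \<delta>)) * N powr 1"
        unfolding powr_powr using N by simp
      also have "\<dots> = N powr (- 1 / \<alpha> * (1 - \<delta>) + 1)" by (rule powr_add[symmetric])
      also have "- 1 / \<alpha> * (1 - \<delta>) + 1 = - (1 - \<delta>) / \<alpha> + 1"
        using alpha by (simp add: field_simps)
      finally show ?thesis .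
    qed
    \<comment> \<open>The exponents compare because \<open>1 / \<alpha> \<ge> 2\<close>.\<close>
    also have "\<dots> \<le> N powr (\<delta> / \<alpha> - 1)"
      using N alpha \<delta> by (intro powr_mono) (auto simp: field_simps)
    also have "\<dots> = N powr (\<delta> / \<alpha>) / N" using N by (simp add: powr_diff)
    finally have 2: "t powr (- \<delta>) * (t * N) \<le> N powr (\<delta> / \<alpha>) / N" .
    show ?thesis using 1 2 by (simp add: algebra_simps add_divide_distrib)
  qed
  have D_bd: "cmod (D t x \<xi>) \<le> B * N powr (\<delta> / \<alpha>)" and D'_bd: "cmod (D' t x \<xi>) \<le> B * N powr (\<delta> / \<alpha>) / N"
    if N: "N \<ge> 1" and t: "0 < t" "t \<le> N powr (- 1 / \<alpha>)" and \<xi>: "\<bar>\<xi>\<bar> \<le> 2 * N" for N t x \<xi>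
  proof -
    have "\<xi>\<^sup>2 \<le> (2 * N) * (2 * N)"
      unfolding power2_abs[of \<xi>, symmetric] unfolding power2_eq_square using \<xi> by (intro mult_mono) auto
    then have "\<bar>b t x * \<xi> + t * \<xi>\<^sup>2\<bar> \<le> \<bar>b t x\<bar> * (2 * N) + t * ((2 * N) * (2 * N))"
      using t \<xi> by (intro order_trans[OF abs_triangle_ineq] add_mono) (auto simp: abs_mult intro!: mult_left_mono)
    also have "\<dots> \<le> 4 * N * (\<bar>b t x\<bar> + t * N) - 2 * N * \<bar>b t x\<bar>" by (simp add: algebra_simps)
    finally have ph: "\<bar>b t x * \<xi> + t * \<xi>\<^sup>2\<bar> \<le> 4 * N * (\<bar>b t x\<bar> + t * N) - 2 * N * \<bar>b t x\<bar>" .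
    have "cmod (D t x \<xi>) \<le> t powr (- \<delta>) * \<bar>b t x * \<xi> + t * \<xi>\<^sup>2\<bar>"
      unfolding D_def norm_mult using norm_cis_minus_one_le by (auto intro!: mult_left_mono)
    also have "\<dots> \<le> t powr (- \<delta>) * (4 * N * (\<bar>b t x\<bar> + t * N))"
      using ph N by (intro mult_left_mono) (auto intro: order_trans)
    also have "\<dots> = 4 * N * (t powr (- \<delta>) * (\<bar>b t x\<bar> + t * N))" by simp
    also have "\<dots> \<le> 4 * N * ((C3 + 1) * N powr (\<delta> / \<alpha>) / N)"
      using N by (intro mult_left_mono phase t) auto
    also have "\<dots> = 4 * (C3 + 1) * N powr (\<delta> / \<alpha>)" using N by simp
    finally show "cmod (D t x \<xi>) \<le> B * N powr (\<delta> / \<alpha>)" by (simp add: B_def)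
    have "\<bar>2 * t * \<xi>\<bar> = 2 * t * \<bar>\<xi>\<bar>" using t by (simp add: abs_mult)
    also have "\<dots> \<le> 2 * t * (2 * N)" using t \<xi> by (intro mult_left_mono) auto
    finally have "\<bar>2 * t * \<xi>\<bar> \<le> 2 * t * (2 * N)" .
    then have "\<bar>b t x + 2 * t * \<xi>\<bar> \<le> 4 * (\<bar>b t x\<bar> + t * N)"
    proof -
      assume le: "\<bar>2 * t * \<xi>\<bar> \<le> 2 * t * (2 * N)"
      have "\<bar>b t x + 2 * t * \<xi>\<bar> \<le> \<bar>b t x\<bar> + \<bar>2 * t * \<xi>\<bar>" by (rule abs_triangle_ineq)
      also have "\<dots> \<le> 4 * \<bar>b t x\<bar> + 2 * t * (2 * N)" by (intro add_mono le) simp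
      finally show ?thesis by simp
    qed
    then have "t powr (- \<delta>) * \<bar>b t x + 2 * t * \<xi>\<bar> \<le> t powr (- \<delta>) * (4 * (\<bar>b t x\<bar> + t * N))"
      by (intro mult_left_mono) auto
    also have "\<dots> = 4 * (t powr (- \<delta>) * (\<bar>b t x\<bar> + t * N))" by simp
    also have "\<dots> \<le> 4 * ((C3 + 1) * N powr (\<delta> / \<alpha>) / N)"
      by (rule mult_left_mono[OF phase[OF N t]]) simp
    also have "\<dots> = B * N powr (\<delta> / \<alpha>) / N" by (simp add: B_def)
    finally show "cmod (D' t x \<xi>) \<le> B * N powr (\<delta> / \<alpha>) / N"
      unfolding D'_def norm_mult norm_of_real norm_ii norm_cis by simp
  qed
  \<comment> \<open>Lets one constant serve both conclusions, of which one is quadratic and the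
    other linear in \<open>B\<close>.\<close>
  have Bm: "B \<le> 16 * B\<^sup>2" using C3 by (simp add: B_def power2_eq_square)
  show ?thesis
  proof (rule that[of "16 * B\<^sup>2"])
    show "16 * B\<^sup>2 > 0" using B by simp
    show "cmod (of_real (t powr (- \<delta>)) * (E t x \<xi> - E 0 x \<xi>)) \<le> 16 * B\<^sup>2 * N powr (\<delta> / \<alpha>)"
      if "N \<ge> 1" "0 < t" "t \<le> N powr (- 1 / \<alpha>)" "\<bar>\<xi>\<bar> \<le> 2 * N" for N t x \<xi>
    proof -
      have "cmod (of_real (t powr (- \<delta>)) * (E t x \<xi> - E 0 x \<xi>)) \<le> B * N powr (\<delta> / \<alpha>)"
        unfolding D_eq using D_bd[OF that] by (simp add: norm_mult)
      also have "\<dots> \<le> 16 * B\<^sup>2 * N powr (\<delta> / \<alpha>)" using Bm by (intro mult_right_mono) auto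
      finally show ?thesis .
    qed
    fix N s t x y :: real
    assume N: "N \<ge> 1" and s: "0 < s" "s \<le> N powr (- 1 / \<alpha>)" and t: "0 < t" "t \<le> N powr (- 1 / \<alpha>)" and xy: "x \<noteq> y"
    define A where "A = B * N powr (\<delta> / \<alpha>)"
    have A: "A > 0" using B N by (simp add: A_def)
    define h where "h \<xi> = D s x \<xi> * cnj (D t y \<xi>)" for \<xi>
    define h' where "h' \<xi> = D s x \<xi> * cnj (D' t y \<xi>) + D' s x \<xi> * cnj (D t y \<xi>)" for \<xi>
    have h_der: "(h has_vector_derivative h' \<xi>) (at \<xi> within S)" for \<xi> S
      unfolding h_def h'_def by (intro has_vector_derivative_mult D_der has_vector_derivative_cnj)
    have h'_cont: "continuous_on S h'" for S
      unfolding h'_def by (intro continuous_intros D_cont D'_cont)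
    have h_cont: "continuous_on S h" for S
      unfolding h_def by (intro continuous_intros D_cont)
    have h_bd: "cmod (h \<xi>) \<le> A\<^sup>2" if "\<bar>\<xi>\<bar> \<le> 2 * N" for \<xi>
      unfolding h_def norm_mult complex_mod_cnj power2_eq_square A_def
      using A by (intro mult_mono D_bd N s t that) (auto simp: A_def)
    have h'_bd: "cmod (h' \<xi>) \<le> 2 * A\<^sup>2 / N" if "\<bar>\<xi>\<bar> \<le> 2 * N" for \<xi>
    proof -
      have bds: "cmod (D s x \<xi>) \<le> A" "cmod (D t y \<xi>) \<le> A" "cmod (D' s x \<xi>) \<le> A / N" "cmod (D' t y \<xi>) \<le> A / N"
        using D_bd[OF N s that, of x] D_bd[OF N t that, of y] D'_bd[OF N s that, of x] D'_bd[OF N t that, of y]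
        by (auto simp: A_def)
      have "cmod (D s x \<xi> * cnj (D' t y \<xi>)) \<le> A * (A / N)" "cmod (D' s x \<xi> * cnj (D t y \<xi>)) \<le> (A / N) * A"
        unfolding norm_mult complex_mod_cnj using A N by (intro mult_mono bds; simp)+
      then have "cmod (h' \<xi>) \<le> A * (A / N) + (A / N) * A"
        unfolding h'_def by (intro norm_triangle_le add_mono)
      then show ?thesis by (simp add: power2_eq_square)
    qed
    define I where "I = (LINT \<xi>:annulus N|lborel. cis ((x - y) * \<xi>) * h \<xi>)"
    have eq: "(LINT \<xi>:annulus N|lborel. of_real (s powr (- \<delta>)) * (E s x \<xi> - E 0 x \<xi>) *
          cnj (of_real (t powr (- \<delta>)) * (E t y \<xi> - E 0 y \<xi>))) = I"
    proof -
      have "of_real (s powr (- \<delta>)) * (E s x \<xi> - E 0 x \<xi>) *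
          cnj (of_real (t powr (- \<delta>)) * (E t y \<xi> - E 0 y \<xi>)) = cis ((x - y) * \<xi>) * h \<xi>" for \<xi>
      proof -
        have "cis ((x - y) * \<xi>) = cis (x * \<xi>) * cnj (cis (y * \<xi>))"
          by (simp add: cis_cnj cis_mult algebra_simps)
        then show ?thesis unfolding D_eq h_def by simp
      qed
      then show ?thesis unfolding I_def by simp
    qed
    have cont: "continuous_on UNIV (\<lambda>\<xi>. cis ((x - y) * \<xi>) * h \<xi>)" by (intro continuous_intros h_cont)
    \<comment> \<open>Each half of the annulus gives \<open>2 * A\<^sup>2\<close> from the boundary
      terms and \<open>N * (2 * A\<^sup>2 / N)\<close> from the derivative of the amplitude.\<close>
    have small: "cmod I \<le> 2 * (4 * A\<^sup>2 / \<bar>x - y\<bar>)"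
      unfolding I_def
    proof (rule norm_set_integral_annulus_le[OF cont])
      have *: "cmod (integral {p..q} (\<lambda>\<xi>. cis ((x - y) * \<xi>) * h \<xi>)) \<le> 4 * A\<^sup>2 / \<bar>x - y\<bar>"
        if "q - p = N" "{p..q} \<subseteq> {- 2 * N..2 * N}" for p q
      proof -
        have "cmod (integral {p..q} (\<lambda>\<xi>. cis ((x - y) * \<xi>) * h \<xi>))
            \<le> (2 * A\<^sup>2 + (q - p) * (2 * A\<^sup>2 / N)) / \<bar>x - y\<bar>"
        proof (rule norm_integral_cis_linear_le)
          show "p \<le> q" using that N by simp
          show "cmod (h \<xi>) \<le> A\<^sup>2" "cmod (h' \<xi>) \<le> 2 * A\<^sup>2 / N" if "\<xi> \<in> {p..q}" for \<xi>
            using h_bd[of \<xi>] h'_bd[of \<xi>] that \<open>{p..q} \<subseteq> {- 2 * N..2 * N}\<close> by (auto simp: abs_le_iff)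
        qed (use xy h_der h'_cont in auto)
        also have "(2 * A\<^sup>2 + (q - p) * (2 * A\<^sup>2 / N)) = 4 * A\<^sup>2" using that N by simp
        finally show ?thesis .
      qed
      show "cmod (integral {N..2 * N} (\<lambda>\<xi>. cis ((x - y) * \<xi>) * h \<xi>)) \<le> 4 * A\<^sup>2 / \<bar>x - y\<bar>"
        "cmod (integral {- 2 * N..- N} (\<lambda>\<xi>. cis ((x - y) * \<xi>) * h \<xi>)) \<le> 4 * A\<^sup>2 / \<bar>x - y\<bar>"
        using N by (intro *; auto)+
    qed (use N in simp)
    have large: "cmod I \<le> 2 * (N * A\<^sup>2)"
      unfolding I_def
    proof (rule norm_set_integral_annulus_le[OF cont])
      have *: "cmod (integral {p..q} (\<lambda>\<xi>. cis ((x - y) * \<xi>) * h \<xi>)) \<le> N * A\<^sup>2"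
        if "q - p = N" "{p..q} \<subseteq> {- 2 * N..2 * N}" for p q
      proof -
        have "cmod (integral {p..q} (\<lambda>\<xi>. cis ((x - y) * \<xi>) * h \<xi>)) \<le> integral {p..q} (\<lambda>_. A\<^sup>2)"
        proof (rule integral_norm_bound_integral)
          show "(\<lambda>\<xi>. cis ((x - y) * \<xi>) * h \<xi>) integrable_on {p..q}"
            by (intro integrable_continuous_real continuous_on_subset[OF cont]) auto
          show "cmod (cis ((x - y) * \<xi>) * h \<xi>) \<le> A\<^sup>2" if "\<xi> \<in> {p..q}" for \<xi>
            using h_bd[of \<xi>] that \<open>{p..q} \<subseteq> {- 2 * N..2 * N}\<close> by (auto simp: abs_le_iff norm_mult)
        qed (intro integrable_continuous_real continuous_intros)
        then show ?thesis using that N by simp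
      qed
      show "cmod (integral {N..2 * N} (\<lambda>\<xi>. cis ((x - y) * \<xi>) * h \<xi>)) \<le> N * A\<^sup>2"
        "cmod (integral {- 2 * N..- N} (\<lambda>\<xi>. cis ((x - y) * \<xi>) * h \<xi>)) \<le> N * A\<^sup>2"
        using N by (intro *; auto)+
    qed (use N in simp)
    have small': "cmod I \<le> 8 * A\<^sup>2 / \<bar>x - y\<bar>" and large': "cmod I \<le> 8 * A\<^sup>2 * N"
      using small large A N by (auto simp: mult.commute intro: order_trans)
    have "cmod I \<le> (8 * A\<^sup>2 * N) powr (1 - \<kappa>) * (8 * A\<^sup>2 / \<bar>x - y\<bar>) powr \<kappa>"
      using \<kappa> by (intro le_interpolation small' large') auto
    also have "\<dots> = (8 * A\<^sup>2) powr (1 - \<kappa>) * (8 * A\<^sup>2) powr \<kappa> * (N powr (1 - \<kappa>) * \<bar>x - y\<bar> powr (- \<kappa>))"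
      using N by (simp add: powr_mult[of "8 * A\<^sup>2"] powr_divide powr_minus_divide)
    also have "(8 * A\<^sup>2) powr (1 - \<kappa>) * (8 * A\<^sup>2) powr \<kappa> = 8 * A\<^sup>2"
      using A by (simp add: powr_add[symmetric])
    also have "8 * A\<^sup>2 = 8 * B\<^sup>2 * N powr (2 * \<delta> / \<alpha>)"
      using N by (simp add: A_def power_mult_distrib power2_eq_square powr_add[symmetric])
    also have "8 * B\<^sup>2 * N powr (2 * \<delta> / \<alpha>) * (N powr (1 - \<kappa>) * \<bar>x - y\<bar> powr (- \<kappa>))
      \<le> 16 * B\<^sup>2 * N powr (2 * \<delta> / \<alpha>) * (N powr (1 - \<kappa>) * \<bar>x - y\<bar> powr (- \<kappa>))"
      by (intro mult_right_mono) auto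
    also have "\<dots> = 16 * B\<^sup>2 * N powr (2 * \<delta> / \<alpha> + (1 - \<kappa>)) * \<bar>x - y\<bar> powr (- \<kappa>)"
      by (simp add: powr_add)
    finally show "cmod (LINT \<xi>:annulus N|lborel. of_real (s powr (- \<delta>)) * (E s x \<xi> - E 0 x \<xi>) *
          cnj (of_real (t powr (- \<delta>)) * (E t y \<xi> - E 0 y \<xi>)))
        \<le> 16 * B\<^sup>2 * N powr (2 * \<delta> / \<alpha> + (1 - \<kappa>)) * \<bar>x - y\<bar> powr (- \<kappa>)"
      unfolding eq .
  qed
qed

end

section \<open>Maximal estimates for dyadic blocks\<close>

lemma annulus_integrable_of_square:
  assumes [measurable]: "g \<in> borel_measurable borel" and N: "N \<ge> 0"
    and g2: "finite_energy N g"
  shows "set_integrable lborel (annulus N) (g :: real \<Rightarrow> complex)"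
  unfolding set_integrable_def
proof (rule Bochner_Integration.integrable_bound)
  have "integrable lborel (\<lambda>\<xi>. indicator (annulus N) \<xi> :: real)"
    using N by (intro integrable_real_indicator) (auto simp: emeasure_annulus)
  then show "integrable lborel (\<lambda>\<xi>. indicator (annulus N) \<xi> + indicator (annulus N) \<xi> *\<^sub>R (cmod (g \<xi>))\<^sup>2)"
    using g2 by (auto simp: set_integrable_def)
show "AE \<xi> in lborel. norm (indicator (annulus N) \<xi> *\<^sub>R g \<xi>)
      \<le> norm (indicator (annulus N) \<xi> + indicator (annulus N) \<xi> *\<^sub>R (cmod (g \<xi>))\<^sup>2)"
    by (intro AE_I2) (auto simp: indicator_def intro: le_one_plus_square)
qed measurable

context holder_curve
begin

definition block :: "(real \<Rightarrow> complex) \<Rightarrow> real \<Rightarrow> real \<Rightarrow> real \<Rightarrow> complex" where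
  "block g N t x = (LINT \<xi>:annulus N|lborel. E t x \<xi> * g \<xi>)"

lemma E_measurable_snd[measurable]: "E t x \<in> borel_measurable borel"
  using continuous_E by (intro borel_measurable_continuous_onI)

lemma E_measurable:
  assumes "t \<in> {-1..1}"
  shows "(\<lambda>(x, \<xi>). E t x \<xi>) \<in> borel_measurable (borel \<Otimes>\<^sub>M borel)"
proof -
  have "continuous_on UNIV (\<lambda>x. \<gamma> (x, t))"
    by (rule continuous_on_compose2[OF cont]) (use assms in \<open>auto intro!: continuous_intros\<close>)
  then have [measurable]: "(\<lambda>x. \<gamma> (x, t)) \<in> borel_measurable borel"
    by (rule borel_measurable_continuous_onI)
  have [measurable]: "cis \<in> borel_measurable borel"
    by (intro borel_measurable_continuous_onI continuous_intros)
  show ?thesis unfolding E_def case_prod_beta' by measurable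
qed

lemma set_integrable_E_mult:
  assumes "A \<in> sets borel" "g \<in> borel_measurable borel" "set_integrable lborel A g"
  shows "set_integrable lborel A (\<lambda>\<xi>. E t x \<xi> * g \<xi>)"
proof -
  note [measurable] = assms(1,2)
  show ?thesis unfolding set_integrable_def
    by (rule Bochner_Integration.integrable_bound[OF assms(3)[unfolded set_integrable_def]])
       (auto simp: norm_mult)
qed

text \<open>On bounded frequency sets the propagator is \<alpha>-Hoelder in time, uniformly in
  \<open>x\<close>. This yields both the continuity in \<open>t\<close> that the maximal theorem
  requires and the convergence of each single block.\<close>

lemma norm_integral_E_diff_le:
  assumes A: "A \<in> sets borel" "\<And>\<xi>. \<xi> \<in> A \<Longrightarrow> \<bar>\<xi>\<bar> \<le> R"
    and g: "g \<in> borel_measurable borel" "set_integrable lborel A g"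
    and st: "s \<in> {-1..1}" "t \<in> {-1..1}" and R: "R \<ge> 0"
  shows "cmod ((LINT \<xi>:A|lborel. E s x \<xi> * g \<xi>) - (LINT \<xi>:A|lborel. E t x \<xi> * g \<xi>))
    \<le> (C3 * R * \<bar>s - t\<bar> powr \<alpha> + R\<^sup>2 * \<bar>s - t\<bar>) * (LINT \<xi>:A|lborel. cmod (g \<xi>))"
proof -
  define c where "c = C3 * R * \<bar>s - t\<bar> powr \<alpha> + R\<^sup>2 * \<bar>s - t\<bar>"
  have E: "cmod (E s x \<xi> - E t x \<xi>) \<le> c" if "\<xi> \<in> A" for \<xi>
  proof -
    define d where "d = (\<gamma> (x, s) - \<gamma> (x, t)) * \<xi> + (s - t) * \<xi>\<^sup>2"
    have "E s x \<xi> - E t x \<xi> = E t x \<xi> * (cis d - 1)"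
      by (simp add: E_def d_def cis_mult algebra_simps)
    then have "cmod (E s x \<xi> - E t x \<xi>) \<le> \<bar>d\<bar>"
      by (simp add: norm_mult norm_cis_minus_one_le)
    also have "\<dots> \<le> \<bar>\<gamma> (x, s) - \<gamma> (x, t)\<bar> * \<bar>\<xi>\<bar> + \<bar>s - t\<bar> * (\<bar>\<xi>\<bar> * \<bar>\<xi>\<bar>)"
      unfolding d_def by (rule order_trans[OF abs_triangle_ineq]) (simp add: abs_mult power2_eq_square)
    also have "\<dots> \<le> (C3 * \<bar>s - t\<bar> powr \<alpha>) * R + \<bar>s - t\<bar> * (R * R)"
      using holder[OF st] A(2)[OF that] R C3 by (intro add_mono mult_mono) auto
    finally show ?thesis by (simp add: c_def power2_eq_square mult_ac)
  qed
  have "(LINT \<xi>:A|lborel. E s x \<xi> * g \<xi>) - (LINT \<xi>:A|lborel. E t x \<xi> * g \<xi>)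
      = (LINT \<xi>:A|lborel. E s x \<xi> * g \<xi> - E t x \<xi> * g \<xi>)"
    by (rule set_integral_diff(2)[symmetric]) (intro set_integrable_E_mult A(1) g)+
  also have "cmod \<dots> \<le> (\<integral>\<xi>. c * (indicator A \<xi> * cmod (g \<xi>)) \<partial>lborel)"
    unfolding set_lebesgue_integral_def
  proof (rule norm_integral_le_integral)
    show "integrable lborel (\<lambda>\<xi>. c * (indicator A \<xi> * cmod (g \<xi>)))"
      using set_integrable_norm[OF g(2)] by (simp add: set_integrable_def)
    show "cmod (indicator A \<xi> *\<^sub>R (E s x \<xi> * g \<xi> - E t x \<xi> * g \<xi>)) \<le> c * (indicator A \<xi> * cmod (g \<xi>))" for \<xi>
      using E[of \<xi>] by (auto simp: indicator_def norm_mult left_diff_distrib[symmetric] intro!: mult_right_mono)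
  qed
  also have "\<dots> = c * (LINT \<xi>:A|lborel. cmod (g \<xi>))"
    by (simp add: set_lebesgue_integral_def)
  finally show ?thesis by (simp add: c_def)
qed

lemma continuous_on_block:
  assumes g: "g \<in> borel_measurable borel" and N: "N \<ge> 0"
    and g1: "set_integrable lborel (annulus N) g"
  shows "continuous_on {-1..1} (\<lambda>t. block g N t x)"
  unfolding continuous_on_def
proof
  fix t :: real assume t: "t \<in> {-1..1}"
  define B where "B s = (C3 * (2 * N) * \<bar>s - t\<bar> powr \<alpha> + (2 * N)\<^sup>2 * \<bar>s - t\<bar>) * (LINT \<xi>:annulus N|lborel. cmod (g \<xi>))" for s
  show "((\<lambda>s. block g N s x) \<longlongrightarrow> block g N t x) (at t within {-1..1})"
  proof (rule Lim_transform_bound[THEN LIM_zero_cancel])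
    show "\<forall>\<^sub>F s in at t within {-1..1}. cmod (block g N s x - block g N t x) \<le> norm (B s)"
      using eventually_at_topological
    proof (auto simp: eventually_at_topological intro!: exI[of _ UNIV])
      fix s :: real assume s: "- 1 \<le> s" "s \<le> 1"
      have "cmod (block g N s x - block g N t x) \<le> B s"
        unfolding block_def B_def using N t s g g1
        by (intro norm_integral_E_diff_le) (auto simp: annulus_def)
      then show "cmod (block g N s x - block g N t x) \<le> \<bar>B s\<bar>" by simp
    qed
    have "((\<lambda>s. \<bar>s - t\<bar> powr \<alpha>) \<longlongrightarrow> \<bar>t - t\<bar> powr \<alpha>) (at t within {-1..1})"
      by (rule tendsto_powr') (use alpha in \<open>auto intro!: always_eventually\<close>, intro tendsto_eq_intros, auto)
    note h1 = this
    have h2: "((\<lambda>s. \<bar>s - t\<bar>) \<longlongrightarrow> \<bar>t - t\<bar>) (at t within {-1..1})"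
      by (intro tendsto_intros)
    have "(B \<longlongrightarrow> (C3 * (2 * N) * \<bar>t - t\<bar> powr \<alpha> + (2 * N)\<^sup>2 * \<bar>t - t\<bar>) * (LINT \<xi>:annulus N|lborel. cmod (g \<xi>))) (at t within {-1..1})"
      unfolding B_def by (intro tendsto_mult tendsto_add tendsto_const h1 h2)
    then show "(B \<longlongrightarrow> 0) (at t within {-1..1})" using alpha by simp
  qed
qed

text \<open>Time is frozen at 0; stating the bound for a constant family over all of
  \<open>UNIV\<close> lets it be added to bounds for families depending on \<open>t\<close>.\<close>

lemma maximal_block_zero:
  fixes m \<kappa> :: real
  assumes m: "m > 0" and \<kappa>: "1 / 2 \<le> \<kappa>" "\<kappa> < 1"
  obtains C where "C > 0" and "\<And>g N. \<lbrakk>N \<ge> 1; g \<in> borel_measurable borel;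
      finite_energy N g\<rbrakk> \<Longrightarrow>
    maximal_L2_le m UNIV (\<lambda>t. block g N 0) (C * N powr (1 - \<kappa>) * energy N g)"
proof -
  have \<kappa>0: "0 < \<kappa>" using \<kappa> by simp
  obtain Cs where Cs: "Cs > 0" and short: "\<And>N T s t x y. \<lbrakk>N \<ge> 1; T * N\<^sup>2 \<le> 1; 0 < T; s \<in> {-1..1}; t \<in> {-1..1}; \<bar>s - t\<bar> \<le> T; x \<noteq> y\<rbrakk> \<Longrightarrow>
    cmod (kernel N s x t y)
      \<le> Cs * (N powr (1 - \<kappa>) + N * T powr (\<alpha> * \<kappa>)) * \<bar>x - y\<bar> powr (- \<kappa>)"
    by (rule kernel_short_time[OF \<kappa>0 \<kappa>(2)]) (rule that)
  show ?thesis
  proof (rule that[of "riesz_const m \<kappa> * (2 * Cs)"])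
    show "riesz_const m \<kappa> * (2 * Cs) > 0" using riesz_const_pos[OF m \<kappa>(2)] Cs by simp
    fix g N assume N: "N \<ge> 1" and g: "g \<in> borel_measurable borel"
      "finite_energy N g"
    \<comment> \<open>With \<open>s = t = 0\<close> the window length is free. This choice makes
      \<open>N * T powr (\<alpha> * \<kappa>)\<close> equal to 1, and
      \<open>T * N\<^sup>2 \<le> 1\<close> holds because
      \<open>\<alpha> * \<kappa> \<le> 1 / 2\<close>.\<close>
    define T where "T = N powr (- 1 / (\<alpha> * \<kappa>))"
    have ak: "0 < \<alpha> * \<kappa>" "\<alpha> * \<kappa> \<le> 1 / 2"
      using alpha \<kappa> mult_mono[of \<alpha> "1/4" \<kappa> 1] by auto
    have T: "0 < T" using N by (simp add: T_def)
    have "T * N\<^sup>2 = N powr (2 - 1 / (\<alpha> * \<kappa>))"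
      using N by (simp add: T_def powr_diff powr_minus_divide powr_numeral)
    also have "\<dots> \<le> N powr 0" using N ak by (intro powr_mono) (auto simp: field_simps)
    finally have TN: "T * N\<^sup>2 \<le> 1" using N by simp
    have "- 1 / (\<alpha> * \<kappa>) * (\<alpha> * \<kappa>) = - 1" using alpha \<kappa> by simp
    then have "T powr (\<alpha> * \<kappa>) = N powr (- 1)" unfolding T_def powr_powr by (simp only:)
    then have "N * T powr (\<alpha> * \<kappa>) = 1" using N by (simp add: powr_minus_divide)
    also have "1 \<le> N powr (1 - \<kappa>)" using N \<kappa> by (intro ge_one_powr_ge_zero) auto
    finally have NT: "N * T powr (\<alpha> * \<kappa>) \<le> N powr (1 - \<kappa>)" .
    have "maximal_L2_le m {0} (\<lambda>t x. LINT \<xi>:annulus N|lborel. E t x \<xi> * g \<xi>)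
        (riesz_const m \<kappa> * (2 * Cs * N powr (1 - \<kappa>)) * energy N g)"
    proof (rule maximal_annulus[OF m \<kappa>(2), where K=1])
      fix s t x y :: real assume st: "s \<in> {0}" "t \<in> {0}" and xy: "x \<noteq> y"
      have "cmod (kernel N s x t y)
        \<le> Cs * (N powr (1 - \<kappa>) + N * T powr (\<alpha> * \<kappa>)) * \<bar>x - y\<bar> powr (- \<kappa>)"
        using N TN T st xy by (intro short) auto
      also have "\<dots> \<le> Cs * (N powr (1 - \<kappa>) + N powr (1 - \<kappa>)) * \<bar>x - y\<bar> powr (- \<kappa>)"
        using NT Cs by (intro mult_left_mono mult_right_mono add_mono) auto
      finally show "cmod (kernel N s x t y)
        \<le> 2 * Cs * N powr (1 - \<kappa>) * \<bar>x - y\<bar> powr (- \<kappa>)" by simp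
    qed (use N Cs g E_measurable in auto)
    then show "maximal_L2_le m UNIV (\<lambda>t. block g N 0) (riesz_const m \<kappa> * (2 * Cs) * N powr (1 - \<kappa>) * energy N g)"
      by (auto simp: maximal_L2_le_def block_def[abs_def] mult.assoc)
  qed
qed

text \<open>From time \<open>T\<close> on the weight is at most \<open>T powr (- \<delta>)\<close>;
  it enters the kernel of T T* twice.\<close>

lemma maximal_block_weighted:
  fixes m \<kappa> \<delta> :: real
  assumes m: "m > 0" and \<kappa>: "\<kappa> < 1" and \<delta>: "0 \<le> \<delta>"
  obtains C where "C > 0" and "\<And>g N Q T P. \<lbrakk>N \<ge> 0; g \<in> borel_measurable borel;
      finite_energy N g; 0 < T; P \<subseteq> {T..1}; Q > 0;
      \<And>s t x y. s \<in> P \<Longrightarrow> t \<in> P \<Longrightarrow> x \<noteq> y \<Longrightarrow> x \<in> {- m..m} \<Longrightarrow> y \<in> {- m..m} \<Longrightarrow>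
        cmod (kernel N s x t y) \<le> Q * \<bar>x - y\<bar> powr (- \<kappa>)\<rbrakk> \<Longrightarrow>
    maximal_L2_le m P (\<lambda>t x. of_real (t powr (- \<delta>)) * block g N t x)
      (C * (T powr (- 2 * \<delta>) * Q) * energy N g)"
proof -
  show ?thesis
  proof (rule that[OF riesz_const_pos[OF m \<kappa>]])
    fix g N Q T P assume N: "N \<ge> 0" and g: "g \<in> borel_measurable borel"
      "finite_energy N g" and T: "0 < T" "P \<subseteq> {T..1}" and Q: "Q > 0"
      and ker: "\<And>s t x y. s \<in> P \<Longrightarrow> t \<in> P \<Longrightarrow> x \<noteq> y \<Longrightarrow> x \<in> {- m..m} \<Longrightarrow> y \<in> {- m..m} \<Longrightarrow>
        cmod (kernel N s x t y) \<le> Q * \<bar>x - y\<bar> powr (- \<kappa>)"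
    have w: "0 \<le> t powr (- \<delta>)" "t powr (- \<delta>) \<le> T powr (- \<delta>)" if "t \<in> P" for t
      using that T \<delta> by (auto intro!: powr_mono2')
    have "maximal_L2_le m P (\<lambda>t x. LINT \<xi>:annulus N|lborel. (of_real (t powr (- \<delta>)) * E t x \<xi>) * g \<xi>)
      (riesz_const m \<kappa> * (T powr (- 2 * \<delta>) * Q) * energy N g)"
    proof (rule maximal_annulus[OF m \<kappa>, where K="T powr (- \<delta>)"])
      fix t assume t: "t \<in> P"
      then have "t \<in> {-1..1}" using T by auto
      note [measurable] = E_measurable[OF this]
      show "(\<lambda>(x, \<xi>). of_real (t powr (- \<delta>)) * E t x \<xi>) \<in> borel_measurable (borel \<Otimes>\<^sub>M borel)"
        by measurable
    next
      fix t x \<xi> assume "t \<in> P"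
      then show "cmod (of_real (t powr (- \<delta>)) * E t x \<xi>) \<le> T powr (- \<delta>)"
        using w by (simp add: norm_mult)
    next
      fix s t x y :: real assume st: "s \<in> P" "t \<in> P" and xy: "x \<noteq> y" "x \<in> {- m..m}" "y \<in> {- m..m}"
      have "(LINT \<xi>:annulus N|lborel. (of_real (s powr (- \<delta>)) * E s x \<xi>) * cnj (of_real (t powr (- \<delta>)) * E t y \<xi>))
        = of_real (s powr (- \<delta>) * t powr (- \<delta>)) * (kernel N s x t y)"
        by (subst set_integral_mult_right[symmetric]) (simp add: mult_ac)
      also have "cmod \<dots> = s powr (- \<delta>) * t powr (- \<delta>) * cmod (kernel N s x t y)"
        unfolding norm_mult norm_of_real by simp
      also have "\<dots> \<le> T powr (- \<delta>) * T powr (- \<delta>) * (Q * \<bar>x - y\<bar> powr (- \<kappa>))"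
        by (intro mult_mono w(2) st ker xy) auto
      also have "T powr (- \<delta>) * T powr (- \<delta>) = T powr (- 2 * \<delta>)" by (simp add: powr_add[symmetric])
      finally show "cmod (LINT \<xi>:annulus N|lborel. (of_real (s powr (- \<delta>)) * E s x \<xi>) * cnj (of_real (t powr (- \<delta>)) * E t y \<xi>))
        \<le> T powr (- 2 * \<delta>) * Q * \<bar>x - y\<bar> powr (- \<kappa>)" by simp
    next
      fix x
      have "continuous_on P (\<lambda>t. of_real (t powr (- \<delta>)) * block g N t x)"
        using T by (intro continuous_intros continuous_on_subset[OF continuous_on_block]
          annulus_integrable_of_square g N) auto
      then show "continuous_on P (\<lambda>t. LINT \<xi>:annulus N|lborel. (of_real (t powr (- \<delta>)) * E t x \<xi>) * g \<xi>)"
        by (simp add: block_def mult.assoc)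
    qed (use N T Q g in auto)
    then show "maximal_L2_le m P (\<lambda>t x. of_real (t powr (- \<delta>)) * block g N t x)
      (riesz_const m \<kappa> * (T powr (- 2 * \<delta>) * Q) * energy N g)"
      by (simp add: block_def mult.assoc)
  qed
qed

lemma maximal_block_small_time:
  fixes m \<kappa> \<delta> :: real
  assumes m: "m > 0" and \<kappa>: "0 \<le> \<kappa>" "\<kappa> < 1" and \<delta>: "0 \<le> \<delta>" "\<delta> < \<alpha>"
  obtains C where "C > 0" and "\<And>g N. \<lbrakk>N \<ge> 1; g \<in> borel_measurable borel;
      finite_energy N g\<rbrakk> \<Longrightarrow>
    maximal_L2_le m {0<..N powr (- 1 / \<alpha>)} (\<lambda>t x. of_real (t powr (- \<delta>)) * (block g N t x - block g N 0 x))
      (C * N powr (2 * \<delta> / \<alpha> + (1 - \<kappa>)) * energy N g)"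
proof -
  obtain Cd where Cd: "Cd > 0" and diff:
    "\<And>N s t x y. \<lbrakk>N \<ge> 1; 0 < s; s \<le> N powr (- 1 / \<alpha>); 0 < t; t \<le> N powr (- 1 / \<alpha>); x \<noteq> y\<rbrakk> \<Longrightarrow>
      cmod (LINT \<xi>:annulus N|lborel. of_real (s powr (- \<delta>)) * (E s x \<xi> - E 0 x \<xi>) *
          cnj (of_real (t powr (- \<delta>)) * (E t y \<xi> - E 0 y \<xi>)))
        \<le> Cd * N powr (2 * \<delta> / \<alpha> + (1 - \<kappa>)) * \<bar>x - y\<bar> powr (- \<kappa>)"
    "\<And>N t x \<xi>. \<lbrakk>N \<ge> 1; 0 < t; t \<le> N powr (- 1 / \<alpha>); \<bar>\<xi>\<bar> \<le> 2 * N\<rbrakk> \<Longrightarrow>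
      cmod (of_real (t powr (- \<delta>)) * (E t x \<xi> - E 0 x \<xi>)) \<le> Cd * N powr (\<delta> / \<alpha>)"
    by (rule kernel_difference[OF \<kappa> \<delta>]) (rule that)
  show ?thesis
  proof (rule that[of "riesz_const m \<kappa> * Cd"])
    show "riesz_const m \<kappa> * Cd > 0" using riesz_const_pos[OF m \<kappa>(2)] Cd by simp
    fix g N assume N: "N \<ge> 1" and g: "g \<in> borel_measurable borel"
      "finite_energy N g"
    let ?P = "{0<..N powr (- 1 / \<alpha>)}"
    have "N powr (- 1 / \<alpha>) \<le> N powr 0" using N alpha by (intro powr_mono) auto
    then have P1: "?P \<subseteq> {-1..1}" using N by auto
    have g1: "set_integrable lborel (annulus N) g"
      by (rule annulus_integrable_of_square) (use N g in auto)
    have eq: "(LINT \<xi>:annulus N|lborel. (of_real (t powr (- \<delta>)) * (E t x \<xi> - E 0 x \<xi>)) * g \<xi>)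
        = of_real (t powr (- \<delta>)) * (block g N t x - block g N 0 x)" for t x
      unfolding block_def
      by (subst set_integral_diff(2)[symmetric], (intro set_integrable_E_mult g g1; simp)+)
         (simp add: mult.assoc left_diff_distrib)
    have "maximal_L2_le m ?P (\<lambda>t x. LINT \<xi>:annulus N|lborel. (of_real (t powr (- \<delta>)) * (E t x \<xi> - E 0 x \<xi>)) * g \<xi>)
      (riesz_const m \<kappa> * (Cd * N powr (2 * \<delta> / \<alpha> + (1 - \<kappa>))) * energy N g)"
    proof (rule maximal_annulus[OF m \<kappa>(2), where K="Cd * N powr (\<delta> / \<alpha>)"])
      fix t assume t: "t \<in> ?P"
      then have "t \<in> {-1..1}" using P1 by auto
      note [measurable] = E_measurable[OF this] E_measurable[of 0]
      show "(\<lambda>(x, \<xi>). of_real (t powr (- \<delta>)) * (E t x \<xi> - E 0 x \<xi>)) \<in> borel_measurable (borel \<Otimes>\<^sub>M borel)"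
        by measurable
    next
      fix t x \<xi> assume "t \<in> ?P" "\<xi> \<in> annulus N"
      then show "cmod (of_real (t powr (- \<delta>)) * (E t x \<xi> - E 0 x \<xi>)) \<le> Cd * N powr (\<delta> / \<alpha>)"
        using N by (intro diff(2)) (auto simp: annulus_def)
    next
      fix s t x y :: real assume "s \<in> ?P" "t \<in> ?P" "x \<noteq> y"
      then show "cmod (LINT \<xi>:annulus N|lborel. of_real (s powr (- \<delta>)) * (E s x \<xi> - E 0 x \<xi>) *
          cnj (of_real (t powr (- \<delta>)) * (E t y \<xi> - E 0 y \<xi>)))
        \<le> Cd * N powr (2 * \<delta> / \<alpha> + (1 - \<kappa>)) * \<bar>x - y\<bar> powr (- \<kappa>)"
        using N by (intro diff(1)) auto
    next
      fix x
      have "continuous_on ?P (\<lambda>t. of_real (t powr (- \<delta>)) * (block g N t x - block g N 0 x))"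
        using P1 by (intro continuous_intros continuous_on_subset[OF continuous_on_block] g g1) (use N in auto)
      then show "continuous_on ?P (\<lambda>t. LINT \<xi>:annulus N|lborel. (of_real (t powr (- \<delta>)) * (E t x \<xi> - E 0 x \<xi>)) * g \<xi>)"
        unfolding eq .
    qed (use N Cd g in auto)
    then show "maximal_L2_le m ?P (\<lambda>t x. of_real (t powr (- \<delta>)) * (block g N t x - block g N 0 x))
      (riesz_const m \<kappa> * Cd * N powr (2 * \<delta> / \<alpha> + (1 - \<kappa>)) * energy N g)"
      unfolding eq by (simp only: mult.assoc)
  qed
qed

end

text \<open>The identity \<open>eq\<close> shows that the two exponents cross exactly at
  \<open>\<delta> = \<alpha> / 2\<close>, so \<open>s_crit\<close> is their maximum.\<close>

lemma s_crit_ge: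
  assumes "0 < \<alpha>" "\<alpha> \<le> 1 / 4" "0 \<le> \<delta>" "\<delta> < \<alpha>"
  shows "\<delta> / \<alpha> \<le> s_crit \<alpha> \<delta>" "1 / 2 - \<alpha> + 2 * \<delta> \<le> s_crit \<alpha> \<delta>"
proof -
  have eq: "1 / 2 - \<alpha> + 2 * \<delta> - \<delta> / \<alpha> = (1 / 2 - \<alpha>) * (1 - 2 * \<delta> / \<alpha>)"
    using assms by (simp add: field_simps)
  show "\<delta> / \<alpha> \<le> s_crit \<alpha> \<delta>"
  proof (cases "\<delta> < \<alpha> / 2")
    case True
    then have "0 \<le> (1 / 2 - \<alpha>) * (1 - 2 * \<delta> / \<alpha>)"
      using assms by (intro mult_nonneg_nonneg) (auto simp: field_simps)
    then show ?thesis using eq True by (simp add: s_crit_def)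
  qed (simp add: s_crit_def)
  show "1 / 2 - \<alpha> + 2 * \<delta> \<le> s_crit \<alpha> \<delta>"
  proof (cases "\<delta> < \<alpha> / 2")
    case False
    then have "(1 / 2 - \<alpha>) * (1 - 2 * \<delta> / \<alpha>) \<le> 0"
      using assms by (intro mult_nonneg_nonpos) (auto simp: field_simps)
    then show ?thesis using eq False by (simp add: s_crit_def)
  qed (simp add: s_crit_def)
qed

text \<open>With frequency \<open>2 powr k\<close> and time \<open>2 powr (- j)\<close>, the
  exponent at \<open>\<kappa> = 1\<close> is affine in \<open>j\<close>, so it is largest at
  \<open>j = k / \<alpha>\<close> or at \<open>j = 2 * k\<close>, according to the sign of
  \<open>2 * \<delta> - \<alpha>\<close>. A smaller \<open>\<kappa>\<close> costs
  \<open>\<alpha> * j * (1 - \<kappa>)\<close>, at most \<open>k * (1 - \<kappa>)\<close>.\<close>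

lemma dyadic_exponent_le:
  fixes j k \<kappa> :: real
  assumes \<alpha>: "0 < \<alpha>" "\<alpha> \<le> 1 / 4" "0 \<le> \<delta>" "\<delta> < \<alpha>" and \<kappa>: "\<kappa> \<le> 1"
    and jk: "0 \<le> k" "2 * k \<le> j" "\<alpha> * j \<le> k"
  shows "2 * \<delta> * j + k - \<alpha> * \<kappa> * j \<le> k * (2 * s_crit \<alpha> \<delta> + (1 - \<kappa>))"
proof -
  have "(\<alpha> * j) * (1 - \<kappa>) \<le> k * (1 - \<kappa>)" using jk \<kappa> by (intro mult_right_mono) auto
  moreover have "k + (2 * \<delta> - \<alpha>) * j \<le> k * (2 * s_crit \<alpha> \<delta>)"
  proof (cases "2 * \<delta> \<ge> \<alpha>")
    case True
    have "j \<le> k / \<alpha>" using jk \<alpha> by (simp add: field_simps)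
    then have "k + (2 * \<delta> - \<alpha>) * j \<le> k + (2 * \<delta> - \<alpha>) * (k / \<alpha>)"
      using True by (intro add_left_mono mult_left_mono) auto
    also have "\<dots> = k * (2 * (\<delta> / \<alpha>))" using \<alpha> by (simp add: field_simps)
    also have "\<dots> \<le> k * (2 * s_crit \<alpha> \<delta>)"
      using s_crit_ge(1)[OF \<alpha>] jk by (intro mult_left_mono) auto
    finally show ?thesis .
  next
    case False
    then have "k + (2 * \<delta> - \<alpha>) * j \<le> k + (2 * \<delta> - \<alpha>) * (2 * k)"
      using jk by (intro add_left_mono mult_left_mono_neg) auto
    also have "\<dots> = k * (2 * (1 / 2 - \<alpha> + 2 * \<delta>))" by (simp add: algebra_simps)
    also have "\<dots> \<le> k * (2 * s_crit \<alpha> \<delta>)"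
      using s_crit_ge(2)[OF \<alpha>] jk by (intro mult_left_mono) auto
    finally show ?thesis .
  qed
  ultimately show ?thesis by (simp add: algebra_simps)
qed

text \<open>Weighting the majorants by \<open>2 powr (\<theta> * k)\<close> keeps their sum
  integrable, hence finite almost everywhere; each term is below the sum, which gives the decay in
  \<open>k\<close>, uniformly in \<open>t\<close>.\<close>

lemma maximal_L2_le_imp_AE_geometric:
  fixes u :: "nat \<Rightarrow> real \<Rightarrow> real \<Rightarrow> complex"
  assumes u: "\<And>k. maximal_L2_le m P (u k) (Q k)" and Q: "\<And>k. 0 \<le> Q k"
    and sum: "summable (\<lambda>k. 2 powr (\<theta> * real k) * Q k)"
  shows "AE x in restrict_space lborel {- m..m}. \<exists>B. \<forall>k. \<forall>t\<in>P. cmod (u k t x) \<le> B * (2 powr (- \<theta> / 2)) ^ k"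
proof -
  let ?M = "restrict_space lborel {- m..m}"
  have "\<exists>S. \<forall>k. S k \<in> borel_measurable ?M \<and> (\<forall>x \<in> {- m..m}. \<forall>t \<in> P. ennreal ((cmod (u k t x))\<^sup>2) \<le> S k x) \<and>
    (\<integral>\<^sup>+x. S k x \<partial>?M) \<le> ennreal (Q k)"
    using u unfolding maximal_L2_le_def by (intro choice) blast
  then obtain S where S[measurable]: "\<And>k. S k \<in> borel_measurable ?M"
    and S_ge: "\<And>k x t. x \<in> {- m..m} \<Longrightarrow> t \<in> P \<Longrightarrow> ennreal ((cmod (u k t x))\<^sup>2) \<le> S k x"
    and S_int: "\<And>k. (\<integral>\<^sup>+x. S k x \<partial>?M) \<le> ennreal (Q k)"
    by blast
  define f where "f x = (\<Sum>k. ennreal (2 powr (\<theta> * real k)) * S k x)" for x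
  have f_meas[measurable]: "f \<in> borel_measurable ?M" unfolding f_def by measurable
  have "(\<integral>\<^sup>+x. f x \<partial>?M) = (\<Sum>k. \<integral>\<^sup>+x. ennreal (2 powr (\<theta> * real k)) * S k x \<partial>?M)"
    unfolding f_def by (rule nn_integral_suminf) measurable
  also have "\<dots> \<le> (\<Sum>k. ennreal (2 powr (\<theta> * real k) * Q k))"
  proof (rule suminf_le)
    fix k
    have "(\<integral>\<^sup>+x. ennreal (2 powr (\<theta> * real k)) * S k x \<partial>?M) = ennreal (2 powr (\<theta> * real k)) * (\<integral>\<^sup>+x. S k x \<partial>?M)"
      by (rule nn_integral_cmult) simp
    also have "\<dots> \<le> ennreal (2 powr (\<theta> * real k)) * ennreal (Q k)" by (intro mult_left_mono S_int) auto
    finally show "(\<integral>\<^sup>+x. ennreal (2 powr (\<theta> * real k)) * S k x \<partial>?M) \<le> ennreal (2 powr (\<theta> * real k) * Q k)"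
      by (simp add: ennreal_mult')
  qed auto
  also have "\<dots> < \<infinity>" using sum Q by (subst suminf_ennreal2) auto
  finally have "(\<integral>\<^sup>+x. f x \<partial>?M) \<noteq> \<infinity>" by simp
  then have "AE x in ?M. f x \<noteq> \<infinity>" by (intro nn_integral_PInf_AE) auto
  moreover have "AE x in ?M. x \<in> {- m..m}" by (rule AE_I2) (auto simp: space_restrict_space)
  ultimately show ?thesis
  proof eventually_elim
    fix x assume fx: "f x \<noteq> \<infinity>" and x: "x \<in> {- m..m}"
    then obtain r where r: "f x = ennreal r" "r \<ge> 0" by (cases "f x") auto
    show "\<exists>B. \<forall>k. \<forall>t\<in>P. cmod (u k t x) \<le> B * (2 powr (- \<theta> / 2)) ^ k"
    proof (intro exI[of _ "sqrt r"] allI ballI)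
      fix k t assume t: "t \<in> P"
      have "ennreal (2 powr (\<theta> * real k) * (cmod (u k t x))\<^sup>2) = ennreal (2 powr (\<theta> * real k)) * ennreal ((cmod (u k t x))\<^sup>2)"
        by (simp add: ennreal_mult')
      also have "\<dots> \<le> ennreal (2 powr (\<theta> * real k)) * S k x" by (intro mult_left_mono S_ge x t) auto
      also have "\<dots> = (\<Sum>i\<in>{k}. ennreal (2 powr (\<theta> * real i)) * S i x)" by simp
      also have "\<dots> \<le> f x" unfolding f_def by (rule sum_le_suminf) auto
      finally have "2 powr (\<theta> * real k) * (cmod (u k t x))\<^sup>2 \<le> r" using r by simp
      then have "(cmod (u k t x))\<^sup>2 \<le> r * 2 powr (- \<theta> * real k)"
        by (simp add: powr_minus_divide field_simps)
      then have "cmod (u k t x) \<le> sqrt (r * 2 powr (- \<theta> * real k))" by (rule real_le_rsqrt)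
      also have "\<dots> = sqrt r * sqrt (2 powr (- \<theta> * real k))" by (rule real_sqrt_mult)
      also have "sqrt (2 powr (- \<theta> * real k)) = (2 powr (- \<theta> / 2)) ^ k"
        by (simp add: powr_half_sqrt[symmetric] powr_powr powr_realpow[symmetric])
      finally show "cmod (u k t x) \<le> sqrt r * (2 powr (- \<theta> / 2)) ^ k" .
    qed
  qed
qed

lemma dyadic_interval_obtain:
  fixes t :: real
  assumes "0 < t" "t \<le> 1"
  obtains j :: nat where "2 powr (- real j - 1) \<le> t" "t \<le> 2 powr (- real j)" "- log 2 t - 1 < real j" "real j \<le> - log 2 t"
proof -
  have pos: "0 \<le> - log 2 t" using assms by (simp add: log_le_zero_cancel_iff)
  define j where "j = nat \<lfloor>- log 2 t\<rfloor>"
  have j: "real j \<le> - log 2 t" "- log 2 t < real j + 1" using pos by (auto simp: j_def)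
  have t: "t = 2 powr log 2 t" using assms by simp
  show ?thesis
  proof (rule that[of j])
    show "2 powr (- real j - 1) \<le> t" by (subst t, rule powr_mono) (use j in auto)
    show "t \<le> 2 powr (- real j)" by (subst t, rule powr_mono) (use j in auto)
  qed (use j in auto)
qed

context holder_curve
begin

text \<open>Only the shortest times use the cancellation in the difference. Later the two terms are
  bounded separately: the weight is then at most \<open>N powr (\<delta> / \<alpha>)\<close>, and
  the block at time 0 loses only \<open>N powr (1 - \<kappa>)\<close>. The factor
  \<open>real k + 1\<close> accounts for the number of dyadic time scales in between.\<close>

lemma maximal_block:
  fixes m \<kappa> \<delta> :: real
  assumes m: "m > 0" and \<kappa>: "1 / 2 \<le> \<kappa>" "\<kappa> < 1" and \<delta>: "0 \<le> \<delta>" "\<delta> < \<alpha>"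
  obtains C where "C > 0" and "\<And>g k. \<lbrakk>g \<in> borel_measurable borel;
      finite_energy (2 ^ k) g\<rbrakk> \<Longrightarrow>
    maximal_L2_le m {0<..1} (\<lambda>t x. of_real (t powr (- \<delta>)) * (block g (2 ^ k) t x - block g (2 ^ k) 0 x))
      (C * (real k + 1) * (2 ^ k) powr (2 * s_crit \<alpha> \<delta> + (1 - \<kappa>)) * energy (2 ^ k) g)"
proof -
  have \<kappa>0: "0 < \<kappa>" "0 \<le> \<kappa>" using \<kappa> by auto
  define \<sigma> where "\<sigma> = s_crit \<alpha> \<delta>"
  have \<sigma>: "\<delta> / \<alpha> \<le> \<sigma>" "1 / 2 - \<alpha> + 2 * \<delta> \<le> \<sigma>"
    unfolding \<sigma>_def using s_crit_ge[OF alpha \<delta>] by auto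
  obtain Cz where Cz: "Cz > 0" and zero: "\<And>g N. \<lbrakk>N \<ge> 1; g \<in> borel_measurable borel;
      finite_energy N g\<rbrakk> \<Longrightarrow>
    maximal_L2_le m UNIV (\<lambda>t. block g N 0) (Cz * N powr (1 - \<kappa>) * energy N g)"
    by (rule maximal_block_zero[OF m \<kappa>]) (rule that)
  obtain Cw where Cw: "Cw > 0" and weighted: "\<And>g N Q T P. \<lbrakk>N \<ge> 0; g \<in> borel_measurable borel;
      finite_energy N g; 0 < T; P \<subseteq> {T..1}; Q > 0;
      \<And>s t x y. s \<in> P \<Longrightarrow> t \<in> P \<Longrightarrow> x \<noteq> y \<Longrightarrow> x \<in> {- m..m} \<Longrightarrow> y \<in> {- m..m} \<Longrightarrow>
        cmod (kernel N s x t y) \<le> Q * \<bar>x - y\<bar> powr (- \<kappa>)\<rbrakk> \<Longrightarrow>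
    maximal_L2_le m P (\<lambda>t x. of_real (t powr (- \<delta>)) * block g N t x)
      (Cw * (T powr (- 2 * \<delta>) * Q) * energy N g)"
    by (rule maximal_block_weighted[OF m \<kappa>(2) \<delta>(1)]) (rule that; blast)
  obtain Ca where Ca: "Ca > 0" and small: "\<And>g N. \<lbrakk>N \<ge> 1; g \<in> borel_measurable borel;
      finite_energy N g\<rbrakk> \<Longrightarrow>
    maximal_L2_le m {0<..N powr (- 1 / \<alpha>)} (\<lambda>t x. of_real (t powr (- \<delta>)) * (block g N t x - block g N 0 x))
      (Ca * N powr (2 * \<delta> / \<alpha> + (1 - \<kappa>)) * energy N g)"
    by (rule maximal_block_small_time[OF m \<kappa>0(2) \<kappa>(2) \<delta>]) (rule that)
  \<comment> \<open>\<open>max 1 (2 * m)\<close> dominates all distances in \<open>{- m..m}\<close>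
    and meets the normalization \<open>Z \<ge> 1\<close>.\<close>
  obtain Cl where Cl: "Cl > 0" and long: "\<And>N s t x y. \<lbrakk>N \<ge> 1; s \<in> {-1..1}; t \<in> {-1..1}; x \<noteq> y; \<bar>x - y\<bar> \<le> max 1 (2 * m)\<rbrakk> \<Longrightarrow>
    cmod (kernel N s x t y) \<le> Cl * N powr (1 - 2 * \<alpha> * \<kappa>) * \<bar>x - y\<bar> powr (- \<kappa>)"
    by (rule kernel_long_time[OF \<kappa>, of "max 1 (2 * m)"]) (simp, rule that)
  obtain Cs where Cs: "Cs > 0" and short: "\<And>N T s t x y. \<lbrakk>N \<ge> 1; T * N\<^sup>2 \<le> 1; 0 < T; s \<in> {-1..1}; t \<in> {-1..1}; \<bar>s - t\<bar> \<le> T; x \<noteq> y\<rbrakk> \<Longrightarrow>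
    cmod (kernel N s x t y)
      \<le> Cs * (N powr (1 - \<kappa>) + N * T powr (\<alpha> * \<kappa>)) * \<bar>x - y\<bar> powr (- \<kappa>)"
    by (rule kernel_short_time[OF \<kappa>0(1) \<kappa>(2)]) (rule that)
  define ia where "ia = 1 / \<alpha> + 1"
  have ia: "ia > 0" using alpha by (simp add: ia_def add_pos_pos)
  define C where "C = Ca + 2 * (Cw * Cl) + 8 * (Cw * Cs) * ia + 2 * Cz"
  have C: "C > 0" using Ca Cw Cl Cs Cz ia by (auto simp: C_def intro!: add_pos_pos mult_pos_pos)
  show ?thesis
  proof (rule that[OF C])
    fix g :: "real \<Rightarrow> complex" and k :: nat
    assume g: "g \<in> borel_measurable borel" "finite_energy (2 ^ k) g"
    define N :: real where "N = 2 ^ k"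
    have N: "N \<ge> 1" by (simp add: N_def)
    have N2: "N = 2 powr real k" by (simp add: N_def powr_realpow)
    note gN = g(2)[folded N_def]
    define G where "G = energy N g"
    have G: "G \<ge> 0" unfolding G_def set_lebesgue_integral_def by simp
    define X where "X = N powr (2 * \<sigma> + (1 - \<kappa>))"
    have X: "X > 0" using N by (simp add: X_def)
    have X1: "N powr (2 * \<delta> / \<alpha> + (1 - \<kappa>)) \<le> X"
      unfolding X_def using N \<sigma>(1) by (intro powr_mono; linarith)
    define w where "w t x = of_real (t powr (- \<delta>)) * (block g N t x - block g N 0 x)" for t x
    define v where "v t x = of_real (t powr (- \<delta>)) * block g N t x" for t x
    define Pc where "Pc = {N powr (- 2)..1}"
    define P where "P j = {2 powr (- real j - 1)..2 powr (- real j)}" for j :: nat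
    define J where "J = {j :: nat. 2 * k \<le> j \<and> \<alpha> * real j \<le> real k}"
    have J_sub: "J \<subseteq> {..nat \<lfloor>real k / \<alpha>\<rfloor>}"
    proof
      fix j assume "j \<in> J"
      then have "real j \<le> real k / \<alpha>" using alpha by (simp add: J_def field_simps)
      then show "j \<in> {..nat \<lfloor>real k / \<alpha>\<rfloor>}" by (simp add: le_nat_floor)
    qed
    then have J_fin: "finite J" using finite_subset by blast
    have "card J \<le> nat \<lfloor>real k / \<alpha>\<rfloor> + 1" using card_mono[OF _ J_sub] by simp
    also have "real (nat \<lfloor>real k / \<alpha>\<rfloor> + 1) \<le> real k / \<alpha> + 1" using alpha by simp
    finally have J_card: "real (card J) \<le> real k / \<alpha> + 1" by simp
    \<comment> \<open>The times up to \<open>N powr (- 1 / \<alpha>)\<close>, those from \<open>N powr (- 2)\<close> on, and the dyadic intervals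
      \<open>P j\<close> between them call for different kernel estimates.\<close>
    have A: "maximal_L2_le m {0<..N powr (- 1 / \<alpha>)} w (Ca * X * G)"
      by (rule maximal_L2_le_mono[OF small[OF N g(1) gN]])
         (use X1 Ca G in \<open>auto simp: w_def G_def intro!: mult_right_mono\<close>)
    have Bc: "maximal_L2_le m Pc v (Cw * Cl * X * G)"
    proof -
      have "maximal_L2_le m Pc v (Cw * ((N powr (- 2)) powr (- 2 * \<delta>) * (Cl * N powr (1 - 2 * \<alpha> * \<kappa>))) * G)"
        unfolding v_def G_def
      proof (rule weighted)
        fix s t x y assume "s \<in> Pc" "t \<in> Pc" "x \<noteq> y" "x \<in> {- m..m}" "y \<in> {- m..m}"
        moreover have le: "- 1 \<le> N powr (- 2)" by (rule order_trans[of _ 0]) auto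
        ultimately show "cmod (kernel N s x t y) \<le> Cl * N powr (1 - 2 * \<alpha> * \<kappa>) * \<bar>x - y\<bar> powr (- \<kappa>)"
          using N by (intro long) (auto simp: Pc_def intro: order_trans[OF le])
      qed (use N g gN Cl in \<open>auto simp: Pc_def\<close>)
      moreover have eq: "(N powr (- 2)) powr (- 2 * \<delta>) * (Cl * N powr (1 - 2 * \<alpha> * \<kappa>)) = Cl * N powr (4 * \<delta> + (1 - 2 * \<alpha> * \<kappa>))"
        by (simp only: powr_powr powr_add) simp
      moreover have le: "N powr (4 * \<delta> + (1 - 2 * \<alpha> * \<kappa>)) \<le> X"
      proof -
        have "2 * \<alpha> * (1 - \<kappa>) \<le> 1 * (1 - \<kappa>)" using alpha \<kappa> by (intro mult_right_mono) auto
        then show ?thesis unfolding X_def using N \<sigma>(2) by (intro powr_mono) (auto simp: algebra_simps)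
      qed
      moreover have "Cw * (Cl * N powr (4 * \<delta> + (1 - 2 * \<alpha> * \<kappa>))) * G \<le> Cw * (Cl * X) * G"
        using Cw Cl G by (intro mult_left_mono mult_right_mono le) auto
      ultimately show ?thesis
        unfolding eq by (elim maximal_L2_le_mono) (auto simp: mult.assoc)
    qed
    have Bj: "maximal_L2_le m (P j) v (4 * (Cw * Cs) * X * G)" if j: "j \<in> J" for j
    proof -
      define T where "T = 2 powr (- real j)"
      have jk: "0 \<le> real k" "2 * real k \<le> real j" "\<alpha> * real j \<le> real k" using j by (auto simp: J_def)
      have T: "0 < T" by (simp add: T_def)
      have T1: "T \<le> 1" unfolding T_def using powr_mono[of "- real j" 0 2] by simp
      have TN: "T * N\<^sup>2 \<le> 1"
      proof -
        have "T * N\<^sup>2 = 2 powr (2 * real k - real j)"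
          unfolding T_def N2 by (simp add: power2_eq_square powr_add[symmetric])
        also have "\<dots> \<le> 2 powr 0" using jk by (intro powr_mono) auto
        finally show ?thesis by simp
      qed
      have "maximal_L2_le m (P j) v (Cw * ((2 powr (- real j - 1)) powr (- 2 * \<delta>) * (Cs * (N powr (1 - \<kappa>) + N * T powr (\<alpha> * \<kappa>)))) * G)"
        unfolding v_def G_def
      proof (rule weighted)
        show "P j \<subseteq> {2 powr (- real j - 1)..1}" using T1 by (auto simp: P_def T_def)
        fix s t x y :: real assume st: "s \<in> P j" "t \<in> P j" and xy: "x \<noteq> y"
        have pos: "0 < (2::real) powr (- real j - 1)" by simp
        then have "0 < s" "0 < t" "s \<le> T" "t \<le> T" using st unfolding P_def T_def by (auto intro: less_le_trans[OF pos])
        then show "cmod (kernel N s x t y)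
            \<le> Cs * (N powr (1 - \<kappa>) + N * T powr (\<alpha> * \<kappa>)) * \<bar>x - y\<bar> powr (- \<kappa>)"
          using N T T1 TN xy by (intro short) auto
      qed (use N g gN Cs T in \<open>auto intro!: mult_pos_pos add_pos_nonneg\<close>)
      \<comment> \<open>The first summand of the kernel constant is worst at the shortest times,
        \<open>j = k / \<alpha>\<close>; the second is the exponent bounded in
        \<open>dyadic_exponent_le\<close>.\<close>
      moreover have "(2 powr (- real j - 1)) powr (- 2 * \<delta>) * (N powr (1 - \<kappa>) + N * T powr (\<alpha> * \<kappa>)) \<le> 4 * X"
      proof -
        have "(2 powr (- real j - 1)) powr (- 2 * \<delta>) = 2 powr (2 * \<delta>) * 2 powr (2 * \<delta> * real j)"
          by (simp add: powr_powr powr_add[symmetric] algebra_simps)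
        also have "\<dots> \<le> 2 * 2 powr (2 * \<delta> * real j)"
          using \<delta> alpha powr_mono[of "2 * \<delta>" 1 2] by (intro mult_right_mono) auto
        finally have 1: "(2 powr (- real j - 1)) powr (- 2 * \<delta>) \<le> 2 * 2 powr (2 * \<delta> * real j)" .
        have 2: "2 powr (2 * \<delta> * real j) * N powr (1 - \<kappa>) \<le> X"
        proof -
          have "real j \<le> real k / \<alpha>" using jk alpha by (simp add: field_simps)
          then have "2 * \<delta> * real j \<le> 2 * \<delta> * (real k / \<alpha>)" using \<delta> by (intro mult_left_mono) auto
          then have "2 powr (2 * \<delta> * real j) \<le> 2 powr (2 * \<delta> * (real k / \<alpha>))" by (intro powr_mono) auto
          also have "\<dots> = N powr (2 * \<delta> / \<alpha>)" unfolding N2 powr_powr by (simp add: mult_ac)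
          finally have "2 powr (2 * \<delta> * real j) * N powr (1 - \<kappa>) \<le> N powr (2 * \<delta> / \<alpha>) * N powr (1 - \<kappa>)"
            by (intro mult_right_mono) auto
          then show ?thesis using X1 by (simp add: powr_add)
        qed
        have 3: "2 powr (2 * \<delta> * real j) * (N * T powr (\<alpha> * \<kappa>)) \<le> X"
        proof -
          have "2 powr (2 * \<delta> * real j) * (N * T powr (\<alpha> * \<kappa>)) = 2 powr (2 * \<delta> * real j + real k - \<alpha> * \<kappa> * real j)"
            unfolding N2 T_def powr_powr by (simp add: powr_add[symmetric] algebra_simps)
          also have "\<dots> \<le> 2 powr (real k * (2 * \<sigma> + (1 - \<kappa>)))"
            unfolding \<sigma>_def using \<kappa> by (intro powr_mono dyadic_exponent_le alpha \<delta> jk) auto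
          also have "\<dots> = X" unfolding X_def N2 powr_powr ..
          finally show ?thesis .
        qed
        have "(2 powr (- real j - 1)) powr (- 2 * \<delta>) * (N powr (1 - \<kappa>) + N * T powr (\<alpha> * \<kappa>))
          \<le> 2 * 2 powr (2 * \<delta> * real j) * (N powr (1 - \<kappa>) + N * T powr (\<alpha> * \<kappa>))"
          using N by (intro mult_right_mono 1) auto
        also have "\<dots> \<le> 4 * X" using 2 3 by (simp add: algebra_simps)
        finally show ?thesis .
      qed
      then have "Cw * Cs * ((2 powr (- real j - 1)) powr (- 2 * \<delta>) * (N powr (1 - \<kappa>) + N * T powr (\<alpha> * \<kappa>))) * G
          \<le> Cw * Cs * (4 * X) * G"
        using Cw Cs G by (intro mult_right_mono mult_left_mono) auto
      moreover have "Cw * Cs * (4 * X) * G = 4 * (Cw * Cs) * X * G" by simp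
      ultimately show ?thesis
        by (elim maximal_L2_le_mono) (auto simp only: mult.assoc mult.left_commute)
    qed
    define Q where "Q = Cw * Cl * X * G + real (card J) * (4 * (Cw * Cs) * X * G)"
    have Q0: "0 \<le> Q" using Cw Cl Cs X G by (auto simp: Q_def)
    have BU: "maximal_L2_le m (Pc \<union> (\<Union>j\<in>J. P j)) v Q"
    proof -
      have "maximal_L2_le m (\<Union>j\<in>J. P j) v (\<Sum>j\<in>J. 4 * (Cw * Cs) * X * G)"
        using Cw Cs X G by (intro maximal_L2_le_UN J_fin Bj) auto
      then show ?thesis unfolding Q_def using Cw Cl Cs X G by (intro maximal_L2_le_Un Bc) auto
    qed
    define c where "c = N powr (\<delta> / \<alpha>)"
    \<comment> \<open>A dyadic interval may reach below \<open>N powr (- 1 / \<alpha>)\<close>;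
      cutting it there keeps the weight at most \<open>c\<close>.\<close>
    define P' where "P' = (Pc \<union> (\<Union>j\<in>J. P j)) \<inter> {N powr (- 1 / \<alpha>)..}"
    have D: "maximal_L2_le m P' w (2 * Q + 2 * c\<^sup>2 * (Cz * N powr (1 - \<kappa>) * G))"
    proof (rule maximal_L2_le_add)
      show "maximal_L2_le m P' v Q" by (rule maximal_L2_le_mono[OF BU]) (auto simp: P'_def)
      show "maximal_L2_le m P' (\<lambda>t. block g N 0) (Cz * N powr (1 - \<kappa>) * G)"
        by (rule maximal_L2_le_mono[OF zero[OF N g(1) gN]]) (auto simp: G_def)
      fix t x assume t: "t \<in> P'"
      have "t powr (- \<delta>) \<le> (N powr (- 1 / \<alpha>)) powr (- \<delta>)"
        using t N \<delta> by (intro powr_mono2') (auto simp: P'_def)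
      also have "\<dots> = c" by (simp add: c_def powr_powr)
      finally have tc: "t powr (- \<delta>) \<le> c" .
      have "cmod (w t x) \<le> cmod (v t x) + cmod (of_real (t powr (- \<delta>)) * block g N 0 x)"
        unfolding w_def v_def right_diff_distrib by (rule norm_triangle_ineq4)
      also have "\<dots> \<le> cmod (v t x) + c * cmod (block g N 0 x)"
        using tc by (auto simp: norm_mult intro!: mult_right_mono)
      finally show "cmod (w t x) \<le> cmod (v t x) + c * cmod (block g N 0 x)" .
    qed (use Q0 Cz G in \<open>auto simp: c_def\<close>)
    have cover: "{0<..1} \<subseteq> {0<..N powr (- 1 / \<alpha>)} \<union> P'"
    proof
      fix t :: real assume t: "t \<in> {0<..1}"
      show "t \<in> {0<..N powr (- 1 / \<alpha>)} \<union> P'"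
      proof (cases "t \<le> N powr (- 1 / \<alpha>) \<or> N powr (- 2) \<le> t")
        case True
        then show ?thesis using t by (auto simp: P'_def Pc_def)
      next
        case False
        obtain j :: nat where j: "2 powr (- real j - 1) \<le> t" "t \<le> 2 powr (- real j)" "- log 2 t - 1 < real j" "real j \<le> - log 2 t"
          using dyadic_interval_obtain[of t] t by auto
        have "log 2 t < log 2 (N powr (- 2))" using False t N by (subst log_less_cancel_iff) auto
        also have "\<dots> = - 2 * real k" using N by (simp add: N2 log_powr powr_powr)
        finally have "2 * real k < real j + 1" using j by linarith
        \<comment> \<open>The logarithm only gives \<open>2 * k < j + 1\<close>; integrality closes
          the gap to membership in \<open>J\<close>.\<close>
        then have 1: "2 * k \<le> j" by linarith
        have "log 2 (N powr (- 1 / \<alpha>)) \<le> log 2 t" using False t N by (subst log_le_cancel_iff) auto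
        also have "log 2 (N powr (- 1 / \<alpha>)) = - real k / \<alpha>" using N by (simp add: N2 powr_powr)
        finally have "real j \<le> real k / \<alpha>" using j by linarith
        then have "\<alpha> * real j \<le> real k" using alpha by (simp add: field_simps)
        then have "j \<in> J" using 1 by (simp add: J_def)
        then show ?thesis using False j by (auto simp: P'_def P_def)
      qed
    qed
    have "maximal_L2_le m ({0<..N powr (- 1 / \<alpha>)} \<union> P') w (Ca * X * G + (2 * Q + 2 * c\<^sup>2 * (Cz * N powr (1 - \<kappa>) * G)))"
      using Ca X G Q0 Cz by (intro maximal_L2_le_Un A D) auto
    then have "maximal_L2_le m {0<..1} w (C * (real k + 1) * X * G)"
    proof (rule maximal_L2_le_mono[OF _ cover])
      have "c\<^sup>2 * N powr (1 - \<kappa>) = N powr (2 * \<delta> / \<alpha> + (1 - \<kappa>))"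
        by (simp add: c_def power2_eq_square powr_add[symmetric])
      then have "2 * c\<^sup>2 * (Cz * N powr (1 - \<kappa>) * G) = 2 * Cz * (N powr (2 * \<delta> / \<alpha> + (1 - \<kappa>))) * G"
        by simp
      also have "\<dots> \<le> 2 * Cz * X * G" using X1 Cz G by (intro mult_left_mono mult_right_mono) auto
      also have "\<dots> = 2 * Cz * (X * G)" by simp
      finally have 1: "2 * c\<^sup>2 * (Cz * N powr (1 - \<kappa>) * G) \<le> 2 * Cz * (X * G)" .
      have kk: "real k / \<alpha> + 1 \<le> ia * (real k + 1)" using alpha by (simp add: ia_def algebra_simps)
      have "Q \<le> Cw * Cl * X * G + (ia * (real k + 1)) * (4 * (Cw * Cs) * X * G)"
        unfolding Q_def using J_card kk Cw Cs X G by (intro add_left_mono mult_right_mono) auto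
      also have "\<dots> = (Cw * Cl + 4 * (Cw * Cs) * ia * (real k + 1)) * (X * G)"
        by (simp add: algebra_simps)
      finally have "Ca * X * G + (2 * Q + 2 * c\<^sup>2 * (Cz * N powr (1 - \<kappa>) * G))
        \<le> (Ca + 2 * (Cw * Cl) + 8 * (Cw * Cs) * ia * (real k + 1) + 2 * Cz) * (X * G)"
        using 1 by (simp add: algebra_simps)
      also have "\<dots> \<le> (C * (real k + 1)) * (X * G)"
      proof (rule mult_right_mono)
        have "0 \<le> (Ca + 2 * (Cw * Cl) + 2 * Cz) * real k" using Ca Cw Cl Cz by simp
        then show "Ca + 2 * (Cw * Cl) + 8 * (Cw * Cs) * ia * (real k + 1) + 2 * Cz \<le> C * (real k + 1)"
          by (simp add: C_def algebra_simps)
      qed (use X G in auto)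
      finally show "Ca * X * G + (2 * Q + 2 * c\<^sup>2 * (Cz * N powr (1 - \<kappa>) * G)) \<le> C * (real k + 1) * X * G"
        by (simp add: mult.assoc)
    qed auto
    then show "maximal_L2_le m {0<..1} (\<lambda>t x. of_real (t powr (- \<delta>)) * (block g (2 ^ k) t x - block g (2 ^ k) 0 x))
      (C * (real k + 1) * (2 ^ k) powr (2 * s_crit \<alpha> \<delta> + (1 - \<kappa>)) * energy (2 ^ k) g)"
      unfolding w_def X_def G_def N_def \<sigma>_def .
  qed
qed

end

section \<open>Almost everywhere convergence\<close>

lemma U_partial_eq:
  "U_partial \<gamma> f x t k =
     1 / (2 * of_real pi) * (LINT \<xi>:{\<xi>. \<bar>\<xi>\<bar> \<le> 2 ^ k}|lborel. cis (\<gamma> (x, t) * \<xi> + t * \<xi>\<^sup>2) * fhat f \<xi>)"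
  by (simp add: U_partial_def U_integrand_def cis_conv_exp)

text \<open>By dominated convergence the integrable branch of \<open>U\<close> is also the limit of
  the dyadic truncations, so both branches can be handled through limits.\<close>

lemma U_partial_tendsto_U:
  assumes "U_defined \<gamma> f x t"
  shows "U_partial \<gamma> f x t \<longlonglongrightarrow> U \<gamma> f x t"
proof (cases "integrable lborel (fhat f)")
  case True
  then have [measurable]: "fhat f \<in> borel_measurable borel" by auto
  have [measurable]: "U_integrand \<gamma> f x t \<in> borel_measurable borel"
    unfolding U_integrand_def by measurable
  have norm: "cmod (U_integrand \<gamma> f x t \<xi>) = cmod (fhat f \<xi>)" for \<xi>
    by (simp add: U_integrand_def norm_mult)
  have "(\<lambda>k. LINT \<xi>:{\<xi>. \<bar>\<xi>\<bar> \<le> 2 ^ k}|lborel. U_integrand \<gamma> f x t \<xi>) \<longlonglongrightarrow> (LINT \<xi>|lborel. U_integrand \<gamma> f x t \<xi>)"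
    unfolding set_lebesgue_integral_def
  proof (rule integral_dominated_convergence)
    show "integrable lborel (\<lambda>\<xi>. cmod (fhat f \<xi>))" using True by auto
    show "AE \<xi> in lborel. (\<lambda>k. indicator {\<xi>. \<bar>\<xi>\<bar> \<le> 2 ^ k} \<xi> *\<^sub>R U_integrand \<gamma> f x t \<xi>) \<longlonglongrightarrow> U_integrand \<gamma> f x t \<xi>"
    proof (rule AE_I2, rule tendsto_eventually)
      fix \<xi> :: real
      obtain n where n: "\<bar>\<xi>\<bar> < 2 ^ n" using real_arch_pow[of 2 "\<bar>\<xi>\<bar>"] by auto
      have "\<bar>\<xi>\<bar> \<le> 2 ^ k" if "k \<ge> n" for k
        using n power_increasing[OF that, of "2::real"] by linarith
      then show "\<forall>\<^sub>F k in sequentially. indicator {\<xi>. \<bar>\<xi>\<bar> \<le> 2 ^ k} \<xi> *\<^sub>R U_integrand \<gamma> f x t \<xi> = U_integrand \<gamma> f x t \<xi>"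
        unfolding eventually_sequentially by (intro exI[of _ n]) (auto simp: indicator_def)
    qed
    show "AE \<xi> in lborel. norm (indicator {\<xi>. \<bar>\<xi>\<bar> \<le> 2 ^ k} \<xi> *\<^sub>R U_integrand \<gamma> f x t \<xi>) \<le> cmod (fhat f \<xi>)" for k
      by (auto simp: indicator_def norm)
  qed measurable
  then show ?thesis using True unfolding U_partial_def U_def by (auto intro!: tendsto_intros)
next
  case False
  then show ?thesis using assms by (auto simp: U_defined_def U_def convergent_LIMSEQ_iff)
qed

lemma U_eq_of_LIMSEQ:
  assumes "U_partial \<gamma> f x t \<longlonglongrightarrow> L"
  shows "U_defined \<gamma> f x t" "U \<gamma> f x t = L"
proof -
  show "U_defined \<gamma> f x t" using assms by (auto simp: U_defined_def convergent_def)
  then show "U \<gamma> f x t = L" using U_partial_tendsto_U LIMSEQ_unique assms by blast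
qed

lemma summable_Suc_mult_power:
  fixes r :: real
  assumes "0 \<le> r" "r < 1"
  shows "summable (\<lambda>k. (real k + 1) * r ^ k)"
  using geometric_deriv_sums[of r] assms by (auto simp: sums_iff add.commute)

context holder_curve
begin

lemma set_integral_dyadic:
  assumes g: "g \<in> borel_measurable borel" and low: "set_integrable lborel {\<xi>. \<bar>\<xi>\<bar> \<le> 1} g"
    and ann: "\<And>k::nat. set_integrable lborel (annulus (2 ^ k)) g"
  shows "set_integrable lborel {\<xi>. \<bar>\<xi>\<bar> \<le> 2 ^ k} g \<and>
    (LINT \<xi>:{\<xi>. \<bar>\<xi>\<bar> \<le> 2 ^ k}|lborel. E t x \<xi> * g \<xi>)
      = (LINT \<xi>:{\<xi>. \<bar>\<xi>\<bar> \<le> 1}|lborel. E t x \<xi> * g \<xi>) + (\<Sum>i<k. block g (2 ^ i) t x)"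
proof (induction k)
  case 0
  then show ?case using low by simp
next
  case (Suc k)
  have eq: "{\<xi>::real. \<bar>\<xi>\<bar> \<le> 2 ^ Suc k} = {\<xi>. \<bar>\<xi>\<bar> \<le> 2 ^ k} \<union> annulus (2 ^ k)"
    by (auto simp: annulus_def)
  have dj: "{\<xi>::real. \<bar>\<xi>\<bar> \<le> 2 ^ k} \<inter> annulus (2 ^ k) = {}" by (auto simp: annulus_def)
  have [measurable]: "{\<xi>::real. \<bar>\<xi>\<bar> \<le> 2 ^ k} \<in> sets borel" by measurable
  have si: "set_integrable lborel {\<xi>. \<bar>\<xi>\<bar> \<le> 2 ^ k} g" using Suc by simp
  have "set_integrable lborel {\<xi>. \<bar>\<xi>\<bar> \<le> 2 ^ Suc k} g"
    unfolding eq by (intro set_integrable_Un si ann) auto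
  moreover have "(LINT \<xi>:{\<xi>. \<bar>\<xi>\<bar> \<le> 2 ^ Suc k}|lborel. E t x \<xi> * g \<xi>)
      = (LINT \<xi>:{\<xi>. \<bar>\<xi>\<bar> \<le> 2 ^ k}|lborel. E t x \<xi> * g \<xi>) + block g (2 ^ k) t x"
    unfolding eq block_def
    by (rule set_integral_Un[OF dj]) (intro set_integrable_E_mult g si ann; simp)+
  ultimately show ?case using Suc by simp
qed

text \<open>At bounded frequency the difference is of order \<open>t powr \<alpha> + t\<close>,
  which is negligible against \<open>t powr \<delta>\<close>.\<close>

lemma tendsto_weighted_difference_0:
  assumes A: "A \<in> sets borel" "\<And>\<xi>. \<xi> \<in> A \<Longrightarrow> \<bar>\<xi>\<bar> \<le> R" "R \<ge> 0"
    and g: "g \<in> borel_measurable borel" "set_integrable lborel A g"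
    and \<delta>: "0 \<le> \<delta>" "\<delta> < \<alpha>"
  shows "((\<lambda>t. of_real (t powr (- \<delta>)) * ((LINT \<xi>:A|lborel. E t x \<xi> * g \<xi>) - (LINT \<xi>:A|lborel. E 0 x \<xi> * g \<xi>)))
    \<longlongrightarrow> 0) (at_right 0)"
proof (rule Lim_null_comparison)
  define G where "G = (LINT \<xi>:A|lborel. cmod (g \<xi>))"
  have "\<forall>\<^sub>F t in at_right 0. t \<in> {0<..<1::real}" by (rule eventually_at_right_real) simp
  then show "\<forall>\<^sub>F t in at_right 0. norm (of_real (t powr (- \<delta>)) * ((LINT \<xi>:A|lborel. E t x \<xi> * g \<xi>) - (LINT \<xi>:A|lborel. E 0 x \<xi> * g \<xi>)))
      \<le> (C3 * R * t powr (\<alpha> - \<delta>) + R\<^sup>2 * t powr (1 - \<delta>)) * G"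
  proof eventually_elim
    fix t :: real assume t: "t \<in> {0<..<1}"
    have "norm (of_real (t powr (- \<delta>)) * ((LINT \<xi>:A|lborel. E t x \<xi> * g \<xi>) - (LINT \<xi>:A|lborel. E 0 x \<xi> * g \<xi>)))
      \<le> t powr (- \<delta>) * ((C3 * R * \<bar>t - 0\<bar> powr \<alpha> + R\<^sup>2 * \<bar>t - 0\<bar>) * G)"
      unfolding norm_mult norm_of_real G_def
      using norm_integral_E_diff_le[OF A(1,2) g, of t 0 x] t A(3) by (auto intro!: mult_mono)
    also have "\<dots> = (C3 * R * t powr (\<alpha> - \<delta>) + R\<^sup>2 * t powr (1 - \<delta>)) * G"
      using t by (simp add: powr_diff powr_minus_divide field_simps)
    finally show "norm (of_real (t powr (- \<delta>)) * ((LINT \<xi>:A|lborel. E t x \<xi> * g \<xi>) - (LINT \<xi>:A|lborel. E 0 x \<xi> * g \<xi>)))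
      \<le> (C3 * R * t powr (\<alpha> - \<delta>) + R\<^sup>2 * t powr (1 - \<delta>)) * G" .
  qed
  have "((\<lambda>t::real. t powr p) \<longlongrightarrow> 0) (at_right 0)" if "p > 0" for p
  proof -
    have "((\<lambda>t::real. t powr p) \<longlongrightarrow> 0 powr p) (at_right 0)"
      by (rule tendsto_powr') (use that in \<open>auto intro!: tendsto_ident_at simp: eventually_at_filter\<close>)
    then show ?thesis using that by simp
  qed
  then have p: "((\<lambda>t::real. t powr (\<alpha> - \<delta>)) \<longlongrightarrow> 0) (at_right 0)" "((\<lambda>t::real. t powr (1 - \<delta>)) \<longlongrightarrow> 0) (at_right 0)"
    using \<delta> alpha by auto
  have "((\<lambda>t. (C3 * R * t powr (\<alpha> - \<delta>) + R\<^sup>2 * t powr (1 - \<delta>)) * G) \<longlongrightarrow> (C3 * R * 0 + R\<^sup>2 * 0) * G) (at_right 0)"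
    by (intro tendsto_mult tendsto_add tendsto_const p)
  then show "((\<lambda>t. (C3 * R * t powr (\<alpha> - \<delta>) + R\<^sup>2 * t powr (1 - \<delta>)) * G) \<longlongrightarrow> 0) (at_right 0)" by simp
qed

text \<open>Tannery's theorem: each block tends to 0, and the geometric bound dominates uniformly in
  \<open>t\<close>. The same bounds make the dyadic truncations converge, so definedness of
  \<open>U\<close> comes along.\<close>

lemma converges_with_rate_of_geometric:
  assumes g: "fhat f \<in> borel_measurable borel" and low: "set_integrable lborel {\<xi>. \<bar>\<xi>\<bar> \<le> 1} (fhat f)"
    and ann: "\<And>k::nat. set_integrable lborel (annulus (2 ^ k)) (fhat f)"
    and \<delta>: "0 \<le> \<delta>" "\<delta> < \<alpha>" and r: "0 \<le> r" "r < 1"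
    and zero: "\<And>k. cmod (block (fhat f) (2 ^ k) 0 x) \<le> B * r ^ k"
    and diff: "\<And>k t. t \<in> {0<..1} \<Longrightarrow>
      cmod (of_real (t powr (- \<delta>)) * (block (fhat f) (2 ^ k) t x - block (fhat f) (2 ^ k) 0 x)) \<le> B' * r ^ k"
  shows "converges_with_rate \<gamma> \<delta> f x"
proof -
  define b where "b k t = block (fhat f) (2 ^ k) t x" for k t
  define d where "d k t = of_real (t powr (- \<delta>)) * (b k t - b k 0)" for k t
  define l where "l t = (LINT \<xi>:{\<xi>. \<bar>\<xi>\<bar> \<le> 1}|lborel. E t x \<xi> * fhat f \<xi>)" for t
  define p where "p = 1 / (2 * complex_of_real pi)"
  have geo: "summable (\<lambda>k. c * r ^ k)" for c using r by (intro summable_mult summable_geometric) auto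
  have partial: "U_partial \<gamma> f x t k = p * (l t + (\<Sum>i<k. b i t))" for t k
    using set_integral_dyadic[OF g low ann, of k t x]
    unfolding U_partial_eq E_def[symmetric] b_def l_def p_def by simp
  have sum0: "summable (\<lambda>k. b k 0)"
    by (rule summable_comparison_test'[OF geo]) (use zero in \<open>auto simp: b_def\<close>)
  have sumd: "summable (\<lambda>k. d k t)" if "t \<in> {0<..1}" for t
    by (rule summable_comparison_test'[OF geo]) (use diff[OF that] in \<open>auto simp: b_def d_def\<close>)
  \<comment> \<open>Recovers the block at time \<open>t\<close> from the one at time 0, so that
    convergence of the series at positive times needs no separate estimate.\<close>
  have bd: "b k t = b k 0 + of_real (t powr \<delta>) * d k t" if "t \<in> {0<..1}" for k t
    using that by (simp add: d_def powr_minus_divide)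
  have sumt: "summable (\<lambda>k. b k t)" if "t \<in> {0<..1}" for t
    unfolding bd[OF that] by (intro summable_add sum0 summable_mult sumd that)
  have lim: "U_partial \<gamma> f x t \<longlonglongrightarrow> p * (l t + (\<Sum>k. b k t))" if "summable (\<lambda>k. b k t)" for t
    unfolding partial by (intro tendsto_intros summable_LIMSEQ that)
  note U0 = U_eq_of_LIMSEQ[OF lim[OF sum0]]
  note Ut = U_eq_of_LIMSEQ[OF lim[OF sumt]]
  have ev: "\<forall>\<^sub>F t in at_right 0. t \<in> {0<..<1::real}" by (rule eventually_at_right_real) simp
  have limd: "((\<lambda>t. d k t) \<longlongrightarrow> 0) (at_right 0)" for k
    unfolding d_def b_def block_def
    by (rule tendsto_weighted_difference_0[where R="2 * 2 ^ k"]) (use g ann \<delta> in \<open>auto simp: annulus_def\<close>)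
  have "((\<lambda>t. \<Sum>k. d k t) \<longlongrightarrow> (\<Sum>k. 0)) (at_right 0)"
  proof -
    have "\<forall>\<^sub>F (k, t) in at_top \<times>\<^sub>F at_right 0. norm (d k t) \<le> B' * r ^ k"
      unfolding eventually_prod_filter
      by (rule exI[of _ "\<lambda>_. True"], rule exI[of _ "\<lambda>t. t \<in> {0<..<1}"])
         (use ev diff in \<open>auto simp: d_def b_def\<close>)
    from tannerys_theorem[OF limd this geo] show ?thesis by auto
  qed
  moreover have "((\<lambda>t. of_real (t powr (- \<delta>)) * (l t - l 0)) \<longlongrightarrow> 0) (at_right 0)"
    unfolding l_def by (rule tendsto_weighted_difference_0[where R=1]) (use g low \<delta> in auto)
  ultimately have "((\<lambda>t. p * (of_real (t powr (- \<delta>)) * (l t - l 0) + (\<Sum>k. d k t))) \<longlongrightarrow> p * (0 + (\<Sum>k. 0))) (at_right 0)"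
    by (intro tendsto_intros)
  then have main: "((\<lambda>t. p * (of_real (t powr (- \<delta>)) * (l t - l 0) + (\<Sum>k. d k t))) \<longlongrightarrow> 0) (at_right 0)"
    by simp
  have "\<forall>\<^sub>F t in at_right 0. p * (of_real (t powr (- \<delta>)) * (l t - l 0) + (\<Sum>k. d k t))
      = (U \<gamma> f x t - U \<gamma> f x 0) / of_real (t powr \<delta>)"
    using ev
  proof eventually_elim
    fix t :: real assume "t \<in> {0<..<1}"
    then have t: "t \<in> {0<..1}" by auto
    have "(\<Sum>k. b k t) = (\<Sum>k. b k 0) + of_real (t powr \<delta>) * (\<Sum>k. d k t)"
      unfolding bd[OF t] using suminf_add[OF sum0 summable_mult[OF sumd[OF t]]] suminf_mult[OF sumd[OF t]] by metis
    then show "p * (of_real (t powr (- \<delta>)) * (l t - l 0) + (\<Sum>k. d k t))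
      = (U \<gamma> f x t - U \<gamma> f x 0) / of_real (t powr \<delta>)"
      using t unfolding U0(2) Ut(2)[OF t] by (simp add: powr_minus_divide field_simps)
  qed
  then have "((\<lambda>t. (U \<gamma> f x t - U \<gamma> f x 0) / of_real (t powr \<delta>)) \<longlongrightarrow> 0) (at_right 0)"
    using main by (rule Lim_transform_eventually[rotated])
  moreover have "\<forall>\<^sub>F t in at_right 0. U_defined \<gamma> f x t"
    using ev by eventually_elim (use Ut(1) in auto)
  ultimately show ?thesis using U0(1) unfolding converges_with_rate_def by blast
qed

lemma AE_converges_with_rate:
  assumes \<delta>: "0 \<le> \<delta>" "\<delta> < \<alpha>" and s: "s > s_crit \<alpha> \<delta>" and f: "f \<in> sobolev s"
  shows "AE x in lborel. converges_with_rate \<gamma> \<delta> f x"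
proof -
  define g where "g = fhat f"
  define \<sigma> where "\<sigma> = s_crit \<alpha> \<delta>"
  have "0 < \<sigma>" using s_crit_ge[OF alpha \<delta>] alpha \<delta> by (auto simp: \<sigma>_def)
  then have s0: "s > 0" using s by (simp add: \<sigma>_def)
  define h where "h \<xi> = (norm ((1 + \<bar>\<xi>\<bar>\<^sup>2) powr (s / 2) *\<^sub>R g \<xi>))\<^sup>2" for \<xi>
  have h_int: "integrable lborel h" using f unfolding sobolev_def h_def g_def by simp
  obtain g' where "fourier_is_fun f g'" using f by (auto simp: sobolev_def)
  then have "fourier_is_fun f g" unfolding g_def fhat_def by (rule someI[of "fourier_is_fun f"])
  then have g[measurable]: "g \<in> borel_measurable borel" by (simp add: fourier_is_fun_def)
  have h_eq: "h \<xi> = (1 + \<xi>\<^sup>2) powr s * (cmod (g \<xi>))\<^sup>2" for \<xi>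
  proof -
    have "((1 + \<xi>\<^sup>2) powr (s / 2))\<^sup>2 = (1 + \<xi>\<^sup>2) powr s" by (simp add: power2_eq_square powr_add[symmetric])
    then show ?thesis by (simp add: h_def power_mult_distrib)
  qed
  have h0: "h \<xi> \<ge> 0" for \<xi> by (simp add: h_def)
  define H where "H = (\<integral>\<xi>. h \<xi> \<partial>lborel)"
  have H0: "H \<ge> 0" unfolding H_def by (rule Bochner_Integration.integral_nonneg) (rule h0)
  have g_le: "(cmod (g \<xi>))\<^sup>2 \<le> N powr (- 2 * s) * h \<xi>" if "N \<ge> 1" "N < \<bar>\<xi>\<bar>" for N \<xi>
  proof -
    have "N powr (2 * s) = (N powr 2) powr s" by (simp add: powr_powr)
    also have "\<dots> = (N\<^sup>2) powr s" using that by (simp add: powr_numeral)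
    also have "\<dots> \<le> (1 + \<xi>\<^sup>2) powr s"
    proof (rule powr_mono2)
      have "N\<^sup>2 \<le> \<bar>\<xi>\<bar>\<^sup>2" using that by (intro power_mono) auto
      then show "N\<^sup>2 \<le> 1 + \<xi>\<^sup>2" by simp
    qed (use s0 in auto)
    finally have "N powr (2 * s) * (cmod (g \<xi>))\<^sup>2 \<le> h \<xi>" unfolding h_eq by (intro mult_right_mono) auto
    then have "N powr (- 2 * s) * (N powr (2 * s) * (cmod (g \<xi>))\<^sup>2) \<le> N powr (- 2 * s) * h \<xi>"
      by (intro mult_left_mono) auto
    moreover have "N powr (- 2 * s) * (N powr (2 * s) * (cmod (g \<xi>))\<^sup>2) = (cmod (g \<xi>))\<^sup>2"
      using that by (simp add: mult.assoc[symmetric] powr_add[symmetric])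
    ultimately show ?thesis by (simp only:)
  qed
  have ann2: "finite_energy (2 ^ k) g" for k
    unfolding set_integrable_def
  proof (rule Bochner_Integration.integrable_bound)
    show "integrable lborel (\<lambda>\<xi>. (2 ^ k) powr (- 2 * s) * h \<xi>)" using h_int by simp
    show "AE \<xi> in lborel. norm (indicator (annulus (2 ^ k)) \<xi> *\<^sub>R (cmod (g \<xi>))\<^sup>2) \<le> norm ((2 ^ k) powr (- 2 * s) * h \<xi>)"
      using g_le[of "2 ^ k"] h0 by (intro AE_I2) (auto simp: indicator_def annulus_def abs_mult)
  qed measurable
  have ann2_le: "energy (2 ^ k) g \<le> (2 ^ k) powr (- 2 * s) * H" for k
  proof -
    have "energy (2 ^ k) g \<le> (\<integral>\<xi>. (2 ^ k) powr (- 2 * s) * h \<xi> \<partial>lborel)"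
      unfolding set_lebesgue_integral_def
      using ann2[of k] h_int g_le[of "2 ^ k"] h0 unfolding set_integrable_def
      by (intro integral_mono) (auto simp: indicator_def annulus_def)
    then show ?thesis by (simp add: H_def)
  qed
  have ann1: "set_integrable lborel (annulus (2 ^ k)) g" for k
    by (rule annulus_integrable_of_square) (use ann2 g in auto)
  have low: "set_integrable lborel {\<xi>. \<bar>\<xi>\<bar> \<le> 1} g"
    unfolding set_integrable_def
  proof (rule Bochner_Integration.integrable_bound)
    have Icc: "{\<xi>::real. \<bar>\<xi>\<bar> \<le> 1} = {- 1..1}" by auto
    have "integrable lborel (\<lambda>\<xi>::real. indicator {\<xi>. \<bar>\<xi>\<bar> \<le> 1} \<xi> :: real)"
      unfolding Icc by (intro integrable_real_indicator) (auto simp: emeasure_lborel_Icc_eq)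
    then show "integrable lborel (\<lambda>\<xi>. indicator {\<xi>. \<bar>\<xi>\<bar> \<le> 1} \<xi> + h \<xi>)" using h_int by auto
    have "cmod (g \<xi>) \<le> 1 + h \<xi>" for \<xi>
    proof -
      have "1 * (cmod (g \<xi>))\<^sup>2 \<le> h \<xi>"
        unfolding h_eq using s0 by (intro mult_right_mono ge_one_powr_ge_zero) auto
      then show ?thesis using le_one_plus_square[of "cmod (g \<xi>)"] by linarith
    qed
    then show "AE \<xi> in lborel. norm (indicator {\<xi>. \<bar>\<xi>\<bar> \<le> 1} \<xi> *\<^sub>R g \<xi>) \<le> norm (indicator {\<xi>. \<bar>\<xi>\<bar> \<le> 1} \<xi> + h \<xi>)"
      using h0 by (intro AE_I2) (auto simp: indicator_def add_nonneg_nonneg abs_of_nonneg)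
  qed measurable
  \<comment> \<open>The surplus \<open>s - \<sigma>\<close> pays for everything: with
    \<open>1 - \<kappa> \<le> s - \<sigma>\<close> the exponent
    \<open>2 * \<sigma> + (1 - \<kappa>) - 2 * s\<close> is at most \<open>- 2 * \<theta>\<close>.
    Half of this decay becomes the weight in the passage to almost every point, the other half sums
    the series with its factor \<open>real k + 1\<close>.\<close>
  define \<theta> where "\<theta> = (s - \<sigma>) / 2"
  have \<theta>: "\<theta> > 0" using s by (simp add: \<theta>_def \<sigma>_def)
  define \<kappa> where "\<kappa> = max (1 / 2) (1 - (s - \<sigma>))"
  have \<kappa>: "1 / 2 \<le> \<kappa>" "\<kappa> < 1" "1 - \<kappa> \<le> s - \<sigma>" using s by (auto simp: \<kappa>_def \<sigma>_def)
  define r where "r = (2::real) powr (- \<theta> / 2)"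
  have r: "0 \<le> r" "r < 1" using \<theta> powr_less_mono[of "- \<theta> / 2" 0 "2::real"] by (auto simp: r_def)
  have AE_m: "AE x in restrict_space lborel {- m..m}. converges_with_rate \<gamma> \<delta> f x" if m: "m > 0" for m
  proof -
    obtain Cz where Cz: "Cz > 0" and zero: "\<And>g N. \<lbrakk>N \<ge> 1; g \<in> borel_measurable borel;
        finite_energy N g\<rbrakk> \<Longrightarrow>
      maximal_L2_le m UNIV (\<lambda>t. block g N 0) (Cz * N powr (1 - \<kappa>) * energy N g)"
      by (rule maximal_block_zero[OF m \<kappa>(1,2)]) (rule that)
    obtain C where C: "C > 0" and block: "\<And>g k. \<lbrakk>g \<in> borel_measurable borel;
        finite_energy (2 ^ k) g\<rbrakk> \<Longrightarrow>
      maximal_L2_le m {0<..1} (\<lambda>t x. of_real (t powr (- \<delta>)) * (block g (2 ^ k) t x - block g (2 ^ k) 0 x))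
        (C * (real k + 1) * (2 ^ k) powr (2 * s_crit \<alpha> \<delta> + (1 - \<kappa>)) * energy (2 ^ k) g)"
      by (rule maximal_block[OF m \<kappa>(1,2) \<delta>]) (rule that)
    define D where "D = (C + Cz) * H"
    have D: "D \<ge> 0" using C Cz H0 by (simp add: D_def)
    define Q where "Q k = D * ((real k + 1) * 2 powr (- 2 * \<theta> * real k))" for k :: nat
    have Q0: "0 \<le> Q k" for k using D by (simp add: Q_def)
    have expo: "(2 ^ k) powr a * ((2 ^ k) powr (- 2 * s) * H) \<le> 2 powr (- 2 * \<theta> * real k) * H"
      if "a \<le> 2 * \<sigma> + (1 - \<kappa>)" for a and k :: nat
    proof -
      have "(2 ^ k :: real) powr a * (2 ^ k) powr (- 2 * s) = 2 powr (real k * (a - 2 * s))"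
        by (simp add: powr_realpow[symmetric] powr_powr powr_add[symmetric] algebra_simps)
      also have "\<dots> \<le> 2 powr (- 2 * \<theta> * real k)"
      proof (rule powr_mono)
        have "real k * (a - 2 * s) \<le> real k * (- 2 * \<theta>)"
          using that \<kappa>(3) by (intro mult_left_mono) (auto simp: \<theta>_def)
        then show "real k * (a - 2 * s) \<le> - 2 * \<theta> * real k" by (simp add: mult.commute)
      qed simp
      finally have "(2 ^ k :: real) powr a * (2 ^ k) powr (- 2 * s) * H \<le> 2 powr (- 2 * \<theta> * real k) * H"
        using H0 by (rule mult_right_mono)
      then show ?thesis by (simp add: mult.assoc)
    qed
    have max_zero: "maximal_L2_le m {0<..1} (\<lambda>t. block g (2 ^ k) 0) (Q k)" for k
    proof (rule maximal_L2_le_mono[OF zero])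
      have "Cz * (2 ^ k) powr (1 - \<kappa>) * energy (2 ^ k) g
          \<le> Cz * (2 ^ k) powr (1 - \<kappa>) * ((2 ^ k) powr (- 2 * s) * H)"
        using Cz by (intro mult_left_mono ann2_le) auto
      also have "\<dots> = Cz * ((2 ^ k) powr (1 - \<kappa>) * ((2 ^ k) powr (- 2 * s) * H))" by simp
      also have "\<dots> \<le> Cz * (2 powr (- 2 * \<theta> * real k) * H)"
        using Cz \<open>0 < \<sigma>\<close> by (intro mult_left_mono expo) auto
      also have "\<dots> = (Cz * 1) * (2 powr (- 2 * \<theta> * real k) * H)" by simp
      also have "\<dots> \<le> ((C + Cz) * (real k + 1)) * (2 powr (- 2 * \<theta> * real k) * H)"
        using C Cz H0 by (intro mult_right_mono mult_mono) auto
      also have "\<dots> = Q k" by (simp add: Q_def D_def)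
      finally show "Cz * (2 ^ k) powr (1 - \<kappa>) * energy (2 ^ k) g \<le> Q k" .
    qed (use g ann2 in auto)
    have max_diff: "maximal_L2_le m {0<..1} (\<lambda>t x. of_real (t powr (- \<delta>)) * (block g (2 ^ k) t x - block g (2 ^ k) 0 x)) (Q k)" for k
    proof (rule maximal_L2_le_mono[OF block])
      have "C * (real k + 1) * (2 ^ k) powr (2 * \<sigma> + (1 - \<kappa>)) * energy (2 ^ k) g
          \<le> C * (real k + 1) * (2 ^ k) powr (2 * \<sigma> + (1 - \<kappa>)) * ((2 ^ k) powr (- 2 * s) * H)"
        using C by (intro mult_left_mono ann2_le) auto
      also have "\<dots> = C * (real k + 1) * ((2 ^ k) powr (2 * \<sigma> + (1 - \<kappa>)) * ((2 ^ k) powr (- 2 * s) * H))" by simp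
      also have "\<dots> \<le> C * (real k + 1) * (2 powr (- 2 * \<theta> * real k) * H)"
        using C by (intro mult_left_mono expo) auto
      also have "\<dots> \<le> ((C + Cz) * (real k + 1)) * (2 powr (- 2 * \<theta> * real k) * H)"
        using C Cz H0 by (intro mult_right_mono) auto
      also have "\<dots> = Q k" by (simp add: Q_def D_def)
      finally show "C * (real k + 1) * (2 ^ k) powr (2 * s_crit \<alpha> \<delta> + (1 - \<kappa>)) * energy (2 ^ k) g \<le> Q k"
        by (simp add: \<sigma>_def)
    qed (use g ann2 in auto)
    have sumQ: "summable (\<lambda>k. 2 powr (\<theta> * real k) * Q k)"
    proof -
      have "2 powr (\<theta> * real k) * 2 powr (- 2 * \<theta> * real k) = (2 powr (- \<theta>)) ^ k" for k :: nat
        by (simp add: powr_add[symmetric] powr_realpow[symmetric] powr_powr)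
      then have eq: "2 powr (\<theta> * real k) * Q k = D * ((real k + 1) * (2 powr (- \<theta>)) ^ k)" for k
        unfolding Q_def by (metis mult.assoc mult.left_commute)
      have "(2::real) powr (- \<theta>) < 1" using \<theta> powr_less_mono[of "- \<theta>" 0 "2::real"] by simp
      then show ?thesis unfolding eq by (intro summable_mult summable_Suc_mult_power) auto
    qed
    have "AE x in restrict_space lborel {- m..m}. \<exists>B. \<forall>k. \<forall>t\<in>{0<..1::real}. cmod (block g (2 ^ k) 0 x) \<le> B * (2 powr (- \<theta> / 2)) ^ k"
      by (rule maximal_L2_le_imp_AE_geometric[OF max_zero Q0 sumQ])
    moreover have "AE x in restrict_space lborel {- m..m}. \<exists>B. \<forall>k. \<forall>t\<in>{0<..1}.
        cmod (of_real (t powr (- \<delta>)) * (block g (2 ^ k) t x - block g (2 ^ k) 0 x)) \<le> B * (2 powr (- \<theta> / 2)) ^ k"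
      by (rule maximal_L2_le_imp_AE_geometric[OF max_diff Q0 sumQ])
    ultimately show ?thesis
    proof eventually_elim
      fix x
      assume "\<exists>B. \<forall>k. \<forall>t\<in>{0<..1::real}. cmod (block g (2 ^ k) 0 x) \<le> B * (2 powr (- \<theta> / 2)) ^ k"
        and "\<exists>B. \<forall>k. \<forall>t\<in>{0<..1}. cmod (of_real (t powr (- \<delta>)) * (block g (2 ^ k) t x - block g (2 ^ k) 0 x)) \<le> B * (2 powr (- \<theta> / 2)) ^ k"
      then obtain B B' where B: "\<And>k t. t \<in> {0<..1::real} \<Longrightarrow> cmod (block g (2 ^ k) 0 x) \<le> B * r ^ k"
        "\<And>k t. t \<in> {0<..1} \<Longrightarrow> cmod (of_real (t powr (- \<delta>)) * (block g (2 ^ k) t x - block g (2 ^ k) 0 x)) \<le> B' * r ^ k"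
        unfolding r_def by blast
      show "converges_with_rate \<gamma> \<delta> f x"
        by (rule converges_with_rate_of_geometric[where r=r and B=B and B'=B'])
           (use g low ann1 \<delta> r B(1)[of 1] B(2) in \<open>auto simp: g_def\<close>)
    qed
  qed
  have "AE x in lborel. \<forall>n::nat. x \<in> {- (real n + 1)..real n + 1} \<longrightarrow> converges_with_rate \<gamma> \<delta> f x"
  proof (subst AE_all_countable, intro allI)
    fix n :: nat
    have "AE x in restrict_space lborel {- (real n + 1)..real n + 1}. converges_with_rate \<gamma> \<delta> f x"
      by (rule AE_m) simp
    then show "AE x in lborel. x \<in> {- (real n + 1)..real n + 1} \<longrightarrow> converges_with_rate \<gamma> \<delta> f x"
      by (subst (asm) AE_restrict_space_iff) auto
  qed
  then show ?thesis
  proof eventually_elim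
    fix x :: real assume *: "\<forall>n::nat. x \<in> {- (real n + 1)..real n + 1} \<longrightarrow> converges_with_rate \<gamma> \<delta> f x"
    obtain n :: nat where "\<bar>x\<bar> \<le> real n" using real_arch_simple by blast
    then have "x \<in> {- (real n + 1)..real n + 1}" by auto
    then show "converges_with_rate \<gamma> \<delta> f x" using * by blast
  qed
qed

end

lemma admissible_curve_imp_holder_curve:
  assumes "0 < \<alpha>" "\<alpha> \<le> 1 / 4" "admissible_curve \<alpha> \<gamma>"
  obtains C1 C3 where "holder_curve \<alpha> \<gamma> C1 C3"
proof -
  obtain C1 C2 where C: "C1 > 0" and bil: "\<And>t x x'. t \<in> {-1..1} \<Longrightarrow> 1 / C1 * \<bar>x - x'\<bar> \<le> \<bar>\<gamma> (x, t) - \<gamma> (x', t)\<bar>"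
    using assms(3) unfolding admissible_curve_def by blast
  obtain C3 where C3: "C3 > 0" "\<And>t t' x. t \<in> {-1..1} \<Longrightarrow> t' \<in> {-1..1} \<Longrightarrow> \<bar>\<gamma> (x, t) - \<gamma> (x, t')\<bar> \<le> C3 * \<bar>t - t'\<bar> powr \<alpha>"
    using assms(3) unfolding admissible_curve_def by blast
  have "holder_curve \<alpha> \<gamma> C1 C3"
  proof
    fix t x x' :: real assume "t \<in> {-1..1}"
    from bil[OF this, of x x'] C show "\<bar>x - x'\<bar> \<le> C1 * \<bar>\<gamma> (x, t) - \<gamma> (x', t)\<bar>"
      by (simp add: field_simps)
  qed (use assms C C3 in \<open>auto simp: admissible_curve_def\<close>)
  then show ?thesis by (rule that)
qed

section \<open>Fourier analysis of Schwartz functions\<close>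

lemma norm_le_schwartz_norm:
  assumes "\<psi> \<in> schwartz" "j \<le> n" "k \<le> n"
  shows "norm (x ^ j *\<^sub>R nderiv k \<psi> x) \<le> schwartz_norm n \<psi>"
proof -
  have bdd: "bdd_above (range (\<lambda>x. norm (x ^ j *\<^sub>R nderiv k \<psi> x)))" for j k
  proof -
    have "bounded (range (\<lambda>x. x ^ j *\<^sub>R nderiv k \<psi> x))" using assms(1) by (auto simp: schwartz_def)
    then have "bdd_above (norm ` range (\<lambda>x. x ^ j *\<^sub>R nderiv k \<psi> x))" by (simp only: bdd_above_norm)
    then show ?thesis by (simp only: image_image)
  qed
  have nn: "0 \<le> (SUP x. norm (x ^ j *\<^sub>R nderiv k \<psi> x))" for j k
    by (rule order_trans[OF norm_ge_zero cSUP_upper[OF UNIV_I bdd]])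
  have "norm (x ^ j *\<^sub>R nderiv k \<psi> x) \<le> (SUP x. norm (x ^ j *\<^sub>R nderiv k \<psi> x))"
    by (rule cSUP_upper[OF UNIV_I bdd])
  also have "\<dots> \<le> (\<Sum>k\<le>n. SUP x. norm (x ^ j *\<^sub>R nderiv k \<psi> x))"
    using assms nn by (intro member_le_sum[where f="\<lambda>k. SUP x. norm (x ^ j *\<^sub>R nderiv k \<psi> x)"]) auto
  also have "\<dots> \<le> schwartz_norm n \<psi>"
    unfolding schwartz_norm_def using assms nn
    by (intro member_le_sum[where f="\<lambda>j. \<Sum>k\<le>n. SUP x. norm (x ^ j *\<^sub>R nderiv k \<psi> x)"]) (auto intro!: sum_nonneg)
  finally show ?thesis .
qed

lemma nderiv_has_vector_derivative:
  assumes "\<psi> \<in> schwartz"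
  shows "(nderiv k \<psi> has_vector_derivative nderiv (Suc k) \<psi> x) (at x)"
  using assms unfolding schwartz_def by (simp add: nderiv_def vector_derivative_works)

lemma continuous_nderiv: "\<psi> \<in> schwartz \<Longrightarrow> continuous_on UNIV (nderiv k \<psi>)"
  by (intro continuous_at_imp_continuous_on ballI has_vector_derivative_continuous[OF nderiv_has_vector_derivative])

lemma nderiv_borel_measurable: "\<psi> \<in> schwartz \<Longrightarrow> nderiv k \<psi> \<in> borel_measurable borel"
  by (intro borel_measurable_continuous_onI continuous_nderiv)

lemma nderiv_decay:
  assumes "\<psi> \<in> schwartz" "2 \<le> n" "k \<le> n"
  shows "cmod (nderiv k \<psi> x) \<le> 2 * schwartz_norm n \<psi> * inverse (1 + x\<^sup>2)"
proof -
  have "cmod (nderiv k \<psi> x) + x\<^sup>2 * cmod (nderiv k \<psi> x) \<le> schwartz_norm n \<psi> + schwartz_norm n \<psi>"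
    using norm_le_schwartz_norm[OF assms(1), of 0 n k x] norm_le_schwartz_norm[OF assms(1), of 2 n k x] assms
    by (intro add_mono) auto
  then have "(1 + x\<^sup>2) * cmod (nderiv k \<psi> x) \<le> 2 * schwartz_norm n \<psi>" by (simp add: distrib_right)
  moreover have "0 < 1 + x\<^sup>2" by (simp add: add_pos_nonneg)
  ultimately show ?thesis by (simp add: field_simps)
qed

lemma integrable_inverse_1_plus_square': "integrable lborel (\<lambda>x::real. inverse (1 + x\<^sup>2))"
  using integrable_inverse_1_plus_square by (simp add: set_integrable_def)

lemma integrable_nderiv:
  assumes "\<psi> \<in> schwartz"
  shows "integrable lborel (nderiv k \<psi>)"
proof (rule Bochner_Integration.integrable_bound)
  show "integrable lborel (\<lambda>x. 2 * schwartz_norm (max 2 k) \<psi> * inverse (1 + x\<^sup>2))"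
    using integrable_inverse_1_plus_square' by simp
  show "AE x in lborel. norm (nderiv k \<psi> x) \<le> norm (2 * schwartz_norm (max 2 k) \<psi> * inverse (1 + x\<^sup>2))"
    using nderiv_decay[OF assms, of "max 2 k" k] by (intro AE_I2) (auto intro: order_trans[OF _ abs_ge_self])
qed (use nderiv_borel_measurable[OF assms] in simp)

lemma nderiv_0[simp]: "nderiv 0 \<psi> = \<psi>" by (simp add: nderiv_def)

lemma integrable_schwartz: "\<psi> \<in> schwartz \<Longrightarrow> integrable lborel \<psi>"
  using integrable_nderiv[of \<psi> 0] by simp

lemma integrable_cis_mult:
  assumes "integrable lborel f"
  shows "integrable lborel (\<lambda>x. cis (a * x) * f x)"
proof -
  have [measurable]: "(\<lambda>x. cis (a * x)) \<in> borel_measurable borel"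
    by (intro borel_measurable_continuous_onI continuous_intros)
  show ?thesis
    by (rule Bochner_Integration.integrable_bound[OF assms]) (use assms in \<open>auto simp: norm_mult\<close>)
qed

lemma fourier_eq: "fourier \<phi> \<xi> = (LINT x|lborel. cis (- \<xi> * x) * \<phi> x)"
  unfolding fourier_def cis_conv_exp
  by (rule Bochner_Integration.integral_cong) (auto simp: mult_ac)

text \<open>Integration by parts on the whole line; the boundary terms vanish by the decay of
  Schwartz functions.\<close>

lemma fourier_nderiv_Suc:
  assumes "\<psi> \<in> schwartz"
  shows "fourier (nderiv (Suc k) \<psi>) \<xi> = \<i> * of_real \<xi> * fourier (nderiv k \<psi>) \<xi>"
proof -
  define F where "F x = cis (- \<xi> * x) * nderiv k \<psi> x" for x
  define F' where "F' x = cis (- \<xi> * x) * nderiv (Suc k) \<psi> x + (- \<i> * of_real \<xi>) * (cis (- \<xi> * x) * nderiv k \<psi> x)" for x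
  have i: "integrable lborel (\<lambda>x. cis (- \<xi> * x) * nderiv k \<psi> x)" for k
    by (intro integrable_cis_mult integrable_nderiv assms)
  have F'_int: "integrable lborel F'" unfolding F'_def using i by simp
  have der: "(F has_vector_derivative F' x) (at x)" for x
  proof -
    have "((\<lambda>x. cis (- \<xi> * x)) has_vector_derivative (\<i> * of_real (- \<xi>) * cis (- \<xi> * x))) (at x)"
      using has_vector_derivative_cis_quadratic[of "- \<xi>" 0 x UNIV] by simp
    from has_vector_derivative_mult[OF this nderiv_has_vector_derivative[OF assms, of k x]]
    show ?thesis unfolding F_def F'_def by (simp add: mult_ac)
  qed
  have lim: "(F \<longlongrightarrow> 0) at_top" "(F \<longlongrightarrow> 0) at_bot"
  proof -
    define c where "c = 2 * schwartz_norm (max 2 k) \<psi>"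
    have "cmod (F x) \<le> c * inverse (1 + x\<^sup>2)" for x
      using nderiv_decay[OF assms, of "max 2 k" k x] by (simp add: F_def norm_mult c_def)
    then have bound: "\<forall>\<^sub>F x in G. norm (F x) \<le> c * inverse (1 + x\<^sup>2)" for G by simp
    have "((\<lambda>x::real. c * inverse (1 + x\<^sup>2)) \<longlongrightarrow> c * 0) at_top" "((\<lambda>x::real. c * inverse (1 + x\<^sup>2)) \<longlongrightarrow> c * 0) at_bot"
      by (intro tendsto_mult tendsto_const tendsto_inverse_0_at_top filterlim_tendsto_add_at_top[OF tendsto_const]
          filterlim_pow_at_top filterlim_ident filterlim_pow_at_bot_even; simp)+
    then show "(F \<longlongrightarrow> 0) at_top" "(F \<longlongrightarrow> 0) at_bot"
      using Lim_null_comparison[OF bound] by auto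
  qed
  have "(LBINT x=-\<infinity>..\<infinity>. F' x) = 0 - 0"
  proof (rule interval_integral_FTC_integrable[where F=F])
    show "isCont F' x" for x
    proof -
      have "continuous_on UNIV F'"
        unfolding F'_def by (intro continuous_intros continuous_nderiv assms)
      then show ?thesis by (simp add: continuous_on_eq_continuous_at)
    qed
  qed (use der F'_int lim in \<open>auto simp: set_integrable_def ereal_tendsto_simps\<close>)
  then have "(LINT x|lborel. F' x) = 0"
    by (simp add: interval_lebesgue_integral_def set_lebesgue_integral_def)
  moreover have "(LINT x|lborel. F' x) = fourier (nderiv (Suc k) \<psi>) \<xi> - \<i> * of_real \<xi> * fourier (nderiv k \<psi>) \<xi>"
    unfolding F'_def fourier_eq using i by simp
  ultimately show ?thesis by simp
qed

lemma norm_fourier_le: "cmod (fourier \<phi> \<xi>) \<le> (LINT x|lborel. cmod (\<phi> x))"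
  unfolding fourier_eq
  by (rule order_trans[OF integral_norm_bound]) (simp add: norm_mult)

lemma continuous_fourier:
  assumes "integrable lborel \<phi>"
  shows "continuous_on UNIV (fourier \<phi>)"
proof -
  have "(\<lambda>n. fourier \<phi> (s n)) \<longlonglongrightarrow> fourier \<phi> \<xi>" if s: "s \<longlonglongrightarrow> \<xi>" for s \<xi>
    unfolding fourier_eq
  proof (rule integral_dominated_convergence[where w="\<lambda>x. cmod (\<phi> x)"])
    show "AE x in lborel. (\<lambda>n. cis (- s n * x) * \<phi> x) \<longlonglongrightarrow> cis (- \<xi> * x) * \<phi> x"
    proof (rule AE_I2)
      fix x
      have "continuous_on UNIV (\<lambda>a. cis (- a * x) * \<phi> x)" by (intro continuous_intros)
      then have "isCont (\<lambda>a. cis (- a * x) * \<phi> x) \<xi>" by (simp add: continuous_on_eq_continuous_at)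
      then show "(\<lambda>n. cis (- s n * x) * \<phi> x) \<longlonglongrightarrow> cis (- \<xi> * x) * \<phi> x"
        by (rule isCont_tendsto_compose[OF _ s])
    qed
    have "(\<lambda>x. cis (- a * x) * \<phi> x) \<in> borel_measurable lborel" for a
      using integrable_cis_mult[OF assms, of "- a"] by (rule borel_measurable_integrable)
    then show "(\<lambda>x. cis (- \<xi> * x) * \<phi> x) \<in> borel_measurable lborel"
      "(\<lambda>x. cis (- s n * x) * \<phi> x) \<in> borel_measurable lborel" for n by blast+
  qed (use assms in \<open>auto simp: norm_mult\<close>)
  then show ?thesis by (auto simp: continuous_on_sequentially comp_def)
qed

text \<open>Two derivatives control
  \<open>(1 + \<xi>\<^sup>2) * cmod (fourier \<psi> \<xi>)\<close>. The constant must not depend on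
  \<open>\<psi>\<close>, since the estimate later serves as the continuity bound of a tempered
  distribution.\<close>

lemma fourier_schwartz_decay:
  obtains W where "W \<ge> 0" and "\<And>\<psi> \<xi>. \<psi> \<in> schwartz \<Longrightarrow> cmod (fourier \<psi> \<xi>) \<le> W * schwartz_norm 2 \<psi> * inverse (1 + \<xi>\<^sup>2)"
proof -
  define W0 where "W0 = (LINT x|lborel. inverse (1 + (x::real)\<^sup>2))"
  have W0: "W0 \<ge> 0" unfolding W0_def by (rule Bochner_Integration.integral_nonneg) (simp add: add_nonneg_nonneg)
  show ?thesis
  proof (rule that[of "4 * W0"])
    show "4 * W0 \<ge> 0" using W0 by simp
    fix \<psi> \<xi> assume \<psi>: "\<psi> \<in> schwartz"
    have L1: "cmod (fourier (nderiv k \<psi>) \<xi>) \<le> 2 * schwartz_norm 2 \<psi> * W0" if "k \<le> 2" for k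
    proof -
      have "cmod (fourier (nderiv k \<psi>) \<xi>) \<le> (LINT x|lborel. cmod (nderiv k \<psi> x))" by (rule norm_fourier_le)
      also have "\<dots> \<le> (LINT x|lborel. 2 * schwartz_norm 2 \<psi> * inverse (1 + x\<^sup>2))"
        using integrable_nderiv[OF \<psi>, of k] integrable_inverse_1_plus_square' nderiv_decay[OF \<psi>, of 2 k] that
        by (intro integral_mono) auto
      finally show ?thesis by (simp add: W0_def)
    qed
    have "fourier (nderiv 2 \<psi>) \<xi> = (\<i> * of_real \<xi>) * ((\<i> * of_real \<xi>) * fourier \<psi> \<xi>)"
      using fourier_nderiv_Suc[OF \<psi>, of 0 \<xi>] fourier_nderiv_Suc[OF \<psi>, of 1 \<xi>] by (simp add: numeral_2_eq_2)
    then have "cmod (fourier (nderiv 2 \<psi>) \<xi>) = \<xi>\<^sup>2 * cmod (fourier \<psi> \<xi>)"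
      by (simp add: norm_mult power2_eq_square mult.assoc[symmetric])
    then have "(1 + \<xi>\<^sup>2) * cmod (fourier \<psi> \<xi>) \<le> 4 * W0 * schwartz_norm 2 \<psi>"
      using L1[of 0] L1[of 2] by (simp add: algebra_simps)
    moreover have "0 < 1 + \<xi>\<^sup>2" by (simp add: add_pos_nonneg)
    ultimately show "cmod (fourier \<psi> \<xi>) \<le> 4 * W0 * schwartz_norm 2 \<psi> * inverse (1 + \<xi>\<^sup>2)"
      by (simp add: field_simps)
  qed
qed

lemma integrable_fourier_schwartz:
  assumes "\<psi> \<in> schwartz"
  shows "integrable lborel (fourier \<psi>)"
proof -
  obtain W where W: "W \<ge> 0" "\<And>\<psi> \<xi>. \<psi> \<in> schwartz \<Longrightarrow> cmod (fourier \<psi> \<xi>) \<le> W * schwartz_norm 2 \<psi> * inverse (1 + \<xi>\<^sup>2)"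
    by (rule fourier_schwartz_decay) (rule that)
  have meas: "fourier \<psi> \<in> borel_measurable lborel"
    using borel_measurable_continuous_onI[OF continuous_fourier[OF integrable_schwartz[OF assms]]] by simp
  have int: "integrable lborel (\<lambda>\<xi>. W * schwartz_norm 2 \<psi> * inverse (1 + \<xi>\<^sup>2))"
    using integrable_inverse_1_plus_square' by simp
  have "AE \<xi> in lborel. cmod (fourier \<psi> \<xi>) \<le> norm (W * schwartz_norm 2 \<psi> * inverse (1 + \<xi>\<^sup>2))"
    unfolding real_norm_def by (intro AE_I2 order_trans[OF W(2)[OF assms] abs_ge_self])
  then show ?thesis by (rule Bochner_Integration.integrable_bound[OF int meas])
qed

section \<open>Gaussian regularization and Fourier inversion\<close>

lemma integral_std_normal:
  fixes f :: "real \<Rightarrow> complex"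
  assumes "f \<in> borel_measurable borel"
  shows "(\<integral>v. f v \<partial>std_normal_distribution) = (LINT v|lborel. of_real (std_normal_density v) * f v)"
  using assms by (subst integral_density) (auto simp: scaleR_conv_of_real)

text \<open>A rescaled form of the characteristic function of the standard normal
  distribution.\<close>

lemma fourier_gaussian:
  assumes e: "e > 0"
  shows "(LINT x|lborel. cis (u * x) * of_real (exp (- (e * x)\<^sup>2 / 2))) = of_real (sqrt (2 * pi) / e * exp (- (u / e)\<^sup>2 / 2))"
proof -
  have "of_real (exp (- (u / e)\<^sup>2 / 2)) = (LINT v|lborel. of_real (std_normal_density v) * iexp (u / e * v))"
    using fun_cong[OF char_std_normal_distribution, of "u / e"] unfolding char_def by (subst (asm) integral_std_normal) auto
  also have "\<dots> = e *\<^sub>R (LINT x|lborel. of_real (std_normal_density (0 + e * x)) * iexp (u / e * (0 + e * x)))"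
    using e by (subst lborel_integral_real_affine[where c=e and t=0]) auto
  also have "(LINT x|lborel. of_real (std_normal_density (0 + e * x)) * iexp (u / e * (0 + e * x)))
      = (LINT x|lborel. of_real (1 / sqrt (2 * pi)) * (cis (u * x) * of_real (exp (- (e * x)\<^sup>2 / 2))))"
    using e by (intro Bochner_Integration.integral_cong) (auto simp: std_normal_density_def cis_conv_exp)
  also have "\<dots> = of_real (1 / sqrt (2 * pi)) * (LINT x|lborel. cis (u * x) * of_real (exp (- (e * x)\<^sup>2 / 2)))"
    by (rule integral_mult_right_zero)
  finally have "of_real (exp (- (u / e)\<^sup>2 / 2)) = of_real e * (of_real (1 / sqrt (2 * pi)) * (LINT x|lborel. cis (u * x) * of_real (exp (- (e * x)\<^sup>2 / 2))))"
    by (simp add: scaleR_conv_of_real)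
  then have "of_real (sqrt (2 * pi) / e) * complex_of_real (exp (- (u / e)\<^sup>2 / 2)) =
      (LINT x|lborel. cis (u * x) * of_real (exp (- (e * x)\<^sup>2 / 2)))"
    using e by (simp add: field_simps)
  then show ?thesis by simp
qed

text \<open>Damping by a wide Gaussian justifies Fubini. The damped integral \<open>A n\<close> then
  has two descriptions: a regularization of the left side, and an average of \<open>\<phi>\<close>
  around \<open>x\<close> at scale \<open>e n\<close>. The claim compares their limits.\<close>

lemma fourier_inversion:
  assumes cont: "continuous_on UNIV \<phi>" and bd: "\<And>x. cmod (\<phi> x) \<le> K"
    and int: "integrable lborel \<phi>" "integrable lborel (fourier \<phi>)"
  shows "(LINT \<xi>|lborel. cis (x * \<xi>) * fourier \<phi> \<xi>) = of_real (2 * pi) * \<phi> x"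
proof (rule LIMSEQ_unique)
  define e where "e n = 1 / (real n + 1)" for n :: nat
  have e: "e n > 0" for n by (simp add: e_def)
  have e_lim: "e \<longlonglongrightarrow> 0" unfolding e_def using LIMSEQ_inverse_real_of_nat by (simp add: inverse_eq_divide add.commute)
  define G where "G n \<xi> = complex_of_real (exp (- (e n * \<xi>)\<^sup>2 / 2))" for n \<xi>
  define A where "A n = (LINT \<xi>|lborel. (cis (x * \<xi>) * G n \<xi>) * fourier \<phi> \<xi>)" for n
  have cis_meas[measurable]: "cis \<in> borel_measurable borel"
    by (intro borel_measurable_continuous_onI continuous_intros)
  have [measurable]: "G n \<in> borel_measurable borel" for n unfolding G_def by measurable
  have [measurable]: "\<phi> \<in> borel_measurable borel" "fourier \<phi> \<in> borel_measurable borel"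
    using int by auto
  have G1: "cmod (G n \<xi>) \<le> 1" for n \<xi> by (simp add: G_def)
  show "A \<longlonglongrightarrow> (LINT \<xi>|lborel. cis (x * \<xi>) * fourier \<phi> \<xi>)"
    unfolding A_def
  proof (rule integral_dominated_convergence[where w="\<lambda>\<xi>. cmod (fourier \<phi> \<xi>)"])
    show "AE \<xi> in lborel. (\<lambda>n. (cis (x * \<xi>) * G n \<xi>) * fourier \<phi> \<xi>) \<longlonglongrightarrow> cis (x * \<xi>) * fourier \<phi> \<xi>"
    proof (rule AE_I2)
      fix \<xi>
      have "(\<lambda>n. (cis (x * \<xi>) * G n \<xi>) * fourier \<phi> \<xi>) \<longlonglongrightarrow>
          (cis (x * \<xi>) * complex_of_real (exp (- (0 * \<xi>)\<^sup>2 / 2))) * fourier \<phi> \<xi>"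
        unfolding G_def by (intro tendsto_intros e_lim) auto
      then show "(\<lambda>n. (cis (x * \<xi>) * G n \<xi>) * fourier \<phi> \<xi>) \<longlonglongrightarrow> cis (x * \<xi>) * fourier \<phi> \<xi>" by simp
    qed
    show "AE \<xi> in lborel. norm ((cis (x * \<xi>) * G n \<xi>) * fourier \<phi> \<xi>) \<le> cmod (fourier \<phi> \<xi>)" for n
      using G1 by (intro AE_I2) (auto simp: norm_mult intro!: mult_left_le_one_le)
  qed (use int in auto)
  have A_eq: "A n = (LINT v|lborel. of_real (2 * pi * std_normal_density v) * \<phi> (x + e n * v))" for n
  proof -
    have "integrable lborel (\<lambda>v. std_normal_density v)" by simp
    from lborel_integrable_real_affine[OF this, of "e n" 0] e[of n]
    have "integrable lborel (\<lambda>v. sqrt (2 * pi) * std_normal_density (0 + e n * v))" by simp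
    then have G_int: "integrable lborel (\<lambda>\<xi>. cmod (G n \<xi>))" by (simp add: std_normal_density_def G_def)
    have pair_int: "integrable (lborel \<Otimes>\<^sub>M lborel) (\<lambda>(\<xi>, y). (cis (x * \<xi>) * G n \<xi>) * (cis (- \<xi> * y) * \<phi> y))"
    proof (rule lborel_pair.Fubini_integrable)
      show "AE \<xi> in lborel. integrable lborel (\<lambda>y. case (\<xi>, y) of (\<xi>, y) \<Rightarrow> (cis (x * \<xi>) * G n \<xi>) * (cis (- \<xi> * y) * \<phi> y))"
        unfolding prod.case by (intro AE_I2 integrable_mult_right integrable_cis_mult int)
      show "integrable lborel (\<lambda>\<xi>. LINT y|lborel. norm (case (\<xi>, y) of (\<xi>, y) \<Rightarrow> (cis (x * \<xi>) * G n \<xi>) * (cis (- \<xi> * y) * \<phi> y)))"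
        using G_int by (simp add: norm_mult)
    qed measurable
    have "A n = (LINT \<xi>|lborel. LINT y|lborel. (cis (x * \<xi>) * G n \<xi>) * (cis (- \<xi> * y) * \<phi> y))"
      unfolding A_def fourier_eq by simp
    also have "\<dots> = (LINT y|lborel. LINT \<xi>|lborel. (cis (x * \<xi>) * G n \<xi>) * (cis (- \<xi> * y) * \<phi> y))"
      using lborel_pair.Fubini_integral[OF pair_int] by simp
    also have "\<dots> = (LINT y|lborel. of_real (sqrt (2 * pi) / e n * exp (- ((x - y) / e n)\<^sup>2 / 2)) * \<phi> y)"
    proof (rule Bochner_Integration.integral_cong[OF refl])
      fix y
      have "(LINT \<xi>|lborel. (cis (x * \<xi>) * G n \<xi>) * (cis (- \<xi> * y) * \<phi> y)) = (LINT \<xi>|lborel. (cis ((x - y) * \<xi>) * G n \<xi>) * \<phi> y)"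
      proof -
        have "cis ((x - y) * \<xi>) = cis (x * \<xi>) * cis (- \<xi> * y)" for \<xi>
          by (simp add: cis_mult algebra_simps)
        then show ?thesis by (simp only: mult_ac)
      qed
      then show "(LINT \<xi>|lborel. (cis (x * \<xi>) * G n \<xi>) * (cis (- \<xi> * y) * \<phi> y)) = of_real (sqrt (2 * pi) / e n * exp (- ((x - y) / e n)\<^sup>2 / 2)) * \<phi> y"
        using fourier_gaussian[OF e, of "x - y" n] by (simp add: G_def)
    qed
    also have "\<dots> = \<bar>e n\<bar> *\<^sub>R (LINT v|lborel. of_real (sqrt (2 * pi) / e n * exp (- ((x - (x + e n * v)) / e n)\<^sup>2 / 2)) * \<phi> (x + e n * v))"
      using e[of n] by (subst lborel_integral_real_affine[where c="e n" and t=x]) auto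
    also have "\<dots> = (LINT v|lborel. of_real (e n) * (of_real (sqrt (2 * pi) / e n * exp (- ((x - (x + e n * v)) / e n)\<^sup>2 / 2)) * \<phi> (x + e n * v)))"
      using e[of n] by (simp add: scaleR_conv_of_real)
    also have "\<dots> = (LINT v|lborel. of_real (2 * pi * std_normal_density v) * \<phi> (x + e n * v))"
    proof (rule Bochner_Integration.integral_cong[OF refl])
      fix v
      have "(x - (x + e n * v)) / e n = - v" using e[of n] by simp
      moreover have s: "2 * pi * (1 / sqrt (2 * pi)) = sqrt (2 * pi)" by (simp add: real_div_sqrt)
      ultimately have "e n * (sqrt (2 * pi) / e n * exp (- ((x - (x + e n * v)) / e n)\<^sup>2 / 2)) = 2 * pi * std_normal_density v"
        using e[of n] unfolding std_normal_density_def mult.assoc[symmetric] s by simp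
      then have "complex_of_real (e n) * of_real (sqrt (2 * pi) / e n * exp (- ((x - (x + e n * v)) / e n)\<^sup>2 / 2)) = of_real (2 * pi * std_normal_density v)"
        by (metis of_real_mult)
      then show "of_real (e n) * (of_real (sqrt (2 * pi) / e n * exp (- ((x - (x + e n * v)) / e n)\<^sup>2 / 2)) * \<phi> (x + e n * v))
          = of_real (2 * pi * std_normal_density v) * \<phi> (x + e n * v)"
        by (metis mult.assoc)
    qed
    finally show ?thesis .
  qed
  have "A \<longlonglongrightarrow> (LINT v|lborel. of_real (2 * pi * std_normal_density v) * \<phi> x)"
    unfolding A_eq
  proof (rule integral_dominated_convergence[where w="\<lambda>v. 2 * pi * std_normal_density v * K"])
    show "AE v in lborel. (\<lambda>n. of_real (2 * pi * std_normal_density v) * \<phi> (x + e n * v)) \<longlonglongrightarrow> of_real (2 * pi * std_normal_density v) * \<phi> x"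
    proof (rule AE_I2)
      fix v
      have "(\<lambda>n. x + e n * v) \<longlonglongrightarrow> x + 0 * v" by (intro tendsto_intros e_lim)
      then have "(\<lambda>n. \<phi> (x + e n * v)) \<longlonglongrightarrow> \<phi> x"
        using continuous_on_tendsto_compose[OF cont] by fastforce
      then show "(\<lambda>n. of_real (2 * pi * std_normal_density v) * \<phi> (x + e n * v)) \<longlonglongrightarrow> of_real (2 * pi * std_normal_density v) * \<phi> x"
        by (intro tendsto_mult tendsto_const)
    qed
    show "AE v in lborel. norm (of_real (2 * pi * std_normal_density v) * \<phi> (x + e n * v)) \<le> 2 * pi * std_normal_density v * K" for n
      unfolding norm_mult norm_of_real using bd by (intro AE_I2) (auto simp: abs_mult intro!: mult_left_mono)
  qed auto
  also have "(LINT v|lborel. of_real (2 * pi * std_normal_density v) * \<phi> x) = of_real (LINT v|lborel. 2 * pi * std_normal_density v) * \<phi> x"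
    by simp
  also have "(LINT v|lborel. 2 * pi * std_normal_density v) = 2 * pi" by simp
  finally show "A \<longlonglongrightarrow> of_real (2 * pi) * \<phi> x" .
qed

lemma fourier_fourier_schwartz:
  assumes "\<phi> \<in> schwartz"
  shows "fourier (fourier \<phi>) (- x) = of_real (2 * pi) * \<phi> x"
proof -
  have "(LINT \<xi>|lborel. cis (x * \<xi>) * fourier \<phi> \<xi>) = of_real (2 * pi) * \<phi> x"
  proof (rule fourier_inversion)
    show "cmod (\<phi> x) \<le> schwartz_norm 0 \<phi>" for x
      using norm_le_schwartz_norm[OF assms, of 0 0 0 x] by simp
    show "continuous_on UNIV \<phi>" using continuous_nderiv[OF assms, of 0] by simp
  qed (use assms integrable_schwartz integrable_fourier_schwartz in auto)
  then show ?thesis by (simp add: fourier_eq)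
qed

text \<open>The counterexample prescribes a Fourier transform, while the elements of
  \<open>sobolev\<close> are distributions. For bounded \<open>g\<close> the corresponding
  functional is tempered by the uniform decay of Fourier transforms of test functions.\<close>

lemma ex_distribution_with_fourier:
  fixes g :: "real \<Rightarrow> complex"
  assumes g[measurable]: "g \<in> borel_measurable borel" and bd: "\<And>\<xi>. cmod (g \<xi>) \<le> 1"
  obtains f where "tempered f" "fourier_is_fun f g"
proof -
  \<comment> \<open>\<open>f\<close> pairs \<open>g\<close> with the inverse Fourier transform of
    the test function; the reflection and the factor \<open>2 * pi\<close> are those of the
    inversion formula.\<close>
  define f :: distribution where "f \<psi> = (LINT \<xi>|lborel. g \<xi> * (fourier \<psi> (- \<xi>) / of_real (2 * pi)))" for \<psi>
  have int: "integrable lborel (\<lambda>\<xi>. g \<xi> * h \<xi>)" if "integrable lborel h" for h :: "real \<Rightarrow> complex"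
    by (rule Bochner_Integration.integrable_bound[OF that])
       (use that bd in \<open>auto simp: norm_mult intro!: mult_left_le_one_le\<close>)
  have int': "integrable lborel (\<lambda>\<xi>. g \<xi> * (fourier \<psi> (- \<xi>) / of_real (2 * pi)))" if "\<psi> \<in> schwartz" for \<psi>
    using lborel_integrable_real_affine[OF integrable_fourier_schwartz[OF that], of "- 1" 0] by (intro int) simp
  have lin: "f (\<lambda>x. a * \<phi> x + b * \<psi> x) = a * f \<phi> + b * f \<psi>" if "\<phi> \<in> schwartz" "\<psi> \<in> schwartz" for \<phi> \<psi> a b
  proof -
    have i: "integrable lborel (\<lambda>x. cis (c * x) * \<phi> x)" "integrable lborel (\<lambda>x. cis (c * x) * \<psi> x)" for c
      using integrable_cis_mult integrable_schwartz that by blast+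
    have "fourier (\<lambda>x. a * \<phi> x + b * \<psi> x) \<xi> = a * fourier \<phi> \<xi> + b * fourier \<psi> \<xi>" for \<xi>
    proof -
      have "fourier (\<lambda>x. a * \<phi> x + b * \<psi> x) \<xi> = (LINT x|lborel. a * (cis (- \<xi> * x) * \<phi> x) + b * (cis (- \<xi> * x) * \<psi> x))"
        unfolding fourier_eq by (intro Bochner_Integration.integral_cong) (auto simp: algebra_simps)
      also have "\<dots> = a * fourier \<phi> \<xi> + b * fourier \<psi> \<xi>"
        unfolding fourier_eq using i[of "- \<xi>"] by (subst Bochner_Integration.integral_add) auto
      finally show ?thesis .
    qed
    then have "f (\<lambda>x. a * \<phi> x + b * \<psi> x) = (LINT \<xi>|lborel. a * (g \<xi> * (fourier \<phi> (- \<xi>) / of_real (2 * pi)))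
        + b * (g \<xi> * (fourier \<psi> (- \<xi>) / of_real (2 * pi))))"
      unfolding f_def by (intro Bochner_Integration.integral_cong) (auto simp: field_simps)
    also have "\<dots> = a * f \<phi> + b * f \<psi>"
      unfolding f_def
      by (subst Bochner_Integration.integral_add, (intro integrable_mult_right int' that)+)
         (simp only: integral_mult_right_zero)
    finally show ?thesis .
  qed
  obtain W where W: "W \<ge> 0" "\<And>\<psi> \<xi>. \<psi> \<in> schwartz \<Longrightarrow> cmod (fourier \<psi> \<xi>) \<le> W * schwartz_norm 2 \<psi> * inverse (1 + \<xi>\<^sup>2)"
    by (rule fourier_schwartz_decay) (rule that)
  define W0 where "W0 = (LINT x|lborel. inverse (1 + (x::real)\<^sup>2))"
  have "cmod (f \<psi>) \<le> (W * W0) * schwartz_norm 2 \<psi>" if \<psi>: "\<psi> \<in> schwartz" for \<psi>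
  proof -
    have "cmod (f \<psi>) \<le> (LINT \<xi>|lborel. W * schwartz_norm 2 \<psi> * inverse (1 + \<xi>\<^sup>2))"
      unfolding f_def
    proof (rule norm_integral_le_integral)
      show "integrable lborel (\<lambda>\<xi>. W * schwartz_norm 2 \<psi> * inverse (1 + \<xi>\<^sup>2))"
        using integrable_inverse_1_plus_square' by simp
      fix \<xi> :: real
      have "cmod (fourier \<psi> (- \<xi>)) / (2 * pi) \<le> cmod (fourier \<psi> (- \<xi>)) / 1"
        using pi_ge_two by (intro divide_left_mono) auto
      then have "cmod (g \<xi>) * (cmod (fourier \<psi> (- \<xi>)) / (2 * pi)) \<le> 1 * cmod (fourier \<psi> (- \<xi>))"
        using bd by (intro mult_mono) auto
      also have "\<dots> \<le> W * schwartz_norm 2 \<psi> * inverse (1 + \<xi>\<^sup>2)" using W(2)[OF \<psi>, of "- \<xi>"] by simp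
      finally show "cmod (g \<xi> * (fourier \<psi> (- \<xi>) / of_real (2 * pi))) \<le> W * schwartz_norm 2 \<psi> * inverse (1 + \<xi>\<^sup>2)"
        by (simp add: norm_mult norm_divide)
    qed
    also have "\<dots> = (W * W0) * schwartz_norm 2 \<psi>" by (simp add: W0_def)
    finally show ?thesis .
  qed
  then have "tempered f" unfolding tempered_def using lin by blast
  moreover have "fourier_is_fun f g"
    unfolding fourier_is_fun_def f_def using int[OF integrable_schwartz] by (auto simp: fourier_fourier_schwartz)
  ultimately show ?thesis by (rule that)
qed

section \<open>Polynomials times modulated Gaussians as test functions\<close>

lemma power_mult_gaussian_le:
  fixes x :: real
  shows "\<bar>x\<bar> ^ i * exp (- x\<^sup>2 / 2) \<le> fact i * exp 1"
proof -
  have "\<bar>x\<bar> ^ i / fact i \<le> exp \<bar>x\<bar>"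
  proof -
    have sm: "summable (\<lambda>n. inverse (fact n) * \<bar>x\<bar> ^ n)" by (rule summable_exp)
    have "(\<Sum>n\<in>{i}. inverse (fact n) * \<bar>x\<bar> ^ n) \<le> (\<Sum>n. inverse (fact n) * \<bar>x\<bar> ^ n)"
      by (rule sum_le_suminf[OF sm]) auto
    then show ?thesis by (simp add: exp_def divide_inverse mult.commute)
  qed
  then have "\<bar>x\<bar> ^ i \<le> fact i * exp \<bar>x\<bar>" by (simp add: field_simps)
  then have "\<bar>x\<bar> ^ i * exp (- x\<^sup>2 / 2) \<le> fact i * exp \<bar>x\<bar> * exp (- x\<^sup>2 / 2)"
    by (intro mult_right_mono) auto
  also have "\<dots> = fact i * exp (\<bar>x\<bar> - x\<^sup>2 / 2)" by (simp add: exp_add[symmetric] mult.assoc)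
  also have "\<dots> \<le> fact i * exp 1"
  proof -
    have "0 \<le> (\<bar>x\<bar> - 1)\<^sup>2" by simp
    also have "\<dots> = x\<^sup>2 - 2 * \<bar>x\<bar> + 1" by (simp add: power2_eq_square algebra_simps flip: abs_mult)
    finally have "\<bar>x\<bar> - x\<^sup>2 / 2 \<le> 1" by linarith
    then show ?thesis by (intro mult_left_mono) auto
  qed
  finally show ?thesis .
qed

text \<open>Multiplication by \<open>x\<close> and differentiation only change \<open>p\<close>, so
  membership in \<open>schwartz\<close> reduces to boundedness. The modulation \<open>u\<close>
  turns pairings with these functions into characteristic functions.\<close>

definition modulated_gaussian :: "real \<Rightarrow> complex poly \<Rightarrow> real \<Rightarrow> complex" where
  "modulated_gaussian u p x = poly p (of_real x) * exp (\<i> * of_real u * of_real x - (of_real x)\<^sup>2 / 2)"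

lemma norm_modulated_gaussian: "cmod (modulated_gaussian u p x) = cmod (poly p (of_real x)) * exp (- x\<^sup>2 / 2)"
  by (simp add: modulated_gaussian_def norm_mult norm_exp_eq_Re power2_eq_square)

lemma modulated_gaussian_has_vector_derivative:
  "(modulated_gaussian u p has_vector_derivative
      modulated_gaussian u (pderiv p + p * [:\<i> * of_real u, - 1:]) x) (at x)"
proof -
  have "((\<lambda>z. poly p z * exp (\<i> * of_real u * z - z\<^sup>2 / 2)) has_field_derivative
      poly (pderiv p + p * [:\<i> * of_real u, - 1:]) (of_real x) * exp (\<i> * of_real u * of_real x - (of_real x)\<^sup>2 / 2)) (at (of_real x))"
    by (auto intro!: derivative_eq_intros simp: algebra_simps)
  from has_vector_derivative_real_field[OF this, of UNIV] show ?thesis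
    by (simp add: modulated_gaussian_def[abs_def])
qed

lemma nderiv_modulated_gaussian:
  "nderiv k (modulated_gaussian u p) =
     modulated_gaussian u (((\<lambda>p. pderiv p + p * [:\<i> * of_real u, - 1:]) ^^ k) p)"
proof (induction k)
  case (Suc k)
  have "nderiv (Suc k) (modulated_gaussian u p) = (\<lambda>x. vector_derivative (nderiv k (modulated_gaussian u p)) (at x))"
    by (simp add: nderiv_def)
  then show ?case
    unfolding Suc using vector_derivative_at[OF modulated_gaussian_has_vector_derivative] by (auto simp: fun_eq_iff)
qed simp

lemma bounded_modulated_gaussian: "bounded (range (modulated_gaussian u p))"
proof -
  have "cmod (modulated_gaussian u p x) \<le> (\<Sum>i\<le>degree p. cmod (coeff p i) * (fact i * exp 1))" for x
  proof -
    have "cmod (poly p (of_real x)) \<le> (\<Sum>i\<le>degree p. cmod (coeff p i) * \<bar>x\<bar> ^ i)"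
      unfolding poly_altdef by (rule order_trans[OF norm_sum]) (simp add: norm_mult norm_power)
    then have "cmod (modulated_gaussian u p x) \<le> (\<Sum>i\<le>degree p. cmod (coeff p i) * \<bar>x\<bar> ^ i) * exp (- x\<^sup>2 / 2)"
      unfolding norm_modulated_gaussian by (intro mult_right_mono) auto
    also have "\<dots> = (\<Sum>i\<le>degree p. cmod (coeff p i) * (\<bar>x\<bar> ^ i * exp (- x\<^sup>2 / 2)))"
      by (simp add: sum_distrib_right mult.assoc)
    also have "\<dots> \<le> (\<Sum>i\<le>degree p. cmod (coeff p i) * (fact i * exp 1))"
      by (intro sum_mono mult_left_mono power_mult_gaussian_le) auto
    finally show ?thesis .
  qed
  then show ?thesis by (auto simp: bounded_iff)
qed

lemma modulated_gaussian_schwartz: "modulated_gaussian u p \<in> schwartz"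
proof -
  have "nderiv k (modulated_gaussian u p) differentiable (at x)" for k x
    unfolding nderiv_modulated_gaussian using modulated_gaussian_has_vector_derivative differentiableI_vector by blast
  moreover have "bounded (range (\<lambda>x. x ^ j *\<^sub>R nderiv k (modulated_gaussian u p) x))" for j k
  proof -
    have "x ^ j *\<^sub>R modulated_gaussian u q x = modulated_gaussian u (monom 1 j * q) x" for q x
      by (simp add: modulated_gaussian_def poly_monom scaleR_conv_of_real)
    then show ?thesis unfolding nderiv_modulated_gaussian using bounded_modulated_gaussian by simp
  qed
  ultimately show ?thesis unfolding schwartz_def by blast
qed

text \<open>The positive and negative parts have equal Fourier transforms. At \<open>u = 0\<close>
  this gives equal mass \<open>m\<close>, so unless \<open>m\<close> is 0 they become, after
  normalization, densities of probability measures with the same characteristic function, and Levy's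
  uniqueness theorem applies.\<close>

lemma real_AE_zero_of_characteristic_zero:
  fixes p :: "real \<Rightarrow> real"
  assumes p: "integrable lborel p" and zero: "\<And>u. (LINT x|lborel. of_real (p x) * iexp (u * x)) = 0"
  shows "AE x in lborel. p x = 0"
proof -
  have [measurable]: "p \<in> borel_measurable borel" using p by auto
  define q where "q x = max 0 (p x)" for x
  define r where "r x = max 0 (- p x)" for x
  have pqr: "p x = q x - r x" for x by (simp add: q_def r_def max_def)
  have qr: "0 \<le> q x" "0 \<le> r x" for x by (auto simp: q_def r_def)
  have qr_meas[measurable]: "q \<in> borel_measurable borel" "r \<in> borel_measurable borel" unfolding q_def r_def by measurable
  have q_int: "integrable lborel q" and r_int: "integrable lborel r"
    by (rule Bochner_Integration.integrable_bound[OF p]; auto simp: q_def r_def)+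
  have ie: "integrable lborel (\<lambda>x. of_real (h x) * iexp (u * x))" if "integrable lborel h" for h :: "real \<Rightarrow> real" and u
    using integrable_cis_mult[of "\<lambda>x. complex_of_real (h x)" u] that by (simp add: cis_conv_exp mult.commute)
  have eq: "(LINT x|lborel. of_real (q x) * iexp (u * x)) = (LINT x|lborel. of_real (r x) * iexp (u * x))" for u
    using zero[of u] ie[OF q_int, of u] ie[OF r_int, of u] by (simp add: pqr left_diff_distrib)
  define m where "m = (LINT x|lborel. q x)"
  have m_r: "m = (LINT x|lborel. r x)"
    using eq[of 0] by (simp add: m_def)
  have m0: "m \<ge> 0" unfolding m_def by (rule Bochner_Integration.integral_nonneg) (rule qr)
  show ?thesis
  proof (cases "m = 0")
    case True
    have "AE x in lborel. q x = 0"
      using True integral_nonneg_eq_0_iff_AE[OF q_int] qr by (simp add: m_def)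
    moreover have "AE x in lborel. r x = 0"
      using True integral_nonneg_eq_0_iff_AE[OF r_int] qr by (simp add: m_r)
    ultimately show ?thesis by eventually_elim (simp add: pqr)
  next
    case False
    then have m: "m > 0" using m0 by simp
    have dist: "real_distribution (density lborel (\<lambda>x. ennreal (h x / m)))"
      if [measurable]: "h \<in> borel_measurable borel" and h: "integrable lborel h" "\<And>x. 0 \<le> h x" "(LINT x|lborel. h x) = m" for h
    proof -
      have "(\<integral>\<^sup>+x. ennreal (h x / m) \<partial>lborel) = ennreal (LINT x|lborel. h x / m)"
        using h m by (intro nn_integral_eq_integral) auto
      also have "\<dots> = 1" using h(3) m by simp
      finally have "(\<integral>\<^sup>+x. ennreal (h x / m) \<partial>lborel) = 1" .
      then have "prob_space (density lborel (\<lambda>x. ennreal (h x / m)))"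
        by (intro prob_spaceI) (simp add: emeasure_density)
      then show ?thesis by (simp add: real_distribution_def real_distribution_axioms_def)
    qed
    have char: "char (density lborel (\<lambda>x. ennreal (h x / m))) u = (LINT x|lborel. of_real (h x) * iexp (u * x)) / of_real m"
      if [measurable]: "h \<in> borel_measurable borel" and "\<And>x. 0 \<le> h x" for h u
      unfolding char_def using that m
      by (subst integral_density) (auto simp: scaleR_conv_of_real)
    have "density lborel (\<lambda>x. ennreal (q x / m)) = density lborel (\<lambda>x. ennreal (r x / m))"
    proof (rule Levy_uniqueness)
      show "char (density lborel (\<lambda>x. ennreal (q x / m))) = char (density lborel (\<lambda>x. ennreal (r x / m)))"
        by (rule ext) (simp only: char[OF qr_meas(1) qr(1)] char[OF qr_meas(2) qr(2)] eq)
    qed (auto intro!: dist qr q_int r_int simp: m_def[symmetric] m_r[symmetric])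
    then have "AE x in lborel. ennreal (q x / m) = ennreal (r x / m)"
      by (subst (asm) sigma_finite_measure.density_unique_iff[OF sigma_finite_lborel]) auto
    then show ?thesis
    proof eventually_elim
      fix x assume "ennreal (q x / m) = ennreal (r x / m)"
      then have "q x / m = r x / m" using qr m by (subst (asm) ennreal_inj) auto
      then show "p x = 0" using m by (simp add: pqr)
    qed
  qed
qed

text \<open>The transform of the conjugate of \<open>h\<close> vanishes too, by reflecting
  \<open>u\<close>, so the real-valued case applies to both the real and the imaginary part.\<close>

lemma AE_zero_of_characteristic_zero:
  fixes h :: "real \<Rightarrow> complex"
  assumes h: "integrable lborel h" and zero: "\<And>u. (LINT x|lborel. h x * iexp (u * x)) = 0"
  shows "AE x in lborel. h x = 0"
proof -
  have i: "integrable lborel (\<lambda>x. h x * iexp (u * x))" for u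
    using integrable_cis_mult[OF h, of u] by (simp add: cis_conv_exp mult.commute)
  have i': "integrable lborel (\<lambda>x. cnj (h x) * iexp (u * x))" for u
    using integrable_cis_mult[of "\<lambda>x. cnj (h x)" u] h by (simp add: cis_conv_exp mult.commute)
  have zero': "(LINT x|lborel. cnj (h x) * iexp (u * x)) = 0" for u
  proof -
    have "(LINT x|lborel. cnj (h x) * iexp (u * x)) = (LINT x|lborel. cnj (h x * iexp (- u * x)))"
      by (simp add: exp_cnj)
    also have "\<dots> = cnj (LINT x|lborel. h x * iexp (- u * x))" by (rule Bochner_Integration.integral_cnj)
    also have "\<dots> = 0" by (simp only: zero complex_cnj_zero)
    finally show ?thesis .
  qed
  have "AE x in lborel. Re (h x) = 0"
  proof (rule real_AE_zero_of_characteristic_zero)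
    fix u
    have "(LINT x|lborel. of_real (Re (h x)) * iexp (u * x)) = (LINT x|lborel. (h x * iexp (u * x) + cnj (h x) * iexp (u * x)) / 2)"
      by (intro Bochner_Integration.integral_cong) (auto simp: distrib_right[symmetric] complex_add_cnj)
    also have "\<dots> = 0" using i[of u] i'[of u] zero[of u] zero'[of u] by simp
    finally show "(LINT x|lborel. of_real (Re (h x)) * iexp (u * x)) = 0" .
  qed (use h in auto)
  moreover have "AE x in lborel. Im (h x) = 0"
  proof (rule real_AE_zero_of_characteristic_zero)
    fix u
    have "(LINT x|lborel. of_real (Im (h x)) * iexp (u * x)) = (LINT x|lborel. (h x * iexp (u * x) - cnj (h x) * iexp (u * x)) / (2 * \<i>))"
    proof (rule Bochner_Integration.integral_cong[OF refl])
      fix x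
      have "(h x - cnj (h x)) / (2 * \<i>) = of_real (Im (h x))"
        by (simp add: complex_diff_cnj mult.commute[of _ \<i>])
      then have "of_real (Im (h x)) * iexp (u * x) = (h x - cnj (h x)) / (2 * \<i>) * iexp (u * x)" by (simp only:)
      then show "of_real (Im (h x)) * iexp (u * x) = (h x * iexp (u * x) - cnj (h x) * iexp (u * x)) / (2 * \<i>)"
        by (simp only: left_diff_distrib times_divide_eq_left)
    qed
    also have "\<dots> = 0" using i[of u] i'[of u] zero[of u] zero'[of u] by simp
    finally show "(LINT x|lborel. of_real (Im (h x)) * iexp (u * x)) = 0" .
  qed (use h in auto)
  ultimately show ?thesis by eventually_elim (simp add: complex_eq_iff)
qed

text \<open>Multiplication by a Gaussian makes \<open>g - g'\<close> integrable, the modulations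
  make the characteristic function of the product vanish, and the Gaussian has no zeros. As
  \<open>fhat\<close> is chosen by \<open>SOME\<close>, this is what identifies it with a prescribed
  function.\<close>

lemma fourier_is_fun_unique:
  assumes "fourier_is_fun f g" "fourier_is_fun f g'"
  shows "AE \<xi> in lborel. g \<xi> = g' \<xi>"
proof -
  define w where "w = (\<lambda>x::real. exp (- (complex_of_real x)\<^sup>2 / 2))"
  have mg: "modulated_gaussian u 1 x = w x * iexp (u * x)" for u x
    by (simp add: modulated_gaussian_def w_def exp_add[symmetric] mult_ac)
  have int: "integrable lborel (\<lambda>\<xi>. g \<xi> * modulated_gaussian u 1 \<xi>)" "integrable lborel (\<lambda>\<xi>. g' \<xi> * modulated_gaussian u 1 \<xi>)"
    and eq: "(LINT \<xi>|lborel. g \<xi> * modulated_gaussian u 1 \<xi>) = (LINT \<xi>|lborel. g' \<xi> * modulated_gaussian u 1 \<xi>)" for u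
    using assms modulated_gaussian_schwartz[of u 1] unfolding fourier_is_fun_def by metis+
  define h where "h \<xi> = (g \<xi> - g' \<xi>) * w \<xi>" for \<xi>
  have hm: "h \<xi> * iexp (u * \<xi>) = g \<xi> * modulated_gaussian u 1 \<xi> - g' \<xi> * modulated_gaussian u 1 \<xi>" for u \<xi>
    by (simp add: h_def mg algebra_simps)
  have "integrable lborel h"
    using Bochner_Integration.integrable_diff[OF int(1)[of 0] int(2)[of 0]] unfolding hm[symmetric] by simp
  moreover have "(LINT \<xi>|lborel. h \<xi> * iexp (u * \<xi>)) = 0" for u
    unfolding hm using int[of u] eq[of u] by simp
  ultimately have "AE \<xi> in lborel. h \<xi> = 0" by (rule AE_zero_of_characteristic_zero)
  then show ?thesis by eventually_elim (simp add: h_def w_def)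
qed

lemma fhat_AE_eq:
  assumes "fourier_is_fun f g"
  shows "AE \<xi> in lborel. fhat f \<xi> = g \<xi>" "fhat f \<in> borel_measurable borel"
proof -
  have f: "fourier_is_fun f (fhat f)" unfolding fhat_def by (rule someI[of "fourier_is_fun f", OF assms])
  show "AE \<xi> in lborel. fhat f \<xi> = g \<xi>" by (rule fourier_is_fun_unique[OF f assms])
  show "fhat f \<in> borel_measurable borel" using f by (simp add: fourier_is_fun_def)
qed

section \<open>Combs of frequencies\<close>

text \<open>Starting at \<open>L\<close> keeps all \<open>L\<close> teeth between
  \<open>2 * L * R\<close> and \<open>4 * L * R\<close>, so the whole comb has a single frequency
  scale.\<close>

definition comb :: "real \<Rightarrow> nat \<Rightarrow> real set" where
  "comb R L = (\<Union>l\<in>{L..<2 * L}. {(2 * real l + 1) * R..(2 * real l + 1) * R + 1})"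

definition comb_osc :: "real \<Rightarrow> nat \<Rightarrow> real \<Rightarrow> real \<Rightarrow> complex" where
  "comb_osc R L y t = (\<Sum>l\<in>{L..<2 * L}.
     integral {(2 * real l + 1) * R..(2 * real l + 1) * R + 1} (\<lambda>\<xi>. cis (y * \<xi> + t * \<xi>\<^sup>2)))"

lemma comb_borel[measurable]: "comb R L \<in> sets borel"
  unfolding comb_def by measurable

lemma comb_tooth_bounds:
  assumes "R \<ge> 1" "l \<in> {L..<2 * L}" "\<xi> \<in> {(2 * real l + 1) * R..(2 * real l + 1) * R + 1}"
  shows "2 * real L * R \<le> \<xi>" "\<xi> \<le> 4 * real L * R"
proof -
  have l: "real L \<le> real l" "real l + 1 \<le> 2 * real L" using assms(2) by auto
  have "2 * real L * R \<le> (2 * real l + 1) * R" using l assms(1) by (intro mult_right_mono) auto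
  then show "2 * real L * R \<le> \<xi>" using assms(3) by simp
  have "\<xi> \<le> (2 * real l + 1) * R + 1 * R" using assms by auto
  also have "\<dots> = (2 * (real l + 1)) * R" by (simp add: algebra_simps)
  also have "\<dots> \<le> (2 * (2 * real L)) * R" using l assms(1) by (intro mult_right_mono) auto
  finally show "\<xi> \<le> 4 * real L * R" by simp
qed

lemma comb_bounds:
  assumes "R \<ge> 1" "\<xi> \<in> comb R L"
  shows "2 * real L * R \<le> \<xi>" "\<xi> \<le> 4 * real L * R"
  using assms comb_tooth_bounds[of R _ L \<xi>] unfolding comb_def by blast+

lemma indicator_comb:
  assumes "R \<ge> 1"
  shows "indicator (comb R L) \<xi> = (\<Sum>l\<in>{L..<2 * L}. indicator {(2 * real l + 1) * R..(2 * real l + 1) * R + 1} \<xi> :: real)"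
  unfolding comb_def
proof (rule indicator_UN_disjoint)
  have "l = l'" if "\<xi> \<in> {(2 * real l + 1) * R..(2 * real l + 1) * R + 1}" "\<xi> \<in> {(2 * real l' + 1) * R..(2 * real l' + 1) * R + 1}"
    for l l' :: nat and \<xi>
  proof -
    have "\<not> l < l'" if "\<xi> \<in> {(2 * real l + 1) * R..(2 * real l + 1) * R + 1}" "\<xi> \<in> {(2 * real l' + 1) * R..(2 * real l' + 1) * R + 1}"
      for l l' :: nat
    proof
      assume "l < l'"
      then have "(2 * (real l + 1) + 1) * R \<le> (2 * real l' + 1) * R" using assms by (intro mult_right_mono) auto
      then have "(2 * real l + 1) * R + 2 * R \<le> \<xi>" using that by (simp add: algebra_simps)
      then show False using that assms by auto
    qed
    then show ?thesis using that by (meson linorder_neqE_nat)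
  qed
  then show "disjoint_family_on (\<lambda>l. {(2 * real l + 1) * R..(2 * real l + 1) * R + 1}) {L..<2 * L}"
    unfolding disjoint_family_on_def by blast
qed simp

lemma set_integrable_cis_quadratic: "set_integrable lborel {p..q} (\<lambda>\<xi>. cis (y * \<xi> + t * \<xi>\<^sup>2))"
  by (intro borel_integrable_atLeastAtMost' continuous_intros)

lemma comb_osc_eq:
  assumes R: "R \<ge> 1"
  shows "set_integrable lborel (comb R L) (\<lambda>\<xi>. cis (y * \<xi> + t * \<xi>\<^sup>2))"
    and "(LINT \<xi>:comb R L|lborel. cis (y * \<xi> + t * \<xi>\<^sup>2)) = comb_osc R L y t"
proof -
  let ?J = "\<lambda>l. {(2 * real l + 1) * R..(2 * real l + 1) * R + 1}" and ?c = "\<lambda>\<xi>. cis (y * \<xi> + t * \<xi>\<^sup>2)"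
  have i: "integrable lborel (\<lambda>\<xi>. indicator (?J l) \<xi> *\<^sub>R ?c \<xi>)" for l
    using set_integrable_cis_quadratic unfolding set_integrable_def .
  show "set_integrable lborel (comb R L) ?c"
    unfolding set_integrable_def indicator_comb[OF R] scaleR_sum_left by (intro Bochner_Integration.integrable_sum i)
  have "(LINT \<xi>:comb R L|lborel. ?c \<xi>) = (\<Sum>l\<in>{L..<2 * L}. LINT \<xi>:?J l|lborel. ?c \<xi>)"
    unfolding set_lebesgue_integral_def indicator_comb[OF R] scaleR_sum_left
    by (rule Bochner_Integration.integral_sum) (rule i)
  also have "\<dots> = comb_osc R L y t"
    unfolding comb_osc_def by (intro sum.cong refl set_borel_integral_eq_integral(2) set_integrable_cis_quadratic)
  finally show "(LINT \<xi>:comb R L|lborel. ?c \<xi>) = comb_osc R L y t" .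
qed

lemma emeasure_comb_le: "R \<ge> 1 \<Longrightarrow> emeasure lborel (comb R L) \<le> ennreal (real L)"
proof -
  have "emeasure lborel (comb R L) \<le> (\<Sum>l\<in>{L..<2 * L}. emeasure lborel {(2 * real l + 1) * R..(2 * real l + 1) * R + 1})"
    unfolding comb_def by (rule emeasure_subadditive_finite) auto
  also have "\<dots> = ennreal (real L)" by (simp add: ennreal_of_nat_eq_real_of_nat)
  finally show ?thesis .
qed

text \<open>The phase derivative is at least \<open>4 * t * L * R\<close> on every tooth, so a tooth
  contributes at most \<open>1 / (t * L * R)\<close> and the number of teeth cancels. This is the
  dispersion of combs far above the one under consideration.\<close>

lemma norm_comb_osc_le:
  assumes R: "R \<ge> 1" and L: "L \<ge> 1" and y: "y \<ge> 0" and t: "t > 0"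
  shows "cmod (comb_osc R L y t) \<le> 1 / (t * R)"
proof -
  have "cmod (comb_osc R L y t) \<le> (\<Sum>l\<in>{L..<2 * L}. 4 / (4 * t * (real L * R)))"
    unfolding comb_osc_def
  proof (rule sum_norm_le)
    fix l assume l: "l \<in> {L..<2 * L}"
    show "cmod (integral {(2 * real l + 1) * R..(2 * real l + 1) * R + 1} (\<lambda>\<xi>. cis (y * \<xi> + t * \<xi>\<^sup>2))) \<le> 4 / (4 * t * (real L * R))"
    proof (rule osc_first)
      show "0 < 4 * t * (real L * R)" using t R L by simp
      fix \<xi> assume "\<xi> \<in> {(2 * real l + 1) * R..(2 * real l + 1) * R + 1}"
      from comb_tooth_bounds(1)[OF R l this] have "2 * t * (2 * real L * R) \<le> 2 * t * \<xi>"
        using t by (intro mult_left_mono) auto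
      then have "4 * t * (real L * R) \<le> 2 * t * \<xi>" by (simp add: mult_ac)
      then show "4 * t * (real L * R) \<le> \<bar>y + 2 * t * \<xi>\<bar>" using y by linarith
    qed simp
  qed
  also have "\<dots> = 1 / (t * R)" using L t R by simp
  finally show ?thesis .
qed

text \<open>The Lipschitz bound for \<open>cis\<close> at frequencies up to
  \<open>4 * L * R\<close>, summed over the teeth. It serves combs far below the one under
  consideration, which hardly distinguish the two times.\<close>

lemma norm_comb_osc_diff_le:
  assumes R: "R \<ge> 1"
  shows "cmod (comb_osc R L y t - comb_osc R L y' t') \<le> real L * (\<bar>y - y'\<bar> * (4 * real L * R) + \<bar>t - t'\<bar> * (4 * real L * R)\<^sup>2)"
proof -
  define B where "B = \<bar>y - y'\<bar> * (4 * real L * R) + \<bar>t - t'\<bar> * (4 * real L * R)\<^sup>2"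
  have "cmod (comb_osc R L y t - comb_osc R L y' t') \<le> (\<Sum>l\<in>{L..<2 * L}. B)"
    unfolding comb_osc_def sum_subtractf[symmetric]
  proof (rule sum_norm_le)
    fix l assume l: "l \<in> {L..<2 * L}"
    let ?J = "{(2 * real l + 1) * R..(2 * real l + 1) * R + 1}"
    have i: "(\<lambda>\<xi>. cis (y * \<xi> + t * \<xi>\<^sup>2)) integrable_on ?J" for y t
      by (intro integrable_continuous_real continuous_intros)
    have "cmod (integral ?J (\<lambda>\<xi>. cis (y * \<xi> + t * \<xi>\<^sup>2)) - integral ?J (\<lambda>\<xi>. cis (y' * \<xi> + t' * \<xi>\<^sup>2)))
        = cmod (integral ?J (\<lambda>\<xi>. cis (y * \<xi> + t * \<xi>\<^sup>2) - cis (y' * \<xi> + t' * \<xi>\<^sup>2)))"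
      by (subst Henstock_Kurzweil_Integration.integral_diff[OF i i]) simp
    also have "\<dots> \<le> integral ?J (\<lambda>_. B)"
    proof (rule Henstock_Kurzweil_Integration.integral_norm_bound_integral)
      fix \<xi> assume \<xi>: "\<xi> \<in> ?J"
      have b: "2 * real L * R \<le> \<xi>" "\<xi> \<le> 4 * real L * R" using comb_tooth_bounds[OF R l \<xi>] by auto
      have \<xi>0: "0 \<le> \<xi>" using b(1) R by (intro order_trans[OF _ b(1)]) auto
      define d where "d = (y - y') * \<xi> + (t - t') * \<xi>\<^sup>2"
      have "cis (y * \<xi> + t * \<xi>\<^sup>2) - cis (y' * \<xi> + t' * \<xi>\<^sup>2) = cis (y' * \<xi> + t' * \<xi>\<^sup>2) * (cis d - 1)"
        by (simp add: d_def algebra_simps cis_mult)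
      then have "cmod (cis (y * \<xi> + t * \<xi>\<^sup>2) - cis (y' * \<xi> + t' * \<xi>\<^sup>2)) \<le> \<bar>d\<bar>"
        by (simp add: norm_mult norm_cis_minus_one_le)
      also have "\<dots> \<le> \<bar>y - y'\<bar> * \<xi> + \<bar>t - t'\<bar> * \<xi>\<^sup>2"
        unfolding d_def using \<xi>0 by (intro order_trans[OF abs_triangle_ineq]) (simp add: abs_mult)
      also have "\<dots> \<le> B" unfolding B_def using b \<xi>0 by (intro add_mono mult_left_mono power_mono) auto
      finally show "cmod (cis (y * \<xi> + t * \<xi>\<^sup>2) - cis (y' * \<xi> + t' * \<xi>\<^sup>2)) \<le> B" .
    qed (intro integrable_continuous_real continuous_intros)+
    also have "\<dots> = B" by simp
    finally show "cmod (integral ?J (\<lambda>\<xi>. cis (y * \<xi> + t * \<xi>\<^sup>2)) - integral ?J (\<lambda>\<xi>. cis (y' * \<xi> + t' * \<xi>\<^sup>2))) \<le> B" .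
  qed
  then show ?thesis by (simp add: B_def)
qed

text \<open>All teeth of the comb sit at odd multiples of \<open>R\<close>, so they are in phase at the times at which
  \<open>y * R\<close> is an integer multiple of \<open>pi\<close>, with a sign given by the parity of this integer.\<close>

lemma comb_osc_aligned:
  fixes m :: int
  assumes R: "R \<ge> 1" and y: "0 \<le> y" "y \<le> 1" "y * R = of_int m * pi"
    and t: "0 \<le> t" "t * (4 * real L * R)\<^sup>2 \<le> 1 / 8"
  shows "real L * (3 / 8) \<le> (if even m then 1 else - 1) * Re (comb_osc R L y t)"
proof -
  define e :: real where "e = (if even m then 1 else - 1)"
  have "(\<Sum>l\<in>{L..<2 * L}. 3 / 8) \<le> (\<Sum>l\<in>{L..<2 * L}. e * Re (integral {(2 * real l + 1) * R..(2 * real l + 1) * R + 1} (\<lambda>\<xi>. cis (y * \<xi> + t * \<xi>\<^sup>2))))"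
  proof (rule sum_mono)
    fix l assume l: "l \<in> {L..<2 * L}"
    let ?J = "{(2 * real l + 1) * R..(2 * real l + 1) * R + 1}"
    have i: "(\<lambda>\<xi>. cis (y * \<xi> + t * \<xi>\<^sup>2)) integrable_on ?J"
      by (intro integrable_continuous_real continuous_intros)
    have iRe: "(\<lambda>\<xi>. Re (cis (y * \<xi> + t * \<xi>\<^sup>2))) integrable_on ?J"
      by (intro integrable_continuous_real continuous_intros)
    have "3 / 8 = integral ?J (\<lambda>_. 3 / 8)" by simp
    also have "\<dots> \<le> integral ?J (\<lambda>\<xi>. e * Re (cis (y * \<xi> + t * \<xi>\<^sup>2)))"
    proof (rule Henstock_Kurzweil_Integration.integral_le)
      fix \<xi> assume \<xi>: "\<xi> \<in> ?J"
      have b: "2 * real L * R \<le> \<xi>" "\<xi> \<le> 4 * real L * R" using comb_tooth_bounds[OF R l \<xi>] by auto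
      have \<xi>0: "0 \<le> \<xi>" using b(1) R by (intro order_trans[OF _ b(1)]) auto
      define \<eta> where "\<eta> = \<xi> - (2 * real l + 1) * R"
      have \<eta>: "0 \<le> \<eta>" "\<eta> \<le> 1" using \<xi> by (auto simp: \<eta>_def)
      \<comment> \<open>The factor \<open>2 * l + 1\<close> is odd, so
        \<open>(2 * l + 1) * m\<close> has the parity of \<open>m\<close> for every tooth.\<close>
      have "y * \<xi> = (2 * real l + 1) * (y * R) + y * \<eta>" by (simp add: \<eta>_def algebra_simps)
      also have "\<dots> = y * \<eta> + pi * of_int ((2 * int l + 1) * m)" unfolding y(3) by simp
      finally have yx: "y * \<xi> = y * \<eta> + pi * of_int ((2 * int l + 1) * m)" .
      have "cos (y * \<xi>) = cos (y * \<eta>) * (if even ((2 * int l + 1) * m) then 1 else - 1)"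
        unfolding yx cos_add sin_npi_int cos_npi_int by simp
      also have "\<dots> = cos (y * \<eta>) * e" by (simp add: e_def)
      finally have c1: "e * cos (y * \<xi>) = cos (y * \<eta>)" by (simp add: e_def)
      \<comment> \<open>Within a tooth the linear phase moves by at most \<open>1\<close>, which is
        below \<open>pi / 3\<close>, leaving a cosine of at least \<open>1 / 2\<close>; the
        quadratic phase takes away at most \<open>1 / 8\<close>, whence
        \<open>3 / 8\<close>.\<close>
      have "cos (pi / 3) \<le> cos (y * \<eta>)"
      proof (rule cos_monotone_0_pi_le)
        have "y * \<eta> \<le> 1 * 1" using y \<eta> by (intro mult_mono) auto
        then show "y * \<eta> \<le> pi / 3" using pi_gt3 by simp
      qed (use y \<eta> in auto)
      then have c2: "1 / 2 \<le> e * cos (y * \<xi>)" unfolding c1 by (simp add: cos_60)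
      have "\<bar>Re (cis (y * \<xi> + t * \<xi>\<^sup>2) - cis (y * \<xi>))\<bar> \<le> cmod (cis (y * \<xi>) * (cis (t * \<xi>\<^sup>2) - 1))"
        by (rule order_trans[OF abs_Re_le_cmod]) (simp add: algebra_simps cis_mult)
      also have "\<dots> \<le> \<bar>t * \<xi>\<^sup>2\<bar>" by (simp add: norm_mult norm_cis_minus_one_le)
      also have "\<dots> = t * \<xi>\<^sup>2" using t by simp
      also have "\<dots> \<le> t * (4 * real L * R)\<^sup>2" using t \<xi>0 b by (intro mult_left_mono power_mono) auto
      also have "\<dots> \<le> 1 / 8" by (rule t)
      finally have "\<bar>cos (y * \<xi> + t * \<xi>\<^sup>2) - cos (y * \<xi>)\<bar> \<le> 1 / 8" by simp
      then have "\<bar>e * cos (y * \<xi> + t * \<xi>\<^sup>2) - e * cos (y * \<xi>)\<bar> \<le> 1 / 8" by (auto simp: e_def abs_minus_commute)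
      then show "3 / 8 \<le> e * Re (cis (y * \<xi> + t * \<xi>\<^sup>2))"
        using c2 unfolding cis.sel by linarith
    qed (intro integrable_continuous_real continuous_intros)+
    also have "\<dots> = e * integral ?J (\<lambda>\<xi>. Re (cis (y * \<xi> + t * \<xi>\<^sup>2)))" by (rule integral_mult_right)
    also have "integral ?J (\<lambda>\<xi>. Re (cis (y * \<xi> + t * \<xi>\<^sup>2))) = Re (integral ?J (\<lambda>\<xi>. cis (y * \<xi> + t * \<xi>\<^sup>2)))"
      using integral_linear[OF i bounded_linear_Re] by (simp add: o_def)
    finally show "3 / 8 \<le> e * Re (integral ?J (\<lambda>\<xi>. cis (y * \<xi> + t * \<xi>\<^sup>2)))" .
  qed
  then show ?thesis by (simp add: comb_osc_def e_def sum_distrib_left sum_negf)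
qed

section \<open>Failure of convergence below the critical exponent\<close>

definition power_curve :: "real \<Rightarrow> real \<times> real \<Rightarrow> real" where
  "power_curve \<alpha> = (\<lambda>(x, t). x + \<bar>t\<bar> powr \<alpha>)"

text \<open>The Hoelder bound in time is the subadditivity of the power
  \<open>\<alpha> \<le> 1\<close>, applied in both directions.\<close>

lemma admissible_power_curve:
  assumes alpha: "0 < \<alpha>" "\<alpha> \<le> 1 / 4"
  shows "admissible_curve \<alpha> (power_curve \<alpha>)"
proof -
  have pw: "\<bar>\<bar>t\<bar> powr \<alpha> - \<bar>t'\<bar> powr \<alpha>\<bar> \<le> \<bar>t - t'\<bar> powr \<alpha>" for t t' :: real
  proof -
    have sub: "(u + v) powr \<alpha> \<le> u powr \<alpha> + v powr \<alpha>" if "u \<ge> 0" "v \<ge> 0" for u v :: real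
    proof (cases "u + v = 0")
      case False
      then have uv: "u + v > 0" using that by simp
      \<comment> \<open>A number in the unit interval does not exceed its power
        \<open>\<alpha> \<le> 1\<close>; the fractions \<open>u / (u + v)\<close> and
        \<open>v / (u + v)\<close> add up to 1.\<close>
      have h: "w / (u + v) \<le> (w / (u + v)) powr \<alpha>" if "0 \<le> w" "w \<le> u + v" for w
      proof (cases "w = 0")
        case False
        then have "(w / (u + v)) powr 1 \<le> (w / (u + v)) powr \<alpha>" using that uv alpha by (intro powr_mono') auto
        then show ?thesis using that uv by simp
      qed simp
      have "1 = u / (u + v) + v / (u + v)" using uv by (simp add: add_divide_distrib[symmetric])
      also have "\<dots> \<le> (u / (u + v)) powr \<alpha> + (v / (u + v)) powr \<alpha>" using that by (intro add_mono h) auto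
      also have "\<dots> = (u powr \<alpha> + v powr \<alpha>) / (u + v) powr \<alpha>" using that uv by (simp add: powr_divide add_divide_distrib)
      finally show ?thesis using uv by (simp add: field_simps)
    qed (use that in auto)
    have one: "\<bar>s\<bar> powr \<alpha> \<le> \<bar>s'\<bar> powr \<alpha> + \<bar>s - s'\<bar> powr \<alpha>" for s s' :: real
    proof -
      have "\<bar>s\<bar> powr \<alpha> \<le> (\<bar>s'\<bar> + \<bar>s - s'\<bar>) powr \<alpha>" using alpha by (intro powr_mono2) auto
      also have "\<dots> \<le> \<bar>s'\<bar> powr \<alpha> + \<bar>s - s'\<bar> powr \<alpha>" by (rule sub) auto
      finally show ?thesis .
    qed
    show ?thesis using one[of t t'] one[of t' t] by (simp add: abs_minus_commute abs_le_iff)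
  qed
  have "continuous_on (UNIV \<times> {-1..1}) (power_curve \<alpha>)"
    unfolding power_curve_def case_prod_beta' using alpha by (intro continuous_intros continuous_on_powr') auto
  moreover have "\<exists>C1>0. \<exists>C2>0. \<forall>t\<in>{-1..1}. \<forall>x x'. 1 / C1 * \<bar>x - x'\<bar> \<le> \<bar>power_curve \<alpha> (x, t) - power_curve \<alpha> (x', t)\<bar> \<and>
      \<bar>power_curve \<alpha> (x, t) - power_curve \<alpha> (x', t)\<bar> \<le> C2 * \<bar>x - x'\<bar>"
    by (intro exI[of _ "1::real"] conjI) (auto simp: power_curve_def)
  moreover have "\<exists>C3>0. \<forall>x. \<forall>t\<in>{-1..1}. \<forall>t'\<in>{-1..1}. \<bar>power_curve \<alpha> (x, t) - power_curve \<alpha> (x, t')\<bar> \<le> C3 * \<bar>t - t'\<bar> powr \<alpha>"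
    by (intro exI[of _ 1]) (use pw in \<open>auto simp: power_curve_def\<close>)
  ultimately show ?thesis by (auto simp: admissible_curve_def power_curve_def)
qed

text \<open>With \<open>t\<close> of size \<open>R k powr (- 1 / \<alpha>)\<close>, the condition \<open>coarse\<close> says that the blocks of lower frequency barely
  change in time, and \<open>fine\<close> that the blocks of higher frequency have already dispersed.\<close>

locale lacunary_combs =
  fixes \<alpha> \<delta> :: real and R :: "nat \<Rightarrow> real" and L :: "nat \<Rightarrow> nat" and a :: "nat \<Rightarrow> real" and \<Lambda> :: real
  assumes alpha: "0 < \<alpha>" "\<alpha> \<le> 1 / 4" and delta: "0 \<le> \<delta>" "\<delta> < \<alpha>"
    and \<Lambda>: "\<Lambda> = (5 * pi) powr (1 / \<alpha>)"
    and R_large: "10 * pi \<le> R k" "real k \<le> R k"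
    and L_pos: "1 \<le> L k"
    and a_eq: "a k = (real k + 1) / (real (L k) * R k powr (\<delta> / \<alpha>))"
    and a_le: "a k \<le> 1"
    and phase: "\<Lambda> * R k powr (- 1 / \<alpha>) * (4 * real (L k) * R k)\<^sup>2 \<le> 1 / 8"
    and coarse: "j < k \<Longrightarrow> (real k + 1) * (a j * (real (L j) * (pi / R k * (4 * real (L j) * R j)
          + \<Lambda> * R k powr (- 1 / \<alpha>) * (4 * real (L j) * R j)\<^sup>2))) \<le> R k powr (- \<delta> / \<alpha>)"
    and fine: "j < k \<Longrightarrow> a k * (2 * R j powr (1 / \<alpha>) / R k) \<le> (1 / 2) ^ k * R j powr (- \<delta> / \<alpha>)"
    and separated: "j < k \<Longrightarrow> 4 * real (L j) * R j \<le> real (L k) * R k"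
begin

section \<open>The superposition of combs and its evolution\<close>

lemma R_ge: "R k \<ge> 30" using R_large(1)[of k] pi_gt3 by linarith

lemma R_ge_1: "R k \<ge> 1" using R_ge[of k] by linarith

lemma R_pos: "R k > 0" using R_ge[of k] by linarith

lemma a_pos: "a k > 0"
  unfolding a_eq using L_pos[of k] R_pos[of k] by (intro divide_pos_pos mult_pos_pos) auto

text \<open>At each frequency at most one term of the series is nonzero, since
  \<open>separated\<close> makes the combs disjoint.\<close>

definition g :: "real \<Rightarrow> complex" where
  "g \<xi> = (\<Sum>k. of_real (a k) * indicator (comb (R k) (L k)) \<xi>)"

lemma comb_disjoint:
  assumes "\<xi> \<in> comb (R j) (L j)" "\<xi> \<in> comb (R k) (L k)"
  shows "j = k"
proof -
  have False if "j < k" "\<xi> \<in> comb (R j) (L j)" "\<xi> \<in> comb (R k) (L k)" for j k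
  proof -
    have "2 * real (L k) * R k \<le> real (L k) * R k"
      using comb_bounds[OF R_ge_1 that(2)] comb_bounds[OF R_ge_1 that(3)] separated[OF that(1)] by linarith
    moreover have "0 < real (L k) * R k" using L_pos[of k] R_pos[of k] by simp
    ultimately show False by linarith
  qed
  then show ?thesis using assms by (meson linorder_neqE_nat)
qed

lemma g_on_comb:
  assumes "\<xi> \<in> comb (R k) (L k)"
  shows "g \<xi> = of_real (a k)"
proof -
  have "g \<xi> = (\<Sum>i\<in>{k}. of_real (a i) * indicator (comb (R i) (L i)) \<xi>)"
    unfolding g_def using comb_disjoint[OF assms] by (intro suminf_finite) (auto simp: indicator_def)
  then show ?thesis using assms by simp
qed

lemma g_off_comb:
  assumes "\<And>k. \<xi> \<notin> comb (R k) (L k)"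
  shows "g \<xi> = 0"
  unfolding g_def using assms by simp

lemma norm_g_le: "cmod (g \<xi>) \<le> 1"
  using g_on_comb[of \<xi>] g_off_comb[of \<xi>] a_pos a_le by (cases "\<exists>k. \<xi> \<in> comb (R k) (L k)") (auto simp: abs_of_pos)

lemma g_measurable[measurable]: "g \<in> borel_measurable borel"
  unfolding g_def by measurable

lemma integrable_weighted_g:
  assumes "0 \<le> \<sigma>" and sob: "\<And>k. (a k)\<^sup>2 * real (L k) * (1 + (4 * real (L k) * R k)\<^sup>2) powr \<sigma> \<le> (1 / 2) ^ k"
  shows "integrable lborel (\<lambda>\<xi>. (1 + \<xi>\<^sup>2) powr \<sigma> * (cmod (g \<xi>))\<^sup>2)"
proof (rule integrableI_bounded)
  define c where "c k = (a k)\<^sup>2 * (1 + (4 * real (L k) * R k)\<^sup>2) powr \<sigma>" for k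
  have c0: "c k \<ge> 0" for k by (simp add: c_def)
  have "ennreal (norm ((1 + \<xi>\<^sup>2) powr \<sigma> * (cmod (g \<xi>))\<^sup>2)) \<le> (\<Sum>k. ennreal (c k) * indicator (comb (R k) (L k)) \<xi>)" for \<xi>
  proof (cases "\<exists>k. \<xi> \<in> comb (R k) (L k)")
    case True
    then obtain k where k: "\<xi> \<in> comb (R k) (L k)" by blast
    note b = comb_bounds[OF R_ge_1 k]
    have "0 \<le> \<xi>" using b(1) R_pos[of k] by (intro order_trans[OF _ b(1)]) auto
    then have "(1 + \<xi>\<^sup>2) powr \<sigma> \<le> (1 + (4 * real (L k) * R k)\<^sup>2) powr \<sigma>"
      using b assms(1) by (intro powr_mono2 add_left_mono power_mono) auto
    then have "(1 + \<xi>\<^sup>2) powr \<sigma> * (cmod (g \<xi>))\<^sup>2 \<le> c k"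
      unfolding g_on_comb[OF k] c_def by (simp add: mult.commute mult_left_mono)
    then have "ennreal (norm ((1 + \<xi>\<^sup>2) powr \<sigma> * (cmod (g \<xi>))\<^sup>2)) \<le> (\<Sum>i\<in>{k}. ennreal (c i) * indicator (comb (R i) (L i)) \<xi>)"
      using k by (simp add: ennreal_leI)
    also have "\<dots> \<le> (\<Sum>k. ennreal (c k) * indicator (comb (R k) (L k)) \<xi>)" by (rule sum_le_suminf) auto
    finally show ?thesis .
  next
    case False
    then show ?thesis using g_off_comb[of \<xi>] by simp
  qed
  then have "(\<integral>\<^sup>+\<xi>. ennreal (norm ((1 + \<xi>\<^sup>2) powr \<sigma> * (cmod (g \<xi>))\<^sup>2)) \<partial>lborel)
      \<le> (\<integral>\<^sup>+\<xi>. (\<Sum>k. ennreal (c k) * indicator (comb (R k) (L k)) \<xi>) \<partial>lborel)"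
    by (intro nn_integral_mono)
  also have "\<dots> = (\<Sum>k. \<integral>\<^sup>+\<xi>. ennreal (c k) * indicator (comb (R k) (L k)) \<xi> \<partial>lborel)"
    by (rule nn_integral_suminf) measurable
  also have "\<dots> = (\<Sum>k. ennreal (c k) * emeasure lborel (comb (R k) (L k)))"
    by (intro suminf_cong nn_integral_cmult_indicator) auto
  also have "\<dots> \<le> (\<Sum>k. ennreal ((1 / 2) ^ k))"
  proof (rule suminf_le)
    fix k
    have "ennreal (c k) * emeasure lborel (comb (R k) (L k)) \<le> ennreal (c k) * ennreal (real (L k))"
      by (intro mult_left_mono emeasure_comb_le R_ge_1) auto
    also have "\<dots> = ennreal (c k * real (L k))" using c0 by (simp add: ennreal_mult')
    also have "\<dots> \<le> ennreal ((1 / 2) ^ k)" using sob[of k] by (intro ennreal_leI) (simp add: c_def mult_ac)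
    finally show "ennreal (c k) * emeasure lborel (comb (R k) (L k)) \<le> ennreal ((1 / 2) ^ k)" .
  qed auto
  also have "\<dots> < \<infinity>" by (subst suminf_ennreal2) (auto intro: summable_geometric)
  finally show "(\<integral>\<^sup>+\<xi>. ennreal (norm ((1 + \<xi>\<^sup>2) powr \<sigma> * (cmod (g \<xi>))\<^sup>2)) \<partial>lborel) < \<infinity>" .
qed measurable

text \<open>A cut-off radius in the gap above the \<open>K\<close>-th comb keeps the combs up to
  \<open>K\<close> whole and misses all others, so the truncated integral is exactly a partial
  sum.\<close>

lemma integral_g_between:
  assumes n: "4 * real (L K) * R K \<le> N" "N < 2 * real (L (Suc K)) * R (Suc K)"
  shows "(LINT \<xi>:{\<xi>. \<bar>\<xi>\<bar> \<le> N}|lborel. cis (y * \<xi> + t * \<xi>\<^sup>2) * g \<xi>) = (\<Sum>k\<le>K. of_real (a k) * comb_osc (R k) (L k) y t)"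
proof -
  let ?c = "\<lambda>\<xi>. cis (y * \<xi> + t * \<xi>\<^sup>2)"
  have up: "4 * real (L k) * R k \<le> 4 * real (L K) * R K" if "k \<le> K" for k
  proof (cases "k = K")
    case False
    then have "4 * real (L k) * R k \<le> real (L K) * R K" using that by (intro separated) auto
    also have "\<dots> \<le> 4 * real (L K) * R K" using R_pos[of K] by simp
    finally show ?thesis .
  qed simp
  have low: "2 * real (L (Suc K)) * R (Suc K) \<le> 2 * real (L k) * R k" if "k > K" for k
  proof (cases "k = Suc K")
    case False
    then have "4 * real (L (Suc K)) * R (Suc K) \<le> real (L k) * R k" using that by (intro separated) auto
    moreover have "0 \<le> real (L (Suc K)) * R (Suc K)" "0 \<le> real (L k) * R k" using R_pos[of "Suc K"] R_pos[of k] by simp_all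
    ultimately show ?thesis by linarith
  qed simp
  have "indicator {\<xi>. \<bar>\<xi>\<bar> \<le> N} \<xi> *\<^sub>R (?c \<xi> * g \<xi>)
      = (\<Sum>k\<le>K. of_real (a k) * (indicator (comb (R k) (L k)) \<xi> *\<^sub>R ?c \<xi>))" for \<xi>
  proof (cases "\<exists>k. \<xi> \<in> comb (R k) (L k)")
    case False
    then show ?thesis using g_off_comb[of \<xi>] by simp
  next
    case True
    then obtain k where k: "\<xi> \<in> comb (R k) (L k)" by blast
    note b = comb_bounds[OF R_ge_1 k]
    have \<xi>0: "0 \<le> \<xi>" using b(1) R_pos[of k] by (intro order_trans[OF _ b(1)]) auto
    have sum: "(\<Sum>j\<le>K. of_real (a j) * (indicator (comb (R j) (L j)) \<xi> *\<^sub>R ?c \<xi>)) = (if k \<le> K then of_real (a k) * ?c \<xi> else 0)"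
    proof -
      have "(\<Sum>j\<le>K. of_real (a j) * (indicator (comb (R j) (L j)) \<xi> *\<^sub>R ?c \<xi>)) = (\<Sum>j\<le>K. if k = j then of_real (a j) * ?c \<xi> else 0)"
      proof (rule sum.cong[OF refl])
        fix j
        show "of_real (a j) * (indicator (comb (R j) (L j)) \<xi> *\<^sub>R ?c \<xi>) = (if k = j then of_real (a j) * ?c \<xi> else 0)"
          using k comb_disjoint[OF k, of j] by (cases "k = j") (auto simp: indicator_def)
      qed
      then show ?thesis by simp
    qed
    show ?thesis
    proof (cases "k \<le> K")
      case True
      then have "\<bar>\<xi>\<bar> \<le> N" using b up[OF True] n \<xi>0 by simp
      then show ?thesis unfolding sum using True g_on_comb[OF k] by (simp add: mult.commute)
    next
      case False
      then have "N < \<bar>\<xi>\<bar>" using b low[of k] n \<xi>0 by simp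
      then show ?thesis unfolding sum using False by simp
    qed
  qed
  then have "(LINT \<xi>:{\<xi>. \<bar>\<xi>\<bar> \<le> N}|lborel. ?c \<xi> * g \<xi>)
      = (LINT \<xi>|lborel. (\<Sum>k\<le>K. of_real (a k) * (indicator (comb (R k) (L k)) \<xi> *\<^sub>R ?c \<xi>)))"
    unfolding set_lebesgue_integral_def by (intro Bochner_Integration.integral_cong) auto
  also have "\<dots> = (\<Sum>k\<le>K. LINT \<xi>|lborel. of_real (a k) * (indicator (comb (R k) (L k)) \<xi> *\<^sub>R ?c \<xi>))"
    using comb_osc_eq(1)[OF R_ge_1] unfolding set_integrable_def
    by (intro Bochner_Integration.integral_sum integrable_mult_right) auto
  also have "\<dots> = (\<Sum>k\<le>K. of_real (a k) * comb_osc (R k) (L k) y t)"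
    unfolding comb_osc_eq(2)[OF R_ge_1, symmetric] set_lebesgue_integral_def
    by (simp only: integral_mult_right_zero)
  finally show ?thesis .
qed

text \<open>The gap above the \<open>K\<close>-th comb spans a factor of at least 2, hence contains
  a power of 2; this is what the constant 4 in \<open>separated\<close> provides.\<close>

lemma ex_dyadic_between:
  obtains n :: nat where "4 * real (L K) * R K \<le> 2 ^ n" "2 ^ n < 2 * real (L (Suc K)) * R (Suc K)"
proof -
  define X where "X = 4 * real (L K) * R K"
  have "1 * 1 \<le> real (L K) * R K" using L_pos[of K] R_ge_1[of K] by (intro mult_mono) auto
  then have X: "1 < X" by (simp add: X_def)
  define n where "n = (LEAST n. X \<le> 2 ^ n)"
  have "\<exists>n. X \<le> 2 ^ n" using real_arch_pow[of 2 X] by (auto intro: less_imp_le)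
  then have n: "X \<le> 2 ^ n" unfolding n_def by (rule LeastI_ex)
  have "n \<noteq> 0" using n X by (cases n) auto
  then have "\<not> X \<le> 2 ^ (n - 1)" unfolding n_def by (intro not_less_Least) simp
  moreover have "(2::real) ^ n = 2 * 2 ^ (n - 1)" using \<open>n \<noteq> 0\<close> by (cases n) auto
  ultimately have "2 ^ n < 2 * X" by simp
  also have "\<dots> \<le> 2 * (real (L (Suc K)) * R (Suc K))"
    unfolding X_def by (intro mult_left_mono separated) auto
  finally show ?thesis using n by (intro that[of n]) (auto simp: X_def)
qed

abbreviation "curve \<equiv> power_curve \<alpha>"

text \<open>The truncations in the definition of \<open>U\<close> run over all powers of 2. If their
  limit exists, it can be computed along those that cut between combs, where no comb is
  split.\<close>

lemma U_along_subsequence: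
  assumes f: "fourier_is_fun f g" and U: "U_defined curve f x t"
  shows "(\<lambda>K. 1 / (2 * of_real pi) * (\<Sum>k\<le>K. of_real (a k) * comb_osc (R k) (L k) (x + \<bar>t\<bar> powr \<alpha>) t)) \<longlonglongrightarrow> U curve f x t"
proof -
  have "\<exists>n. \<forall>K. 4 * real (L K) * R K \<le> 2 ^ n K \<and> 2 ^ n K < 2 * real (L (Suc K)) * R (Suc K)"
    by (intro choice allI) (meson ex_dyadic_between)
  then obtain n where n: "\<And>K. 4 * real (L K) * R K \<le> 2 ^ n K" "\<And>K. 2 ^ n K < 2 * real (L (Suc K)) * R (Suc K)"
    by blast
  have n_top: "filterlim n at_top sequentially"
    unfolding filterlim_at_top
  proof
    fix Z :: nat
    have "Z \<le> n K" if "K \<ge> 2 ^ Z" for K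
    proof -
      have "real (2 ^ Z) \<le> real K" using that by (simp only: of_nat_le_iff)
      also have "\<dots> \<le> 1 * R K" using R_large(2)[of K] by simp
      also have "\<dots> \<le> 4 * real (L K) * R K" using L_pos[of K] R_pos[of K] by (intro mult_right_mono) auto
      also have "\<dots> \<le> 2 ^ n K" by (rule n)
      finally have "(2::real) ^ Z \<le> 2 ^ n K" by simp
      then show ?thesis by simp
    qed
    then show "\<forall>\<^sub>F K in sequentially. Z \<le> n K" unfolding eventually_sequentially by blast
  qed
  have "U_partial curve f x t (n K) = 1 / (2 * of_real pi) * (\<Sum>k\<le>K. of_real (a k) * comb_osc (R k) (L k) (x + \<bar>t\<bar> powr \<alpha>) t)" for K
  proof -
    have "(LINT \<xi>:{\<xi>. \<bar>\<xi>\<bar> \<le> 2 ^ n K}|lborel. cis (curve (x, t) * \<xi> + t * \<xi>\<^sup>2) * fhat f \<xi>)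
        = (LINT \<xi>:{\<xi>. \<bar>\<xi>\<bar> \<le> 2 ^ n K}|lborel. cis (curve (x, t) * \<xi> + t * \<xi>\<^sup>2) * g \<xi>)"
    proof -
      note [measurable] = fhat_AE_eq(2)[OF f]
      have [measurable]: "(\<lambda>\<xi>. cis (curve (x, t) * \<xi> + t * \<xi>\<^sup>2)) \<in> borel_measurable borel"
        by (intro borel_measurable_continuous_onI continuous_intros)
      show ?thesis unfolding set_lebesgue_integral_def
        by (rule integral_cong_AE) (use fhat_AE_eq(1)[OF f] in \<open>measurable, auto\<close>)
    qed
    then show ?thesis
      unfolding U_partial_eq using integral_g_between[OF n] by (simp add: power_curve_def)
  qed
  then show ?thesis
    using filterlim_compose[OF U_partial_tendsto_U[OF U] n_top] by simp
qed

text \<open>Comparing the value at an aligned time with the value at an anti-aligned time avoids any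
  statement about the initial datum \<open>U curve f x 0\<close>.\<close>

lemma aligned_times:
  assumes x: "0 < x" "x < 1 / 2"
  obtains t t' where "R k powr (- 1 / \<alpha>) \<le> t" "t \<le> \<Lambda> * R k powr (- 1 / \<alpha>)"
    "R k powr (- 1 / \<alpha>) \<le> t'" "t' \<le> \<Lambda> * R k powr (- 1 / \<alpha>)"
    "x + t powr \<alpha> \<in> {0..1}" "x + t' powr \<alpha> \<in> {0..1}" "(x + t' powr \<alpha>) - (x + t powr \<alpha>) = pi / R k"
    "real (L k) / 2 \<le> cmod (comb_osc (R k) (L k) (x + t powr \<alpha>) t - comb_osc (R k) (L k) (x + t' powr \<alpha>) t')"
proof -
  \<comment> \<open>Adding 1 to the ceiling keeps the displacement \<open>z\<close> of the curve at
    least \<open>2 * pi / R k\<close>, which bounds the time from below. The anti-aligned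
    displacement \<open>z'\<close> is half a period further, at most \<open>5 * pi / R k\<close>,
    whence the constant \<open>5 * pi\<close> in \<open>\<Lambda>\<close>.\<close>
  define m where "m = \<lceil>x * R k / (2 * pi)\<rceil> + 1"
  define z where "z = 2 * pi * of_int m / R k - x"
  have Rk: "R k > 0" "R k \<ge> 1" by (rule R_pos R_ge_1)+
  have "x * R k / (2 * pi) \<le> of_int m - 1" "of_int m - 2 < x * R k / (2 * pi)"
    unfolding m_def by linarith+
  then have "x * R k \<le> 2 * pi * (of_int m - 1)" "2 * pi * (of_int m - 2) \<le> x * R k"
    by (auto simp: field_simps)
  then have "2 * pi \<le> 2 * pi * of_int m - x * R k" "2 * pi * of_int m - x * R k \<le> 4 * pi"
    by (auto simp: algebra_simps)
  moreover have "z = (2 * pi * of_int m - x * R k) / R k" using Rk by (simp add: z_def field_simps)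
  ultimately have z: "2 * pi / R k \<le> z" "z \<le> 4 * pi / R k"
    using Rk by (auto intro!: divide_right_mono)
  have z0: "z > 0" using z(1) Rk by (smt (verit) divide_pos_pos pi_gt_zero)
  define z' where "z' = z + pi / R k"
  have z': "2 * pi / R k \<le> z'" "z' \<le> 5 * pi / R k" "0 < z'"
    using z z0 Rk by (auto simp: z'_def add_divide_distrib add_pos_pos)
  \<comment> \<open>Together with \<open>x < 1 / 2\<close> this keeps both positions in
    \<open>{0..1}\<close>, as \<open>comb_osc_aligned\<close> requires; it is the reason for
    \<open>10 * pi \<le> R k\<close>.\<close>
  have small: "5 * pi / R k \<le> 1 / 2" using R_large(1)[of k] Rk by (simp add: field_simps)
  have pw: "R k powr (- 1 / \<alpha>) \<le> w powr (1 / \<alpha>)" "w powr (1 / \<alpha>) \<le> \<Lambda> * R k powr (- 1 / \<alpha>)" "(w powr (1 / \<alpha>)) powr \<alpha> = w"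
    if w: "2 * pi / R k \<le> w" "w \<le> 5 * pi / R k" "0 < w" for w
  proof -
    have "1 / R k \<le> 2 * pi / R k" using pi_gt3 Rk by (intro divide_right_mono) auto
    then have "(1 / R k) powr (1 / \<alpha>) \<le> w powr (1 / \<alpha>)" using w Rk alpha by (intro powr_mono2) auto
    then show "R k powr (- 1 / \<alpha>) \<le> w powr (1 / \<alpha>)" using Rk by (simp add: powr_divide powr_minus_divide)
    have "w powr (1 / \<alpha>) \<le> (5 * pi / R k) powr (1 / \<alpha>)" using w alpha by (intro powr_mono2) auto
    also have "\<dots> = \<Lambda> * R k powr (- 1 / \<alpha>)" unfolding \<Lambda> using Rk by (simp add: powr_divide powr_minus_divide)
    finally show "w powr (1 / \<alpha>) \<le> \<Lambda> * R k powr (- 1 / \<alpha>)" .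
    show "(w powr (1 / \<alpha>)) powr \<alpha> = w" using w alpha by (simp add: powr_powr)
  qed
  have z5: "z \<le> 5 * pi / R k" using z(2) Rk by (smt (verit) divide_right_mono pi_gt_zero)
  note pz = pw[OF z(1) z5 z0] and pz' = pw[OF z']
  define t where "t = z powr (1 / \<alpha>)"
  define t' where "t' = z' powr (1 / \<alpha>)"
  have ph: "s * (4 * real (L k) * R k)\<^sup>2 \<le> 1 / 8" if "s \<le> \<Lambda> * R k powr (- 1 / \<alpha>)" for s
    using mult_right_mono[OF that, of "(4 * real (L k) * R k)\<^sup>2"] phase[of k] by simp
  have y: "0 \<le> x + z" "x + z \<le> 1" "0 \<le> x + z'" "x + z' \<le> 1"
    using x z0 z' z5 small by auto
  have e: "(x + z) * R k = of_int (2 * m) * pi" "(x + z') * R k = of_int (2 * m + 1) * pi"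
    using Rk by (simp_all add: z_def z'_def distrib_right add_divide_distrib)
  have t0: "0 \<le> t" "0 \<le> t'" by (simp_all add: t_def t'_def)
  have "real (L k) * (3 / 8) \<le> (if even (2 * m) then 1 else - 1) * Re (comb_osc (R k) (L k) (x + z) t)"
    by (rule comb_osc_aligned[OF Rk(2) y(1,2) e(1) t0(1) ph[OF pz(2)[folded t_def]]])
  moreover have "real (L k) * (3 / 8) \<le> (if even (2 * m + 1) then 1 else - 1) * Re (comb_osc (R k) (L k) (x + z') t')"
    by (rule comb_osc_aligned[OF Rk(2) y(3,4) e(2) t0(2) ph[OF pz'(2)[folded t'_def]]])
  ultimately have "real (L k) * (3 / 8) + real (L k) * (3 / 8) \<le> Re (comb_osc (R k) (L k) (x + z) t - comb_osc (R k) (L k) (x + z') t')"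
    by simp
  then have "real (L k) / 2 \<le> Re (comb_osc (R k) (L k) (x + z) t - comb_osc (R k) (L k) (x + z') t')" by simp
  then have main: "real (L k) / 2 \<le> cmod (comb_osc (R k) (L k) (x + z) t - comb_osc (R k) (L k) (x + z') t')"
    by (rule order_trans[OF _ complex_Re_le_cmod])
  show ?thesis
    by (rule that[of t t']) (use pz pz' y main in \<open>auto simp: t_def t'_def z'_def\<close>)
qed

text \<open>The \<open>k\<close>-th comb dominates: it contributes at least
  \<open>(k + 1) / 2\<close> units of \<open>R k powr (- \<delta> / \<alpha>)\<close>, the combs
  below it together at most one unit, since \<open>coarse\<close> allows each
  \<open>1 / (k + 1)\<close>, and those above it at most two units by a geometric series.\<close>

lemma partial_sum_difference_ge:
  assumes tt': "R k powr (- 1 / \<alpha>) \<le> t" "t \<le> \<Lambda> * R k powr (- 1 / \<alpha>)"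
    "R k powr (- 1 / \<alpha>) \<le> t'" "t' \<le> \<Lambda> * R k powr (- 1 / \<alpha>)"
    and y: "y \<in> {0..1}" "y' \<in> {0..1}" "y' - y = pi / R k"
    and main: "real (L k) / 2 \<le> cmod (comb_osc (R k) (L k) y t - comb_osc (R k) (L k) y' t')"
    and K: "k \<le> K"
  shows "((real k + 1) / 2 - 3) * R k powr (- \<delta> / \<alpha>)
    \<le> cmod (\<Sum>j\<le>K. of_real (a j) * (comb_osc (R j) (L j) y t - comb_osc (R j) (L j) y' t'))"
proof -
  define d where "d j = of_real (a j) * (comb_osc (R j) (L j) y t - comb_osc (R j) (L j) y' t')" for j
  define r where "r = R k powr (- \<delta> / \<alpha>)"
  have r: "r > 0" using R_pos[of k] by (simp add: r_def)
  have q: "R k powr (- 1 / \<alpha>) > 0" using R_pos[of k] by simp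
  have dk: "(real k + 1) / 2 * r \<le> cmod (d k)"
  proof -
    \<comment> \<open>The amplitude \<open>a k\<close> is normalized so that the jump of the
      \<open>k\<close>-th comb is of size \<open>t powr \<delta>\<close> times the growing factor
      \<open>k + 1\<close>.\<close>
    have "(real k + 1) / 2 * r = a k * (real (L k) / 2)"
      using L_pos[of k] R_pos[of k] by (simp add: a_eq r_def powr_minus_divide field_simps)
    also have "\<dots> \<le> a k * cmod (comb_osc (R k) (L k) y t - comb_osc (R k) (L k) y' t')"
      using a_pos[of k] by (intro mult_left_mono main) auto
    finally show ?thesis using a_pos[of k] by (simp add: d_def norm_mult)
  qed
  have lower: "cmod (d j) \<le> r / (real k + 1)" if j: "j < k" for j
  proof -
    have "cmod (comb_osc (R j) (L j) y t - comb_osc (R j) (L j) y' t')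
        \<le> real (L j) * (\<bar>y - y'\<bar> * (4 * real (L j) * R j) + \<bar>t - t'\<bar> * (4 * real (L j) * R j)\<^sup>2)"
      by (rule norm_comb_osc_diff_le[OF R_ge_1])
    also have "\<dots> \<le> real (L j) * (pi / R k * (4 * real (L j) * R j) + \<Lambda> * R k powr (- 1 / \<alpha>) * (4 * real (L j) * R j)\<^sup>2)"
    proof -
      have "0 < pi / R k" using R_pos[of k] by simp
      then have "\<bar>y - y'\<bar> = pi / R k" using y(3) by linarith
      moreover have "\<bar>t - t'\<bar> \<le> \<Lambda> * R k powr (- 1 / \<alpha>)" using tt' q by linarith
      ultimately show ?thesis using R_pos[of j] by (intro mult_left_mono add_mono mult_right_mono) auto
    qed
    finally have "cmod (d j) \<le> a j * (real (L j) * (pi / R k * (4 * real (L j) * R j) + \<Lambda> * R k powr (- 1 / \<alpha>) * (4 * real (L j) * R j)\<^sup>2))"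
      using a_pos[of j] by (simp add: d_def norm_mult)
    then have "(real k + 1) * cmod (d j) \<le> (real k + 1) * (a j * (real (L j) * (pi / R k * (4 * real (L j) * R j) + \<Lambda> * R k powr (- 1 / \<alpha>) * (4 * real (L j) * R j)\<^sup>2)))"
      by (intro mult_left_mono) auto
    also have "\<dots> \<le> r" using coarse[OF j] by (simp add: r_def)
    finally show ?thesis by (simp add: field_simps)
  qed
  have upper: "cmod (d j) \<le> (1 / 2) ^ j * r" if j: "k < j" for j
  proof -
    have one: "cmod (comb_osc (R j) (L j) w s) \<le> R k powr (1 / \<alpha>) / R j" if w: "0 \<le> w" and s: "R k powr (- 1 / \<alpha>) \<le> s" for w s
    proof -
      have s0: "s > 0" using s q by linarith
      have "cmod (comb_osc (R j) (L j) w s) \<le> 1 / (s * R j)" by (rule norm_comb_osc_le[OF R_ge_1 L_pos w s0])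
      also have "\<dots> \<le> 1 / (R k powr (- 1 / \<alpha>) * R j)"
        using s q R_pos[of j] s0 by (intro divide_left_mono mult_right_mono mult_pos_pos) auto
      also have "\<dots> = R k powr (1 / \<alpha>) / R j" using R_pos[of k] by (simp add: powr_minus_divide)
      finally show ?thesis .
    qed
    have "cmod (comb_osc (R j) (L j) y t - comb_osc (R j) (L j) y' t') \<le> R k powr (1 / \<alpha>) / R j + R k powr (1 / \<alpha>) / R j"
      using y tt' by (intro order_trans[OF norm_triangle_ineq4] add_mono one) auto
    then have "a j * cmod (comb_osc (R j) (L j) y t - comb_osc (R j) (L j) y' t')
        \<le> a j * (R k powr (1 / \<alpha>) / R j + R k powr (1 / \<alpha>) / R j)"
      using a_pos[of j] by (intro mult_left_mono) auto
    then have "cmod (d j) \<le> a j * (2 * R k powr (1 / \<alpha>) / R j)"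
      using a_pos[of j] by (simp add: d_def norm_mult)
    also have "\<dots> \<le> (1 / 2) ^ j * r" using fine[OF j] by (simp add: r_def)
    finally show ?thesis .
  qed
  have "{..K} = insert k ({..<k} \<union> {k<..K})" using K by auto
  then have "(\<Sum>j\<le>K. d j) = d k + ((\<Sum>j<k. d j) + (\<Sum>j\<in>{k<..K}. d j))"
    using sum.union_disjoint[of "{..<k}" "{k<..K}" d] by (simp add: disjoint_iff)
  then have "cmod (d k) \<le> cmod (\<Sum>j\<le>K. d j) + cmod (\<Sum>j<k. d j) + cmod (\<Sum>j\<in>{k<..K}. d j)"
    by (smt (verit) add_diff_cancel_right' norm_triangle_ineq norm_triangle_ineq4)
  moreover have "cmod (\<Sum>j<k. d j) \<le> r"
  proof -
    have "cmod (\<Sum>j<k. d j) \<le> (\<Sum>j<k. r / (real k + 1))" by (intro sum_norm_le lower) auto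
    also have "\<dots> \<le> r" using r by (simp add: field_simps)
    finally show ?thesis .
  qed
  moreover have "cmod (\<Sum>j\<in>{k<..K}. d j) \<le> 2 * r"
  proof -
    have "cmod (\<Sum>j\<in>{k<..K}. d j) \<le> (\<Sum>j\<in>{k<..K}. (1 / 2) ^ j * r)" by (intro sum_norm_le upper) auto
    also have "\<dots> = (\<Sum>j\<in>{k<..K}. (1 / 2) ^ j) * r" by (simp add: sum_distrib_right)
    also have "\<dots> \<le> (\<Sum>j. (1 / 2) ^ j) * r"
      using r by (intro mult_right_mono sum_le_suminf summable_geometric) auto
    also have "(\<Sum>j. (1 / 2 :: real) ^ j) = 2" by (subst suminf_geometric) auto
    finally show ?thesis .
  qed
  ultimately have "(real k + 1) / 2 * r - 3 * r \<le> cmod (\<Sum>j\<le>K. d j)" using dk by linarith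
  then show ?thesis by (simp add: d_def r_def left_diff_distrib)
qed

text \<open>Convergence would put \<open>U\<close> at both aligned times within a multiple of
  \<open>R k powr (- \<delta> / \<alpha>)\<close> of its value at time 0, with a factor independent
  of \<open>k\<close>. The partial sums, and so their limits, differ by that unit times a factor
  growing with \<open>k\<close>.\<close>

lemma not_converges_with_rate:
  assumes f: "fourier_is_fun f g" and x: "0 < x" "x < 1 / 2"
  shows "\<not> converges_with_rate curve \<delta> f x"
proof
  assume conv: "converges_with_rate curve \<delta> f x"
  then have "\<forall>\<^sub>F t in at_right 0. dist ((U curve f x t - U curve f x 0) / of_real (t powr \<delta>)) 0 < 1"
    unfolding converges_with_rate_def by (intro tendstoD) auto
  moreover have "\<forall>\<^sub>F t in at_right 0. U_defined curve f x t"
    using conv unfolding converges_with_rate_def by blast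
  ultimately have "\<forall>\<^sub>F t in at_right 0. U_defined curve f x t \<and> dist ((U curve f x t - U curve f x 0) / of_real (t powr \<delta>)) 0 < 1"
    by eventually_elim auto
  then obtain t0 where t0: "t0 > 0" and good: "\<And>t. 0 < t \<Longrightarrow> t < t0 \<Longrightarrow> U_defined curve f x t"
    and good': "\<And>t. 0 < t \<Longrightarrow> t < t0 \<Longrightarrow> cmod ((U curve f x t - U curve f x 0) / of_real (t powr \<delta>)) < 1"
    unfolding eventually_at_right_field by auto
  have rate: "cmod (U curve f x t - U curve f x 0) \<le> t powr \<delta>" if "0 < t" "t < t0" for t
    using good'[OF that] that by (simp add: norm_divide field_simps)
  have \<Lambda>0: "\<Lambda> > 0" by (simp add: \<Lambda>)
  have "(\<lambda>k. \<Lambda> * R k powr (- 1 / \<alpha>)) \<longlonglongrightarrow> \<Lambda> * 0"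
  proof (intro tendsto_mult tendsto_const tendsto_neg_powr)
    show "- 1 / \<alpha> < 0" using alpha by simp
    show "filterlim R at_top sequentially"
      by (rule filterlim_at_top_mono[OF filterlim_real_sequentially]) (use R_large(2) in auto)
  qed
  then have "\<forall>\<^sub>F k in sequentially. \<Lambda> * R k powr (- 1 / \<alpha>) < t0"
    using t0 by (intro order_tendstoD(2)) auto
  moreover have "\<forall>\<^sub>F k in sequentially. 4 * pi * \<Lambda> powr \<delta> + 3 < (real k + 1) / 2"
  proof -
    obtain n :: nat where "2 * (4 * pi * \<Lambda> powr \<delta> + 3) < real n" using reals_Archimedean2 by blast
    then show ?thesis unfolding eventually_sequentially by (intro exI[of _ n]) auto
  qed
  ultimately have "\<forall>\<^sub>F k in sequentially. \<Lambda> * R k powr (- 1 / \<alpha>) < t0 \<and> 4 * pi * \<Lambda> powr \<delta> + 3 < (real k + 1) / 2"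
    by eventually_elim auto
  then obtain k where k: "\<Lambda> * R k powr (- 1 / \<alpha>) < t0" "4 * pi * \<Lambda> powr \<delta> + 3 < (real k + 1) / 2"
    by (auto simp: eventually_sequentially)
  define r where "r = R k powr (- \<delta> / \<alpha>)"
  have r: "r > 0" using R_pos[of k] by (simp add: r_def)
  have q: "R k powr (- 1 / \<alpha>) > 0" using R_pos[of k] by simp
  obtain t t' where tt': "R k powr (- 1 / \<alpha>) \<le> t" "t \<le> \<Lambda> * R k powr (- 1 / \<alpha>)"
    "R k powr (- 1 / \<alpha>) \<le> t'" "t' \<le> \<Lambda> * R k powr (- 1 / \<alpha>)"
    "x + t powr \<alpha> \<in> {0..1}" "x + t' powr \<alpha> \<in> {0..1}" "(x + t' powr \<alpha>) - (x + t powr \<alpha>) = pi / R k"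
    "real (L k) / 2 \<le> cmod (comb_osc (R k) (L k) (x + t powr \<alpha>) t - comb_osc (R k) (L k) (x + t' powr \<alpha>) t')"
    by (rule aligned_times[OF x]) (rule that)
  have t_pos: "0 < t" "0 < t'" using tt'(1,3) q by linarith+
  have t_lt: "t < t0" "t' < t0" using tt'(2,4) k by linarith+
  have pow: "s powr \<delta> \<le> \<Lambda> powr \<delta> * r" if "0 < s" "s \<le> \<Lambda> * R k powr (- 1 / \<alpha>)" for s
  proof -
    have "s powr \<delta> \<le> (\<Lambda> * R k powr (- 1 / \<alpha>)) powr \<delta>" using that delta by (intro powr_mono2) auto
    also have "\<dots> = \<Lambda> powr \<delta> * r" using \<Lambda>0 by (simp add: powr_mult powr_powr r_def)
    finally show ?thesis .
  qed
  have "cmod (U curve f x t - U curve f x t') \<le> cmod (U curve f x t - U curve f x 0) + cmod (U curve f x t' - U curve f x 0)"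
    using norm_triangle_ineq4[of "U curve f x t - U curve f x 0" "U curve f x t' - U curve f x 0"] by simp
  also have "\<dots> \<le> t powr \<delta> + t' powr \<delta>" by (intro add_mono rate t_pos t_lt)
  also have "\<dots> \<le> \<Lambda> powr \<delta> * r + \<Lambda> powr \<delta> * r" by (intro add_mono pow t_pos tt')
  finally have upper: "cmod (U curve f x t - U curve f x t') \<le> 2 * \<Lambda> powr \<delta> * r"
    by (simp add: mult_ac)
  define S where "S K = (\<Sum>j\<le>K. of_real (a j) * (comb_osc (R j) (L j) (x + t powr \<alpha>) t - comb_osc (R j) (L j) (x + t' powr \<alpha>) t'))" for K
  have "(\<lambda>K. 1 / (2 * of_real pi) * S K) \<longlonglongrightarrow> U curve f x t - U curve f x t'"
    using tendsto_diff[OF U_along_subsequence[OF f good[OF t_pos(1) t_lt(1)]] U_along_subsequence[OF f good[OF t_pos(2) t_lt(2)]]] t_pos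
    by (simp add: S_def right_diff_distrib sum_subtractf diff_divide_distrib)
  then have "(\<lambda>K. cmod (1 / (2 * of_real pi) * S K)) \<longlonglongrightarrow> cmod (U curve f x t - U curve f x t')"
    by (rule tendsto_norm)
  moreover have "1 / (2 * pi) * (((real k + 1) / 2 - 3) * r) \<le> cmod (1 / (2 * of_real pi) * S K)" if "K \<ge> k" for K
  proof -
    have "((real k + 1) / 2 - 3) * r \<le> cmod (S K)"
      unfolding S_def r_def by (rule partial_sum_difference_ge[OF tt' that])
    then show ?thesis by (simp add: norm_mult norm_divide divide_right_mono)
  qed
  ultimately have "1 / (2 * pi) * (((real k + 1) / 2 - 3) * r) \<le> cmod (U curve f x t - U curve f x t')"
    by (intro LIMSEQ_le_const) auto
  then have "1 / (2 * pi) * (((real k + 1) / 2 - 3) * r) \<le> 2 * \<Lambda> powr \<delta> * r" using upper by linarith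
  then have "((real k + 1) / 2 - 3) * r \<le> 4 * pi * \<Lambda> powr \<delta> * r" by (simp add: field_simps)
  then have "(real k + 1) / 2 - 3 \<le> 4 * pi * \<Lambda> powr \<delta>" using r by simp
  then show False using k(2) by linarith
qed

end

section \<open>Choice of the parameters\<close>

lemma ex_sequence_of_eventually:
  fixes Q :: "nat \<Rightarrow> real \<Rightarrow> bool" and P :: "nat \<Rightarrow> nat \<Rightarrow> real \<Rightarrow> real \<Rightarrow> bool"
  assumes Q: "\<And>k. \<forall>\<^sub>F x in at_top. Q k x" and P: "\<And>j k r. \<forall>\<^sub>F x in at_top. P j k r x"
  obtains R where "\<And>k. Q k (R k)" "\<And>j k. j < k \<Longrightarrow> P j k (R j) (R k)"
proof -
  have "\<exists>R. \<forall>k::nat. Q k (R k) \<and> (\<forall>j<k. P j k (R j) (R k))"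
  proof (rule dependent_wellorder_choice)
    fix k :: nat and R :: "nat \<Rightarrow> real"
    have ev: "\<forall>\<^sub>F x in at_top. Q k x \<and> (\<forall>j\<in>{..<k}. P j k (R j) x)"
      by (intro eventually_conj Q eventually_ball_finite ballI P) auto
    from eventually_happens'[OF _ ev] obtain x where "Q k x" "\<forall>j\<in>{..<k}. P j k (R j) x" by auto
    then show "\<exists>x. Q k x \<and> (\<forall>j<k. P j k (R j) x)" by auto
  qed auto
  then show ?thesis using that by blast
qed

lemma eventually_powr_le_powr:
  fixes p q C c :: real
  assumes "p < q" "c > 0"
  shows "\<forall>\<^sub>F x in at_top. C * x powr p \<le> c * x powr q"
proof -
  have "((\<lambda>x::real. C * x powr (p - q)) \<longlongrightarrow> C * 0) at_top"
    using assms by (intro tendsto_mult tendsto_const tendsto_neg_powr filterlim_ident) auto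
  then have "\<forall>\<^sub>F x in at_top. C * x powr (p - q) < c" using assms by (intro order_tendstoD(2)) auto
  moreover have "\<forall>\<^sub>F x in at_top. (0::real) < x" by (rule eventually_gt_at_top)
  ultimately show ?thesis
  proof eventually_elim
    fix x :: real assume "C * x powr (p - q) < c" "0 < x"
    then have "C * x powr (p - q) * x powr q \<le> c * x powr q" by (intro mult_right_mono) auto
    then show "C * x powr p \<le> c * x powr q" by (simp add: mult.assoc powr_add[symmetric])
  qed
qed

text \<open>With the earlier radii frozen, every requirement holds for all large \<open>R k\<close>,
  so the radii can be chosen recursively. Strictness of
  \<open>\<sigma> < s_crit \<alpha> \<delta>\<close> leaves room for the factors
  \<open>(k + 1)\<^sup>2\<close> and \<open>(1 / 2) ^ k\<close> in the Sobolev bound.\<close>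

lemma ex_lacunary_combs:
  assumes alpha: "0 < \<alpha>" "\<alpha> \<le> 1 / 4" and delta: "0 \<le> \<delta>" "\<delta> < \<alpha>" and \<sigma>: "0 \<le> \<sigma>" "\<sigma> < s_crit \<alpha> \<delta>"
  obtains R L a where "lacunary_combs \<alpha> \<delta> R L a ((5 * pi) powr (1 / \<alpha>))"
    and "\<And>k. (a k)\<^sup>2 * real (L k) * (1 + (4 * real (L k) * R k)\<^sup>2) powr \<sigma> \<le> (1 / 2) ^ k"
proof -
  define \<Lambda> where "\<Lambda> = (5 * pi) powr (1 / \<alpha>)"
  have \<Lambda>: "\<Lambda> \<ge> 1" unfolding \<Lambda>_def using pi_gt3 alpha by (intro ge_one_powr_ge_zero) auto
  \<comment> \<open>The comb has about \<open>R powr \<beta>\<close> teeth. For \<open>\<delta> < \<alpha> / 2\<close> this is the largest number for which its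
    frequencies \<open>N\<close> still satisfy \<open>t * N\<^sup>2 \<lesssim> 1\<close> at the relevant times \<open>t\<close> of size \<open>R powr (- 1 / \<alpha>)\<close>.\<close>
  define \<beta> where "\<beta> = (if \<delta> < \<alpha> / 2 then 1 / (2 * \<alpha>) - 1 else 0)"
  \<comment> \<open>The second property keeps the quadratic phase bounded. The third makes the
    Sobolev term small: \<open>(a k)\<^sup>2 * L * (L * R) powr (2 * \<sigma>)\<close> has order
    \<open>R powr ((2 * \<beta> + 2) * \<sigma> - \<beta> - 2 * \<delta> / \<alpha>)\<close> up to
    \<open>(k + 1)\<^sup>2\<close>.\<close>
  have \<beta>: "0 \<le> \<beta>" "2 * \<beta> + 2 \<le> 1 / \<alpha>" "(2 * \<beta> + 2) * \<sigma> < \<beta> + 2 * \<delta> / \<alpha>"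
  proof -
    have inv: "4 \<le> 1 / \<alpha>" using alpha by (simp add: field_simps)
    show "0 \<le> \<beta>" "2 * \<beta> + 2 \<le> 1 / \<alpha>" using inv by (auto simp: \<beta>_def)
    show "(2 * \<beta> + 2) * \<sigma> < \<beta> + 2 * \<delta> / \<alpha>"
    proof (cases "\<delta> < \<alpha> / 2")
      case True
      then have b: "2 * \<beta> + 2 = 1 / \<alpha>" by (simp add: \<beta>_def)
      have "(2 * \<beta> + 2) * \<sigma> < 1 / \<alpha> * (1 / 2 - \<alpha> + 2 * \<delta>)"
        unfolding b using \<sigma> True alpha by (intro mult_strict_left_mono) (auto simp: s_crit_def)
      also have "\<dots> = \<beta> + 2 * \<delta> / \<alpha>" using True alpha by (simp add: \<beta>_def field_simps)
      finally show ?thesis .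
    next
      case False
      then show ?thesis using \<sigma> by (simp add: \<beta>_def s_crit_def)
    qed
  qed
  \<comment> \<open>With this \<open>c\<close> the comb uses
    \<open>32 * \<Lambda> * c\<^sup>2 = 1 / 16\<close> of the admissible phase \<open>1 / 8\<close>;
    the other \<open>1 / 16\<close> is left for rounding the number of teeth up.\<close>
  define c where "c = sqrt (1 / (512 * \<Lambda>))"
  have c: "0 < c" "c \<le> 1" "c\<^sup>2 = 1 / (512 * \<Lambda>)" using \<Lambda> by (auto simp: c_def)
  define L where "L x = nat \<lceil>c * x powr \<beta>\<rceil>" for x :: real
  have L: "1 \<le> L x" "c * x powr \<beta> \<le> real (L x)" "real (L x) \<le> c * x powr \<beta> + 1" "real (L x) \<le> 2 * x powr \<beta>"
    if x: "x \<ge> 1" for x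
  proof -
    have pos: "0 < c * x powr \<beta>" using x c by simp
    then show 1: "1 \<le> L x" unfolding L_def by linarith
    show "c * x powr \<beta> \<le> real (L x)" using pos unfolding L_def by linarith
    show 2: "real (L x) \<le> c * x powr \<beta> + 1" using pos unfolding L_def by linarith
    have "1 \<le> x powr \<beta>" using x \<beta>(1) by (rule ge_one_powr_ge_zero)
    moreover then have "c * x powr \<beta> \<le> 1 * x powr \<beta>" using c by (intro mult_right_mono) auto
    ultimately show "real (L x) \<le> 2 * x powr \<beta>" using 2 by linarith
  qed
  define a where "a k x = (real k + 1) / (real (L x) * x powr (\<delta> / \<alpha>))" for k :: nat and x :: real
  define Q where "Q k x \<longleftrightarrow> 10 * pi \<le> x \<and> real k \<le> x \<and> \<Lambda> * x powr (- 1 / \<alpha>) * (4 * real (L x) * x)\<^sup>2 \<le> 1 / 8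
    \<and> (a k x)\<^sup>2 * real (L x) * (1 + (4 * real (L x) * x)\<^sup>2) powr \<sigma> \<le> (1 / 2) ^ k" for k x
  \<comment> \<open>\<open>P\<close> is to hold eventually for every real \<open>r\<close>; the
    guard \<open>0 < r\<close> makes the right side of its condition positive.\<close>
  define P where "P j k r x \<longleftrightarrow> (real k + 1) * (a j r * (real (L r) * (pi / x * (4 * real (L r) * r)
          + \<Lambda> * x powr (- 1 / \<alpha>) * (4 * real (L r) * r)\<^sup>2))) \<le> x powr (- \<delta> / \<alpha>)
    \<and> (0 < r \<longrightarrow> a k x * (2 * r powr (1 / \<alpha>) / x) \<le> (1 / 2) ^ k * r powr (- \<delta> / \<alpha>))
    \<and> 4 * real (L r) * r \<le> real (L x) * x" for j k r x
  have big: "\<forall>\<^sub>F x in at_top. (1::real) \<le> x" by (rule eventually_ge_at_top)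
  have ev_phase: "\<forall>\<^sub>F x in at_top. \<Lambda> * x powr (- 1 / \<alpha>) * (4 * real (L x) * x)\<^sup>2 \<le> 1 / 8"
  proof -
    have "2 - 1 / \<alpha> < 0" using alpha by (simp add: field_simps)
    then have "\<forall>\<^sub>F x in at_top. 32 * \<Lambda> * x powr (2 - 1 / \<alpha>) \<le> (1 / 16) * x powr 0"
      by (rule eventually_powr_le_powr) simp
    with big show ?thesis
    proof eventually_elim
      fix x :: real assume x: "1 \<le> x" and le: "32 * \<Lambda> * x powr (2 - 1 / \<alpha>) \<le> (1 / 16) * x powr 0"
      have "(real (L x))\<^sup>2 \<le> (c * x powr \<beta> + 1)\<^sup>2" using L[OF x] by (intro power_mono) auto
      also have "\<dots> \<le> 2 * (c * x powr \<beta>)\<^sup>2 + 2"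
        using sum_squares_bound[of "c * x powr \<beta>" 1] by (simp add: power2_sum)
      also have "\<dots> = 2 * c\<^sup>2 * x powr (2 * \<beta>) + 2"
        by (simp add: power_mult_distrib power2_eq_square powr_add[symmetric])
      finally have L2: "(real (L x))\<^sup>2 \<le> 2 * c\<^sup>2 * x powr (2 * \<beta>) + 2" .
      have "\<Lambda> * x powr (- 1 / \<alpha>) * (4 * real (L x) * x)\<^sup>2 = 16 * \<Lambda> * (real (L x))\<^sup>2 * x powr (2 - 1 / \<alpha>)"
        using x by (simp add: power_mult_distrib powr_diff powr_minus_divide powr_numeral)
      also have "\<dots> \<le> 16 * \<Lambda> * (2 * c\<^sup>2 * x powr (2 * \<beta>) + 2) * x powr (2 - 1 / \<alpha>)"
        using \<Lambda> L2 by (intro mult_right_mono mult_left_mono) auto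
      also have "\<dots> = 32 * \<Lambda> * c\<^sup>2 * x powr (2 * \<beta> + (2 - 1 / \<alpha>)) + 32 * \<Lambda> * x powr (2 - 1 / \<alpha>)"
        unfolding powr_add by (simp add: algebra_simps)
      also have "\<dots> \<le> 32 * \<Lambda> * c\<^sup>2 * x powr 0 + (1 / 16) * x powr 0"
        using \<Lambda> x \<beta>(2) le by (intro add_mono mult_left_mono powr_mono) auto
      also have "\<dots> = 1 / 8" using \<Lambda> x c(3) by simp
      finally show "\<Lambda> * x powr (- 1 / \<alpha>) * (4 * real (L x) * x)\<^sup>2 \<le> 1 / 8" .
    qed
  qed
  have ev_sob: "\<forall>\<^sub>F x in at_top. (a k x)\<^sup>2 * real (L x) * (1 + (4 * real (L x) * x)\<^sup>2) powr \<sigma> \<le> (1 / 2) ^ k" for k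
  proof -
    define C where "C = (real k + 1)\<^sup>2 / c * 128 powr \<sigma>"
    have "(2 * \<beta> + 2) * \<sigma> - (\<beta> + 2 * \<delta> / \<alpha>) < 0" using \<beta> by simp
    then have "\<forall>\<^sub>F x in at_top. C * x powr ((2 * \<beta> + 2) * \<sigma> - (\<beta> + 2 * \<delta> / \<alpha>)) \<le> (1 / 2) ^ k * x powr 0"
      by (rule eventually_powr_le_powr) simp
    with big show ?thesis
    proof eventually_elim
      fix x :: real assume x: "1 \<le> x" and le: "C * x powr ((2 * \<beta> + 2) * \<sigma> - (\<beta> + 2 * \<delta> / \<alpha>)) \<le> (1 / 2) ^ k * x powr 0"
      note Lx = L[OF x]
      have "1 * 1 \<le> real (L x) * x" using Lx(1) x by (intro mult_mono) auto
      then have "1 \<le> (4 * real (L x) * x)\<^sup>2" by (intro one_le_power) simp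
      then have "1 + (4 * real (L x) * x)\<^sup>2 \<le> 2 * (4 * real (L x) * x)\<^sup>2" by linarith
      also have "\<dots> \<le> 2 * (4 * (2 * x powr \<beta>) * x)\<^sup>2" using Lx(4) x by (intro mult_left_mono power_mono mult_right_mono) auto
      also have "\<dots> = 128 * x powr (2 * \<beta> + 2)"
        using x by (simp add: power_mult_distrib powr_add powr_numeral) (simp add: power2_eq_square powr_add[symmetric])
      finally have "(1 + (4 * real (L x) * x)\<^sup>2) powr \<sigma> \<le> (128 * x powr (2 * \<beta> + 2)) powr \<sigma>"
        using \<sigma> by (intro powr_mono2) (auto simp: add_nonneg_nonneg)
      also have "\<dots> = 128 powr \<sigma> * x powr ((2 * \<beta> + 2) * \<sigma>)" by (simp add: powr_mult powr_powr)
      finally have 1: "(1 + (4 * real (L x) * x)\<^sup>2) powr \<sigma> \<le> 128 powr \<sigma> * x powr ((2 * \<beta> + 2) * \<sigma>)" .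
      have "(a k x)\<^sup>2 * real (L x) = (real k + 1)\<^sup>2 / (real (L x) * x powr (2 * \<delta> / \<alpha>))"
        using Lx(1) x by (simp add: a_def power_divide power_mult_distrib power2_eq_square powr_add[symmetric])
      also have "\<dots> \<le> (real k + 1)\<^sup>2 / (c * x powr \<beta> * x powr (2 * \<delta> / \<alpha>))"
        using Lx(1,2) x c by (intro divide_left_mono mult_right_mono mult_pos_pos) auto
      also have "\<dots> = (real k + 1)\<^sup>2 / c * x powr (- (\<beta> + 2 * \<delta> / \<alpha>))"
        unfolding powr_minus_divide powr_add by simp
      finally have 2: "(a k x)\<^sup>2 * real (L x) \<le> (real k + 1)\<^sup>2 / c * x powr (- (\<beta> + 2 * \<delta> / \<alpha>))" .
      have "(a k x)\<^sup>2 * real (L x) * (1 + (4 * real (L x) * x)\<^sup>2) powr \<sigma>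
          \<le> ((real k + 1)\<^sup>2 / c * x powr (- (\<beta> + 2 * \<delta> / \<alpha>))) * (128 powr \<sigma> * x powr ((2 * \<beta> + 2) * \<sigma>))"
        using c by (intro mult_mono 1 2) auto
      also have "\<dots> = C * (x powr ((2 * \<beta> + 2) * \<sigma>) * x powr (- (\<beta> + 2 * \<delta> / \<alpha>)))"
        by (simp only: C_def mult_ac)
      also have "\<dots> = C * x powr ((2 * \<beta> + 2) * \<sigma> - (\<beta> + 2 * \<delta> / \<alpha>))" by (simp only: powr_add[symmetric] add_uminus_conv_diff)
      finally show "(a k x)\<^sup>2 * real (L x) * (1 + (4 * real (L x) * x)\<^sup>2) powr \<sigma> \<le> (1 / 2) ^ k"
        using le x by simp
    qed
  qed
  have evQ: "\<forall>\<^sub>F x in at_top. Q k x" for k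
    unfolding Q_def by (intro eventually_conj ev_phase ev_sob eventually_ge_at_top)
  have evP: "\<forall>\<^sub>F x in at_top. P j k r x" for j k r
  proof -
    define C1 where "C1 = (real k + 1) * (a j r * (real (L r) * (pi * (4 * real (L r) * r))))"
    define C2 where "C2 = (real k + 1) * (a j r * (real (L r) * (\<Lambda> * (4 * real (L r) * r)\<^sup>2)))"
    have exps: "- 1 < - \<delta> / \<alpha>" "- 1 / \<alpha> < - \<delta> / \<alpha>" using alpha delta by (auto simp: field_simps)
    have ev: "\<forall>\<^sub>F x in at_top. C1 * x powr (- 1) \<le> (1 / 2) * x powr (- \<delta> / \<alpha>)"
      "\<forall>\<^sub>F x in at_top. C2 * x powr (- 1 / \<alpha>) \<le> (1 / 2) * x powr (- \<delta> / \<alpha>)"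
      by (rule eventually_powr_le_powr[OF exps(1)], simp) (rule eventually_powr_le_powr[OF exps(2)], simp)
    have coarse: "\<forall>\<^sub>F x in at_top. (real k + 1) * (a j r * (real (L r) * (pi / x * (4 * real (L r) * r)
          + \<Lambda> * x powr (- 1 / \<alpha>) * (4 * real (L r) * r)\<^sup>2))) \<le> x powr (- \<delta> / \<alpha>)"
      using ev big
    proof eventually_elim
      fix x :: real assume le: "C1 * x powr (- 1) \<le> (1 / 2) * x powr (- \<delta> / \<alpha>)" "C2 * x powr (- 1 / \<alpha>) \<le> (1 / 2) * x powr (- \<delta> / \<alpha>)" and x: "1 \<le> x"
      have "(real k + 1) * (a j r * (real (L r) * (pi / x * (4 * real (L r) * r)
          + \<Lambda> * x powr (- 1 / \<alpha>) * (4 * real (L r) * r)\<^sup>2))) = C1 * (1 / x) + C2 * x powr (- 1 / \<alpha>)"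
        unfolding C1_def C2_def by (simp only: distrib_left times_divide_eq_left times_divide_eq_right mult_ac mult_1)
      also have "1 / x = x powr (- 1)" using x by (simp add: powr_minus_divide)
      finally show "(real k + 1) * (a j r * (real (L r) * (pi / x * (4 * real (L r) * r)
          + \<Lambda> * x powr (- 1 / \<alpha>) * (4 * real (L r) * r)\<^sup>2))) \<le> x powr (- \<delta> / \<alpha>)"
        using le by linarith
    qed
    have fine: "\<forall>\<^sub>F x in at_top. 0 < r \<longrightarrow> a k x * (2 * r powr (1 / \<alpha>) / x) \<le> (1 / 2) ^ k * r powr (- \<delta> / \<alpha>)"
    proof (cases "0 < r")
      case True
      have "\<forall>\<^sub>F x in at_top. (real k + 1) * (2 * r powr (1 / \<alpha>)) * x powr (- 1) \<le> ((1 / 2) ^ k * r powr (- \<delta> / \<alpha>)) * x powr 0"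
        using True by (intro eventually_powr_le_powr) auto
      with big show ?thesis
      proof eventually_elim
        fix x :: real assume x: "1 \<le> x"
          and le: "(real k + 1) * (2 * r powr (1 / \<alpha>)) * x powr (- 1) \<le> ((1 / 2) ^ k * r powr (- \<delta> / \<alpha>)) * x powr 0"
        have "1 \<le> x powr (\<delta> / \<alpha>)" using x alpha delta by (intro ge_one_powr_ge_zero) auto
        then have "1 * 1 \<le> real (L x) * x powr (\<delta> / \<alpha>)" using L(1)[OF x] by (intro mult_mono) auto
        then have "a k x \<le> (real k + 1) / 1" unfolding a_def by (intro divide_left_mono) auto
        then have "a k x * (2 * r powr (1 / \<alpha>) / x) \<le> (real k + 1) * (2 * r powr (1 / \<alpha>) / x)"
          using x by (intro mult_right_mono) auto
        also have "\<dots> = (real k + 1) * (2 * r powr (1 / \<alpha>)) * x powr (- 1)" using x by (simp add: powr_minus_divide)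
        finally show "0 < r \<longrightarrow> a k x * (2 * r powr (1 / \<alpha>) / x) \<le> (1 / 2) ^ k * r powr (- \<delta> / \<alpha>)"
          using le x by simp
      qed
    qed simp
    have sep: "\<forall>\<^sub>F x in at_top. 4 * real (L r) * r \<le> real (L x) * x"
      using eventually_ge_at_top[of "4 * real (L r) * r"] big
    proof eventually_elim
      fix x :: real assume le: "4 * real (L r) * r \<le> x" and x: "1 \<le> x"
      note le
      also have "x \<le> real (L x) * x" using L(1)[OF x] x by (simp add: mult_le_cancel_right1)
      finally show "4 * real (L r) * r \<le> real (L x) * x" .
    qed
    show ?thesis unfolding P_def using coarse fine sep by eventually_elim blast
  qed
  obtain R where R: "\<And>k. Q k (R k)" "\<And>j k. j < k \<Longrightarrow> P j k (R j) (R k)"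
    by (rule ex_sequence_of_eventually[of Q P, OF evQ evP]) (rule that)
  have R1: "1 \<le> R k" for k using R(1)[of k] pi_gt3 by (simp add: Q_def)
  have sob: "(a k (R k))\<^sup>2 * real (L (R k)) * (1 + (4 * real (L (R k)) * R k)\<^sup>2) powr \<sigma> \<le> (1 / 2) ^ k" for k
    using R(1)[of k] by (simp add: Q_def)
  \<comment> \<open>The Sobolev bound already contains this, because the number of teeth and the
    weight are at least 1.\<close>
  have a1: "a k (R k) \<le> 1" for k
  proof -
    have "1 \<le> (1 + (4 * real (L (R k)) * R k)\<^sup>2) powr \<sigma>" using \<sigma> by (intro ge_one_powr_ge_zero) auto
    then have "1 * 1 \<le> real (L (R k)) * (1 + (4 * real (L (R k)) * R k)\<^sup>2) powr \<sigma>"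
      using L(1)[OF R1] by (intro mult_mono) auto
    then have "(a k (R k))\<^sup>2 * 1 \<le> (a k (R k))\<^sup>2 * (real (L (R k)) * (1 + (4 * real (L (R k)) * R k)\<^sup>2) powr \<sigma>)"
      by (intro mult_left_mono) auto
    also have "\<dots> \<le> (1 / 2) ^ k" using sob[of k] by (simp add: mult.assoc)
    also have "\<dots> \<le> 1" by (rule power_le_one) auto
    finally show ?thesis using power2_le_imp_le[of "a k (R k)" 1] by simp
  qed
  have "lacunary_combs \<alpha> \<delta> R (\<lambda>k. L (R k)) (\<lambda>k. a k (R k)) \<Lambda>"
  proof
    show "4 * real (L (R j)) * R j \<le> real (L (R k)) * R k"
      "a k (R k) * (2 * R j powr (1 / \<alpha>) / R k) \<le> (1 / 2) ^ k * R j powr (- \<delta> / \<alpha>)"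
      "(real k + 1) * (a j (R j) * (real (L (R j)) * (pi / R k * (4 * real (L (R j)) * R j)
          + \<Lambda> * R k powr (- 1 / \<alpha>) * (4 * real (L (R j)) * R j)\<^sup>2))) \<le> R k powr (- \<delta> / \<alpha>)"
      if "j < k" for j k
      using R(2)[OF that] R1[of j] unfolding P_def by auto
    show "a k (R k) = (real k + 1) / (real (L (R k)) * R k powr (\<delta> / \<alpha>))" for k by (rule a_def)
  qed (use alpha delta \<Lambda>_def R(1) a1 L(1)[OF R1] in \<open>auto simp: Q_def\<close>)
  then show ?thesis using sob unfolding \<Lambda>_def by (rule that)
qed

text \<open>Orders below 0 are covered by raising \<open>s\<close> to some
  \<open>\<sigma> \<ge> 0\<close> still below \<open>s_crit \<alpha> \<delta>\<close>, which only
  strengthens the integrability. Convergence then fails at every point of an interval of positive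
  length.\<close>

lemma power_curve_counterexample:
  assumes alpha: "0 < \<alpha>" "\<alpha> \<le> 1 / 4" and delta: "0 \<le> \<delta>" "\<delta> < \<alpha>" and s: "s < s_crit \<alpha> \<delta>"
  obtains f where "f \<in> sobolev s" "\<not> (AE x in lborel. converges_with_rate (power_curve \<alpha>) \<delta> f x)"
proof -
  have "0 < s_crit \<alpha> \<delta>" using s_crit_ge[OF alpha delta] alpha delta by auto
  then obtain \<sigma> where \<sigma>: "0 \<le> \<sigma>" "s \<le> \<sigma>" "\<sigma> < s_crit \<alpha> \<delta>" using s that[of "max 0 s"] by auto
  obtain R L a where "lacunary_combs \<alpha> \<delta> R L a ((5 * pi) powr (1 / \<alpha>))"
    and sob: "\<And>k. (a k)\<^sup>2 * real (L k) * (1 + (4 * real (L k) * R k)\<^sup>2) powr \<sigma> \<le> (1 / 2) ^ k"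
    by (rule ex_lacunary_combs[OF alpha delta \<sigma>(1,3)]) (rule that)
  then interpret lacunary_combs \<alpha> \<delta> R L a "(5 * pi) powr (1 / \<alpha>)" by simp
  obtain f where f: "tempered f" "fourier_is_fun f g"
    by (rule ex_distribution_with_fourier[OF g_measurable norm_g_le])
  note [measurable] = fhat_AE_eq(2)[OF f(2)]
  have "integrable lborel (\<lambda>\<xi>. (norm ((1 + \<bar>\<xi>\<bar>\<^sup>2) powr (s / 2) *\<^sub>R fhat f \<xi>))\<^sup>2)"
  proof (rule Bochner_Integration.integrable_bound[OF integrable_weighted_g[OF \<sigma>(1) sob]])
    show "AE \<xi> in lborel. norm ((norm ((1 + \<bar>\<xi>\<bar>\<^sup>2) powr (s / 2) *\<^sub>R fhat f \<xi>))\<^sup>2) \<le> norm ((1 + \<xi>\<^sup>2) powr \<sigma> * (cmod (g \<xi>))\<^sup>2)"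
      using fhat_AE_eq(1)[OF f(2)]
    proof eventually_elim
      fix \<xi> assume eq: "fhat f \<xi> = g \<xi>"
      have "((1 + \<xi>\<^sup>2) powr (s / 2))\<^sup>2 = (1 + \<xi>\<^sup>2) powr s" by (simp add: power2_eq_square powr_add[symmetric])
      also have "\<dots> \<le> (1 + \<xi>\<^sup>2) powr \<sigma>" using \<sigma>(2) by (intro powr_mono) auto
      finally show "norm ((norm ((1 + \<bar>\<xi>\<bar>\<^sup>2) powr (s / 2) *\<^sub>R fhat f \<xi>))\<^sup>2) \<le> norm ((1 + \<xi>\<^sup>2) powr \<sigma> * (cmod (g \<xi>))\<^sup>2)"
        by (simp add: eq power_mult_distrib mult_right_mono)
    qed
  qed measurable
  then have "f \<in> sobolev s" using f by (auto simp: sobolev_def)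
  moreover have "\<not> (AE x in lborel. converges_with_rate (power_curve \<alpha>) \<delta> f x)"
  proof
    assume "AE x in lborel. converges_with_rate (power_curve \<alpha>) \<delta> f x"
    then have "AE x in lborel. x \<notin> {0<..<1 / 2 :: real}"
      by eventually_elim (use not_converges_with_rate[OF f(2)] in auto)
    then have "emeasure lborel {0<..<1 / 2 :: real} = 0"
      by (subst (asm) AE_iff_measurable[of "{0<..<1 / 2 :: real}"]) auto
    then show False by simp
  qed
  ultimately show ?thesis by (rule that)
qed

theorem theorem1p3:
  fixes \<alpha> \<delta> :: real
  assumes "0 < \<alpha>" and "\<alpha> \<le> 1 / 4" and "0 \<le> \<delta>" and "\<delta> < \<alpha>"
  shows "(\<forall>\<gamma>. admissible_curve \<alpha> \<gamma> \<longrightarrow>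
            (\<forall>s > s_crit \<alpha> \<delta>. \<forall>f \<in> sobolev s. AE x in lborel. converges_with_rate \<gamma> \<delta> f x))
       \<and> (\<exists>\<gamma>. admissible_curve \<alpha> \<gamma> \<and>
            (\<forall>s < s_crit \<alpha> \<delta>.
               \<not> (\<forall>f \<in> sobolev s. AE x in lborel. converges_with_rate \<gamma> \<delta> f x)))"
proof (intro conjI allI impI ballI)
  fix \<gamma> s f assume "admissible_curve \<alpha> \<gamma>" "s_crit \<alpha> \<delta> < s" "f \<in> sobolev s"
  then obtain C1 C3 where "holder_curve \<alpha> \<gamma> C1 C3"
    using admissible_curve_imp_holder_curve[OF assms(1,2)] by metis
  then interpret holder_curve \<alpha> \<gamma> C1 C3 .
  show "AE x in lborel. converges_with_rate \<gamma> \<delta> f x"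
    by (rule AE_converges_with_rate) fact+
next
  show "\<exists>\<gamma>. admissible_curve \<alpha> \<gamma> \<and>
      (\<forall>s < s_crit \<alpha> \<delta>. \<not> (\<forall>f \<in> sobolev s. AE x in lborel. converges_with_rate \<gamma> \<delta> f x))"
    using admissible_power_curve[OF assms(1,2)] power_curve_counterexample[OF assms] by metis
qed


end
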